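(* $(D_G,y_G)$ is a generic $\mathbf{LE}_b$-dominating real (that is, $\mathbb{LE}_b$ forces that $D_G$ is an infinite subset of $\omega$, $y_G\in\prod_{n<\omega}b(n)$, and $x\neq^*(D_G,y_G)$ for every ground-model $x\in\prod_{n<\omega}b(n)$), and hence $\mathbb{LE}_b$ increases $\mathfrak b(\mathbf{LE}_b)$ (by iteration).
   Context: Fix $b\in\omega^\omega$ with $b(n)\geq2^n$ for all $n<\omega$, and write $\prod b=\prod_{n<\omega}b(n)$. The relational system $\mathbf{LE}_b$: for $x,y\in\prod b$ and an infinite set $D\subseteq\omega$, $x\neq^*(D,y)$ means that $x(n)\neq y(n)$ for all but finitely many $n\in D$. Let $\mathbf{LE}_b=\langle\prod b,\,[\omega]^\omega\times\prod b,\,\neq^*\rangle$, where $[\omega]^\omega$ is the set of infinite subsets of $\omega$. Its bounding number $\mathfrak b(\mathbf{LE}_b)$ is the least size of a set $F\subseteq\prod b$ such that no single $(D,y)\in[\omega]^\omega\times\prod b$ satisfies $x\neq^*(D,y)$ for all $x\in F$. The poset $\mathbb{LE}_b$: conditions are triples $(d,s,\varphi)$ with $d\in2^{<\omega}$, $s\in\prod_{n<|d|}b(n)$, $\varphi\in\prod_{n<\omega}\mathcal P(b(n))$ such that for some $k<\omega$, $\frac{|\varphi(n)|}{b(n)}\leq 2^{-n/2^k}$ for all $n\geq|d|$. The order is: $(d',s',\varphi')\leq(d,s,\varphi)$ if $d'\supseteq d$, $s'\supseteq s$, $\varphi'(n)\supseteq\varphi(n)$ for all $n<\omega$, and $s'(n)\notin\varphi(n)$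 for all $n\in(d')^{-1}(\{1\})\setminus d^{-1}(\{1\})$. For a generic filter $G$, in $V[G]$ let $D_G=\bigcup_{(d,s,\varphi)\in G}d^{-1}(\{1\})$ and $y_G=\bigcup_{(d,s,\varphi)\in G}s$. *)

theory Defs
  imports Complex_Main "HOL-Library.Sublist"
begin

unbundle cardinal_syntax

section \<open>The forcing relation\<close>

text \<open>
  The ground model is the ambient universe of HOL.  A forcing notion is given by its (pre)order
  relation \<open>R\<close>, where \<open>(q, p) \<in> R\<close> means that \<open>q\<close> is stronger than \<open>p\<close>; the set of
  conditions is \<open>Field R\<close>.

  Every subset, in an extension, of a ground-model set \<open>A\<close> has a name contained in the product of
  the set of check names of elements of \<open>A\<close> with the set of conditions.  Dropping the
  checks, such a name is a set of pairs (element of \<open>A\<close>, condition).  Functions in the extension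
  between ground-model sets are identified with their graphs.
\<close>

type_synonym ('a, 'p) name = "('a \<times> 'p) set"

definition val :: "('a, 'p) name \<Rightarrow> 'p set \<Rightarrow> 'a set" where
  "val \<tau> G = {a. \<exists>p\<in>G. (a, p) \<in> \<tau>}"

definition check :: "'p rel \<Rightarrow> 'a set \<Rightarrow> ('a, 'p) name" where
  "check R A = A \<times> Field R"

text \<open>
  Sentences of the forcing language are represented by their forcing relation: \<open>\<phi> R p\<close> is
  ``\<open>p\<close> forces \<open>\<phi>\<close> in the forcing notion \<open>R\<close>''.  The clauses below are the usual recursive clauses
  of the forcing relation.  Quantifiers range over a HOL type: over a type of
  ground-model objects this is a quantifier bounded by a ground-model set, over a type of names it
  is a quantifier over the corresponding power set of the extension.
\<close>

type_synonym 'p sentence = "'p rel \<Rightarrow> 'p \<Rightarrow> bool"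

text \<open>A statement about ground-model objects, evaluated in the ground model.\<close>
definition fGr :: "bool \<Rightarrow> 'p sentence" ("\<langle>_\<rangle>") where
  "\<langle>Q\<rangle> = (\<lambda>R p. Q)"

definition fmem :: "'a \<Rightarrow> ('a, 'p) name \<Rightarrow> 'p sentence" (infix "\<^bold>\<in>" 50) where
  "(a \<^bold>\<in> \<tau>) = (\<lambda>R p. \<forall>q. (q, p) \<in> R \<longrightarrow> (\<exists>r t. (r, q) \<in> R \<and> (a, t) \<in> \<tau> \<and> (r, t) \<in> R))"

definition fnot :: "'p sentence \<Rightarrow> 'p sentence" ("\<^bold>\<not> _" [40] 40) where
  "(\<^bold>\<not> \<phi>) = (\<lambda>R p. \<forall>q. (q, p) \<in> R \<longrightarrow> \<not> \<phi> R q)"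

definition fand :: "'p sentence \<Rightarrow> 'p sentence \<Rightarrow> 'p sentence" (infixr "\<^bold>\<and>" 35) where
  "(\<phi> \<^bold>\<and> \<psi>) = (\<lambda>R p. \<phi> R p \<and> \<psi> R p)"

definition fimp :: "'p sentence \<Rightarrow> 'p sentence \<Rightarrow> 'p sentence" (infixr "\<^bold>\<longrightarrow>" 25) where
  "(\<phi> \<^bold>\<longrightarrow> \<psi>) = (\<^bold>\<not> (\<phi> \<^bold>\<and> \<^bold>\<not> \<psi>))"

definition fiff :: "'p sentence \<Rightarrow> 'p sentence \<Rightarrow> 'p sentence" (infixr "\<^bold>\<longleftrightarrow>" 25) where
  "(\<phi> \<^bold>\<longleftrightarrow> \<psi>) = ((\<phi> \<^bold>\<longrightarrow> \<psi>) \<^bold>\<and> (\<psi> \<^bold>\<longrightarrow> \<phi>))"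

definition fall :: "('x \<Rightarrow> 'p sentence) \<Rightarrow> 'p sentence" (binder "\<^bold>\<forall>" 10) where
  "(\<^bold>\<forall>x. \<phi> x) = (\<lambda>R p. \<forall>x. \<phi> x R p)"

definition fex :: "('x \<Rightarrow> 'p sentence) \<Rightarrow> 'p sentence" (binder "\<^bold>\<exists>" 10) where
  "(\<^bold>\<exists>x. \<phi> x) = (\<lambda>R p. \<forall>q. (q, p) \<in> R \<longrightarrow> (\<exists>r x. (r, q) \<in> R \<and> \<phi> x R r))"

definition forced :: "'p rel \<Rightarrow> 'p sentence \<Rightarrow> bool" (infix "\<tturnstile>" 20) where
  "(R \<tturnstile> \<phi>) \<longleftrightarrow> (\<forall>p\<in>Field R. \<phi> R p)"


section \<open>The relational system LE\<close>

definition prod_b :: "(nat \<Rightarrow> nat) \<Rightarrow> (nat \<Rightarrow> nat) set" where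
  "prod_b b = {x. \<forall>n. x n < b n}"

definition graph_of :: "('a \<Rightarrow> 'b) \<Rightarrow> ('a \<times> 'b) set" where
  "graph_of x = {(n, m). m = x n}"

definition f_infinite :: "(nat, 'p) name \<Rightarrow> 'p sentence" where
  "f_infinite D = (\<^bold>\<forall>k. \<^bold>\<exists>n. \<langle>k \<le> n\<rangle> \<^bold>\<and> n \<^bold>\<in> D)"

text \<open>``\<open>y\<close> is (the graph of) an element of \<open>\<Prod>b\<close>''\<close>
definition f_prod_b :: "(nat \<Rightarrow> nat) \<Rightarrow> (nat \<times> nat, 'p) name \<Rightarrow> 'p sentence" where
  "f_prod_b b y =
     (\<^bold>\<forall>n. \<^bold>\<exists>m. \<langle>m < b n\<rangle> \<^bold>\<and> (n, m) \<^bold>\<in> y \<^bold>\<and> (\<^bold>\<forall>m'. (n, m') \<^bold>\<in> y \<^bold>\<longrightarrow> \<langle>m' = m\<rangle>))"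

text \<open>\<open>x \<noteq>\<^sup>* (D, y)\<close>: \<open>x(n) \<noteq> y(n)\<close> for all but finitely many \<open>n \<in> D\<close>\<close>
definition f_neq_star ::
    "(nat \<times> nat, 'p) name \<Rightarrow> (nat, 'p) name \<Rightarrow> (nat \<times> nat, 'p) name \<Rightarrow> 'p sentence" where
  "f_neq_star x D y =
     (\<^bold>\<exists>N. \<^bold>\<forall>n. \<langle>N \<le> n\<rangle> \<^bold>\<and> n \<^bold>\<in> D \<^bold>\<longrightarrow> (\<^bold>\<not> (\<^bold>\<exists>m. (n, m) \<^bold>\<in> x \<^bold>\<and> (n, m) \<^bold>\<in> y)))"

text \<open>
  ``The bounding number of LE is at least \<open>\<theta>\<close>'', where \<open>\<theta>\<close> is the order type of the well-order
  \<open>r\<close>: every set of fewer than \<open>\<theta>\<close> elements of \<open>\<Prod>b\<close> is bounded by a single pair \<open>(D, y)\<close>.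
  In the extension, a nonempty set has size less than \<open>\<theta>\<close> iff it is the range of
  a sequence indexed by some ordinal \<open>\<lambda> < \<theta>\<close>, and such ordinals correspond to the elements \<open>l\<close> of
  \<open>Field r\<close>.  The name \<open>X\<close> denotes a subset of \<open>\<lambda> \<times> (\<omega> \<times> \<omega>)\<close>, that is, a sequence of subsets
  of \<open>\<omega> \<times> \<omega>\<close>.
\<close>

definition section_name :: "('i \<times> 'a, 'p) name \<Rightarrow> 'i \<Rightarrow> ('a, 'p) name" where
  "section_name X i = {(a, p). ((i, a), p) \<in> X}"

definition f_bounding_ge :: "(nat \<Rightarrow> nat) \<Rightarrow> 'i rel \<Rightarrow> 'p sentence" where
  "f_bounding_ge b r =
     (\<^bold>\<forall>l. \<^bold>\<forall>X :: ('i \<times> nat \<times> nat, 'p) name.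
        \<langle>l \<in> Field r\<rangle> \<^bold>\<and> (\<^bold>\<forall>i. \<langle>i \<in> underS r l\<rangle> \<^bold>\<longrightarrow> f_prod_b b (section_name X i)) \<^bold>\<longrightarrow>
        (\<^bold>\<exists>D. \<^bold>\<exists>y. f_infinite D \<^bold>\<and> f_prod_b b y \<^bold>\<and>
           (\<^bold>\<forall>i. \<langle>i \<in> underS r l\<rangle> \<^bold>\<longrightarrow> f_neq_star (section_name X i) D y)))"


section \<open>The forcing notion LE\<close>

text \<open>Elements of \<open>2\<^sup><\<^sup>\<omega>\<close> are lists of Booleans, \<open>True\<close> standing for 1.\<close>

type_synonym cond = "bool list \<times> nat list \<times> (nat \<Rightarrow> nat set)"

definition ones :: "bool list \<Rightarrow> nat set" where
  "ones d = {n. n < length d \<and> d ! n}"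

definition LE_cond :: "(nat \<Rightarrow> nat) \<Rightarrow> cond set" where
  "LE_cond b = {(d, s, \<phi>).
     length s = length d \<and> (\<forall>n < length d. s ! n < b n) \<and> (\<forall>n. \<phi> n \<subseteq> {..<b n}) \<and>
     (\<exists>k::nat. \<forall>n \<ge> length d. real (card (\<phi> n)) / real (b n) \<le> 2 powr (- (real n / 2 ^ k)))}"

definition LE_order :: "(nat \<Rightarrow> nat) \<Rightarrow> cond rel" where
  "LE_order b = {((d', s', \<phi>'), (d, s, \<phi>)).
     (d', s', \<phi>') \<in> LE_cond b \<and> (d, s, \<phi>) \<in> LE_cond b \<and>
     prefix d d' \<and> prefix s s' \<and> (\<forall>n. \<phi> n \<subseteq> \<phi>' n) \<and>
     (\<forall>n \<in> ones d' - ones d. s' ! n \<notin> \<phi> n)}"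

lemma Field_LE_order: "Field (LE_order b) = LE_cond b"
  by (auto simp: Field_def LE_order_def)

definition D_gen :: "cond set \<Rightarrow> nat set" where
  "D_gen G = (\<Union>(d, s, \<phi>)\<in>G. ones d)"

definition y_gen :: "cond set \<Rightarrow> (nat \<times> nat) set" where
  "y_gen G = (\<Union>(d, s, \<phi>)\<in>G. {(n, s ! n) |n. n < length s})"

definition D_name :: "(nat \<Rightarrow> nat) \<Rightarrow> (nat, cond) name" where
  "D_name b = {(n, (d, s, \<phi>)) |n d s \<phi>. (d, s, \<phi>) \<in> LE_cond b \<and> n \<in> ones d}"

definition y_name :: "(nat \<Rightarrow> nat) \<Rightarrow> (nat \<times> nat, cond) name" where
  "y_name b = {((n, s ! n), (d, s, \<phi>)) |n d s \<phi>. (d, s, \<phi>) \<in> LE_cond b \<and> n < length s}"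

lemma val_D_name: "G \<subseteq> LE_cond b \<Longrightarrow> val (D_name b) G = D_gen G"
  by (fastforce simp: val_def D_name_def D_gen_def)

lemma val_y_name: "G \<subseteq> LE_cond b \<Longrightarrow> val (y_name b) G = y_gen G"
  by (fastforce simp: val_def y_name_def y_gen_def)


section \<open>Finite support iteration of LE\<close>

text \<open>
  In an extension, a condition \<open>(d, s, \<phi>)\<close> of LE is coded by the set consisting of
  \<open>Inl (d, s)\<close> and of all \<open>Inr (n, m)\<close> with \<open>m \<in> \<phi>(n)\<close>.  Thus names of conditions are names of
  subsets of the ground-model set \<open>code\<close>.
\<close>

type_synonym code = "(bool list \<times> nat list) + (nat \<times> nat)"

definition code_of :: "cond \<Rightarrow> code set" where
  "code_of = (\<lambda>(d, s, \<phi>). insert (Inl (d, s)) {Inr (n, m) |n m. m \<in> \<phi> n})"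

text \<open>
  ``\<open>\<tau>\<close> codes a condition of LE'', as interpreted in the extension.  The finite set \<open>\<phi>(n)\<close>
  belongs to the ground model, whence the quantifier over \<open>A\<close>.
\<close>
definition f_LE_cond :: "(nat \<Rightarrow> nat) \<Rightarrow> (code, 'p) name \<Rightarrow> 'p sentence" where
  "f_LE_cond b \<tau> =
     (\<^bold>\<exists>d. \<^bold>\<exists>s. Inl (d, s) \<^bold>\<in> \<tau> \<^bold>\<and> (\<^bold>\<forall>d'. \<^bold>\<forall>s'. Inl (d', s') \<^bold>\<in> \<tau> \<^bold>\<longrightarrow> \<langle>d' = d \<and> s' = s\<rangle>) \<^bold>\<and>
        \<langle>length s = length d \<and> (\<forall>n < length d. s ! n < b n)\<rangle> \<^bold>\<and>
        (\<^bold>\<forall>n. \<^bold>\<forall>m. Inr (n, m) \<^bold>\<in> \<tau> \<^bold>\<longrightarrow> \<langle>m < b n\<rangle>) \<^bold>\<and>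
        (\<^bold>\<exists>k::nat. \<^bold>\<forall>n. \<langle>length d \<le> n\<rangle> \<^bold>\<longrightarrow>
           (\<^bold>\<exists>A. (\<^bold>\<forall>m. Inr (n, m) \<^bold>\<in> \<tau> \<^bold>\<longleftrightarrow> \<langle>m \<in> A\<rangle>) \<^bold>\<and>
              \<langle>real (card A) / real (b n) \<le> 2 powr (- (real n / 2 ^ k))\<rangle>)))"

text \<open>``\<open>\<sigma>\<close> is stronger than \<open>\<tau>\<close>''\<close>
definition f_LE_le :: "(code, 'p) name \<Rightarrow> (code, 'p) name \<Rightarrow> 'p sentence" where
  "f_LE_le \<sigma> \<tau> =
     (\<^bold>\<forall>d'. \<^bold>\<forall>s'. \<^bold>\<forall>d. \<^bold>\<forall>s. Inl (d', s') \<^bold>\<in> \<sigma> \<^bold>\<and> Inl (d, s) \<^bold>\<in> \<tau> \<^bold>\<longrightarrow>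
        \<langle>prefix d d' \<and> prefix s s'\<rangle> \<^bold>\<and>
        (\<^bold>\<forall>n. \<^bold>\<forall>m. Inr (n, m) \<^bold>\<in> \<tau> \<^bold>\<longrightarrow> Inr (n, m) \<^bold>\<in> \<sigma>) \<^bold>\<and>
        (\<^bold>\<forall>n. \<langle>n \<in> ones d' - ones d\<rangle> \<^bold>\<longrightarrow> (\<^bold>\<not> Inr (n, s' ! n) \<^bold>\<in> \<tau>)))"

text \<open>On check names, the two sentences agree with the definitions in the ground model.\<close>

context
  fixes R :: "'p rel"
  assumes refl: "\<And>p. p \<in> Field R \<Longrightarrow> (p, p) \<in> R"
begin

lemma forces_check_mem: "p \<in> Field R \<Longrightarrow> (a \<^bold>\<in> check R A) R p \<longleftrightarrow> a \<in> A"
  using refl unfolding fmem_def check_def by (blast intro: FieldI1)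

private lemma decide:
  "(\<And>q. q \<in> Field R \<Longrightarrow> \<phi> R q \<longleftrightarrow> A) \<Longrightarrow> (\<And>q. q \<in> Field R \<Longrightarrow> \<psi> R q \<longleftrightarrow> B) \<Longrightarrow> p \<in> Field R \<Longrightarrow>
     (\<phi> \<^bold>\<longrightarrow> \<psi>) R p \<longleftrightarrow> (A \<longrightarrow> B)"
  "(\<And>q. q \<in> Field R \<Longrightarrow> \<phi> R q \<longleftrightarrow> A) \<Longrightarrow> (\<And>q. q \<in> Field R \<Longrightarrow> \<psi> R q \<longleftrightarrow> B) \<Longrightarrow> p \<in> Field R \<Longrightarrow>
     (\<phi> \<^bold>\<and> \<psi>) R p \<longleftrightarrow> (A \<and> B)"
  "(\<And>q. q \<in> Field R \<Longrightarrow> \<phi> R q \<longleftrightarrow> A) \<Longrightarrow> p \<in> Field R \<Longrightarrow> (\<^bold>\<not> \<phi>) R p \<longleftrightarrow> \<not> A"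
  "(\<And>x q. q \<in> Field R \<Longrightarrow> \<chi> x R q \<longleftrightarrow> C x) \<Longrightarrow> p \<in> Field R \<Longrightarrow> (\<^bold>\<forall>x. \<chi> x) R p \<longleftrightarrow> (\<forall>x. C x)"
  "(\<And>x q. q \<in> Field R \<Longrightarrow> \<chi> x R q \<longleftrightarrow> C x) \<Longrightarrow> p \<in> Field R \<Longrightarrow> (\<^bold>\<exists>x. \<chi> x) R p \<longleftrightarrow> (\<exists>x. C x)"
  "\<langle>Q\<rangle> R p \<longleftrightarrow> Q"
  using refl unfolding fimp_def fnot_def fand_def fall_def fex_def fGr_def
  by (metis FieldI1)+

lemma forces_check_LE_cond:
  assumes "p \<in> Field R"
  shows "f_LE_cond b (check R (code_of c)) R p \<longleftrightarrow> c \<in> LE_cond b"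
proof -
  obtain d s \<phi> where c: "c = (d, s, \<phi>)" by (cases c)
  have "f_LE_cond b (check R (code_of c)) R p \<longleftrightarrow>
   (\<exists>d s. Inl (d, s) \<in> code_of c \<and> (\<forall>d' s'. Inl (d', s') \<in> code_of c \<longrightarrow> d' = d \<and> s' = s) \<and>
        (length s = length d \<and> (\<forall>n < length d. s ! n < b n)) \<and>
        (\<forall>n m. Inr (n, m) \<in> code_of c \<longrightarrow> m < b n) \<and>
        (\<exists>k::nat. \<forall>n. length d \<le> n \<longrightarrow>
           (\<exists>A. (\<forall>m. (Inr (n, m) \<in> code_of c \<longrightarrow> m \<in> A) \<and> (m \<in> A \<longrightarrow> Inr (n, m) \<in> code_of c)) \<and>
              real (card A) / real (b n) \<le> 2 powr (- (real n / 2 ^ k)))))"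
    unfolding f_LE_cond_def fiff_def
    by (rule decide forces_check_mem assms | assumption)+
  also have "\<dots> \<longleftrightarrow> c \<in> LE_cond b"
  proof -
    have "(\<forall>m. (m \<in> \<phi> n \<longrightarrow> m \<in> A) \<and> (m \<in> A \<longrightarrow> m \<in> \<phi> n)) \<longleftrightarrow> A = \<phi> n" for A n
      by blast
    then show ?thesis
      by (simp add: c code_of_def LE_cond_def) (auto simp: subset_iff)
  qed
  finally show ?thesis .
qed

lemma forces_check_LE_le:
  assumes "p \<in> Field R" "c' \<in> LE_cond b" "c \<in> LE_cond b"
  shows "f_LE_le (check R (code_of c')) (check R (code_of c)) R p \<longleftrightarrow> (c', c) \<in> LE_order b"
proof -
  obtain d s \<phi> d' s' \<phi>' where c: "c = (d, s, \<phi>)" "c' = (d', s', \<phi>')"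
    by (cases c, cases c')
  have "f_LE_le (check R (code_of c')) (check R (code_of c)) R p \<longleftrightarrow>
     (\<forall>d' s' d s. Inl (d', s') \<in> code_of c' \<and> Inl (d, s) \<in> code_of c \<longrightarrow>
        (prefix d d' \<and> prefix s s') \<and>
        (\<forall>n m. Inr (n, m) \<in> code_of c \<longrightarrow> Inr (n, m) \<in> code_of c') \<and>
        (\<forall>n. n \<in> ones d' - ones d \<longrightarrow> Inr (n, s' ! n) \<notin> code_of c))"
    unfolding f_LE_le_def
    by (rule decide forces_check_mem assms | assumption)+
  also have "\<dots> \<longleftrightarrow> (c', c) \<in> LE_order b"
    using assms(2,3) by (simp add: c code_of_def LE_order_def) (auto simp: subset_iff)
  finally show ?thesis .
qed

end

text \<open>
  A condition of the iteration is a partial function on the index set \<open>'i\<close> whose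
  values are names of conditions of LE.  To fit into a datatype, a name occurring inside a
  condition is given as a family, indexed by a type \<open>'k\<close>, of pairs (the value \<open>None\<close> allows for
  the empty name).  For any infinite \<open>'k\<close> this provides all countable names, which are enough
  since the iteration is ccc and LE-conditions are coded by reals; larger \<open>'k\<close> provide larger
  names.
\<close>

datatype ('i, 'k) icond = ICond (coords: "'i \<Rightarrow> ('k \<Rightarrow> (code \<times> ('i, 'k) icond) option) option")

definition nm :: "('k \<Rightarrow> (code \<times> ('i, 'k) icond) option) \<Rightarrow> (code, ('i, 'k) icond) name" where
  "nm f = {x. \<exists>j. f j = Some x}"

definition restr :: "'i rel \<Rightarrow> ('i, 'k) icond \<Rightarrow> 'i \<Rightarrow> ('i, 'k) icond" where
  "restr r p \<gamma> = ICond (coords p |` underS r \<gamma>)"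

text \<open>
  The stage of the iteration whose conditions have their (finite) supports contained in the
  initial segment \<open>A\<close> of the well-order \<open>r\<close>, given the stages \<open>I \<gamma>\<close> for \<open>\<gamma> \<in> A\<close>.  An index
  outside the support stands for the weakest condition of LE.
\<close>

definition stage_conds ::
    "(nat \<Rightarrow> nat) \<Rightarrow> 'i rel \<Rightarrow> 'i set \<Rightarrow> ('i \<Rightarrow> ('i, 'k) icond rel) \<Rightarrow> ('i, 'k) icond set" where
  "stage_conds b r A I =
     {p. finite (dom (coords p)) \<and> dom (coords p) \<subseteq> A \<and>
        (\<forall>\<gamma> \<tau>. coords p \<gamma> = Some \<tau> \<longrightarrow>
           restr r p \<gamma> \<in> Field (I \<gamma>) \<and> snd ` nm \<tau> \<subseteq> Field (I \<gamma>) \<and>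
           f_LE_cond b (nm \<tau>) (I \<gamma>) (restr r p \<gamma>))}"

definition stage_order ::
    "(nat \<Rightarrow> nat) \<Rightarrow> 'i rel \<Rightarrow> 'i set \<Rightarrow> ('i \<Rightarrow> ('i, 'k) icond rel) \<Rightarrow> ('i, 'k) icond rel" where
  "stage_order b r A I =
     {(q, p). q \<in> stage_conds b r A I \<and> p \<in> stage_conds b r A I \<and>
        dom (coords p) \<subseteq> dom (coords q) \<and>
        (\<forall>\<gamma> \<sigma> \<tau>. coords q \<gamma> = Some \<sigma> \<longrightarrow> coords p \<gamma> = Some \<tau> \<longrightarrow>
           f_LE_le (nm \<sigma>) (nm \<tau>) (I \<gamma>) (restr r q \<gamma>))}"

definition iter_stage :: "(nat \<Rightarrow> nat) \<Rightarrow> 'i rel \<Rightarrow> 'i \<Rightarrow> ('i, 'k) icond rel" where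
  "iter_stage b r = wfrec (r - Id) (\<lambda>I \<beta>. stage_order b r (underS r \<beta>) I)"

definition LE_iteration :: "(nat \<Rightarrow> nat) \<Rightarrow> 'i rel \<Rightarrow> ('i, 'k) icond rel" where
  "LE_iteration b r = stage_order b r (Field r) (iter_stage b r)"

lemma stage_order_cong:
  assumes "\<And>\<gamma>. \<gamma> \<in> A \<Longrightarrow> I \<gamma> = J \<gamma>"
  shows "stage_order b r A I = stage_order b r A J"
proof -
  have *: "I \<gamma> = J \<gamma>" if "dom (coords p) \<subseteq> A" "coords p \<gamma> = Some \<tau>"
    for p :: "('a, 'b) icond" and \<gamma> \<tau>
    using that assms by (auto simp: domIff)
  have "stage_conds b r A I = stage_conds b r A J"
    unfolding stage_conds_def using * by (intro Collect_cong conj_cong refl) auto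
  then show ?thesis
    unfolding stage_order_def using * by (auto simp: stage_conds_def)
qed

lemma iter_stage_unfold:
  assumes "Well_order r"
  shows "iter_stage b r \<beta> = stage_order b r (underS r \<beta>) (iter_stage b r)"
proof -
  have "wf (r - Id)"
    using assms by (simp add: well_order_on_def)
  then show ?thesis
    unfolding iter_stage_def
    by (subst wfrec) (auto intro!: stage_order_cong simp: underS_def cut_def)
qed

end

theory Submission
  imports Defs "HOL-Library.Countable_Set"
begin

text \<open>
  A condition \<open>(d, s, \<phi>)\<close> of LE can always be lengthened: for \<open>n > 0\<close> beyond the stem
  the set \<open>\<phi>(n)\<close> is a proper subset of \<open>b(n)\<close>, so \<open>n\<close> can be put into \<open>D\<close> with a value outside
  \<open>\<phi>(n)\<close>; hence \<open>D\<close> is infinite and \<open>y\<close> is total.  Given \<open>x\<close> in \<open>\<Prod>b\<close>, pad the stem with zeros up to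
  a length \<open>L\<close> and replace \<open>\<phi>\<close> by \<open>\<lambda>n. \<phi>(n) \<union> {x(n)}\<close>.  As \<open>b(n) \<ge> 2\<^sup>n\<close>, both summands are bounded by
  \<open>2 powr -n/2\<^sup>k\<close>, and twice this is at most \<open>2 powr -n/2\<^sup>k\<^sup>+\<^sup>1\<close> once \<open>n \<ge> 2\<^sup>k\<^sup>+\<^sup>1\<close>, so this is a
  condition; it forces \<open>y\<close> to avoid \<open>x\<close> on \<open>D\<close> from \<open>L\<close> on.  The same computation shows that two
  conditions with equal \<open>d\<close>, \<open>s\<close> and rate \<open>k\<close> are compatible.

  In the iteration, whose length \<open>\<theta>\<close> is a regular uncountable cardinal, let \<open>p\<close> force \<open>X\<close> to be a sequence of fewer than \<open>\<theta>\<close> members of \<open>\<Prod>b\<close>.  Each value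
  \<open>X\<^sub>i(n)\<close> is decided by the members of a maximal antichain below \<open>p\<close>.  The iteration is ccc, so all
  these antichains together have fewer than \<open>\<theta>\<close> members, and by regularity their finite supports are
  bounded by one coordinate \<open>\<gamma>\<close>.  Hence each \<open>X\<^sub>i\<close> has a countable name over stage \<open>\<gamma>\<close>, and the
  ground-model argument can be repeated over that stage: the name of the set of values of \<open>X\<^sub>i\<close> is
  united with the \<open>\<phi>\<close> of coordinate \<open>\<gamma>\<close>.  Thus the pair read off coordinate \<open>\<gamma>\<close> bounds all the
  \<open>X\<^sub>i\<close> (lemmas \<open>avoid_name\<close> and \<open>iteration_bounding\<close>).

  The countable chain condition (\<open>countable_antichain\<close>) is the usual one for finite support iterations
  of \<open>\<sigma>\<close>-linked posets: the conditions whose restrictions decide \<open>(d, s, k)\<close> at every coordinate of the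
  support are dense, two of them are compatible if these decisions agree on the common support, and
  finite partial functions into a countable set are ccc.

  Most computations inside the forcing language are replaced by computations with values of names.  A statement holds
  \<open>generically\<close> if countably many dense sets suffice to make it true of every filter meeting them;
  such filters exist without leaving the ground model.  For sentences built with quantifiers over
  countable types, \<open>p\<close> forces the sentence iff generically its evaluation holds in every filter containing
  \<open>p\<close> (\<open>forces_iff_generically\<close>).  Likewise, the sentences describing names of conditions of LE
  say that their values in the filter are (codes of) conditions, related by the order of LE.
\<close>

section \<open>Forcing and generic filters\<close>

locale forcing =
  fixes R :: "'p rel"
  assumes leq_refl: "p \<in> Field R \<Longrightarrow> (p, p) \<in> R"
    and leq_trans: "(p, q) \<in> R \<Longrightarrow> (q, s) \<in> R \<Longrightarrow> (p, s) \<in> R"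

definition dense_in :: "'p rel \<Rightarrow> 'p set \<Rightarrow> bool" where
  "dense_in R D \<longleftrightarrow> (\<forall>p\<in>Field R. \<exists>q\<in>D. (q, p) \<in> R)"

definition cond_filter :: "'p rel \<Rightarrow> 'p set \<Rightarrow> bool" where
  "cond_filter R G \<longleftrightarrow> G \<noteq> {} \<and> G \<subseteq> Field R \<and> (\<forall>p\<in>G. \<forall>q. (p, q) \<in> R \<longrightarrow> q \<in> G) \<and>
     (\<forall>p\<in>G. \<forall>q\<in>G. \<exists>s\<in>G. (s, p) \<in> R \<and> (s, q) \<in> R)"

text \<open>
  Closed under countable conjunctions, which is why countably many dense sets, rather than one filter
  meeting all dense sets, are the right notion: filters meeting countably many dense sets exist.
\<close>

definition generically :: "'p rel \<Rightarrow> ('p set \<Rightarrow> bool) \<Rightarrow> bool" where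
  "generically R P \<longleftrightarrow> (\<exists>\<D>. countable \<D> \<and> (\<forall>D\<in>\<D>. dense_in R D) \<and>
     (\<forall>G. cond_filter R G \<longrightarrow> (\<forall>D\<in>\<D>. G \<inter> D \<noteq> {}) \<longrightarrow> P G))"

lemma generically_mono:
  assumes "generically R P" "\<And>G. cond_filter R G \<Longrightarrow> P G \<Longrightarrow> Q G"
  shows "generically R Q"
  using assms unfolding generically_def by meson

lemma generically_filter: "generically R (cond_filter R)"
  unfolding generically_def by (rule exI[of _ "{}"]) auto

lemma generically_all:
  fixes P :: "'x::countable \<Rightarrow> 'p set \<Rightarrow> bool"
  assumes "\<And>x. generically R (P x)"
  shows "generically R (\<lambda>G. \<forall>x. P x G)"
proof -
  have "\<forall>x. \<exists>\<D>. countable \<D> \<and> (\<forall>D\<in>\<D>. dense_in R D) \<and>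
     (\<forall>G. cond_filter R G \<longrightarrow> (\<forall>D\<in>\<D>. G \<inter> D \<noteq> {}) \<longrightarrow> P x G)"
    using assms unfolding generically_def by blast
  then obtain \<D> where \<D>: "\<And>x. countable (\<D> x)" "\<And>x D. D \<in> \<D> x \<Longrightarrow> dense_in R D"
     "\<And>x G. cond_filter R G \<Longrightarrow> (\<forall>D\<in>\<D> x. G \<inter> D \<noteq> {}) \<Longrightarrow> P x G"
    by metis
  show ?thesis
    unfolding generically_def
    by (rule exI[of _ "\<Union>x. \<D> x"]) (use \<D> in auto)
qed

lemma generically_conj:
  assumes "generically R P" "generically R Q"
  shows "generically R (\<lambda>G. P G \<and> Q G)"
proof -
  have "generically R (\<lambda>G. \<forall>x. (if x then P else Q) G)"
    by (rule generically_all) (use assms in auto)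
  then show ?thesis by (rule generically_mono) (metis (full_types))
qed

lemma cond_filter_up: "cond_filter R G \<Longrightarrow> p \<in> G \<Longrightarrow> (p, q) \<in> R \<Longrightarrow> q \<in> G"
  unfolding cond_filter_def by blast

lemma cond_filter_directed:
  "cond_filter R G \<Longrightarrow> p \<in> G \<Longrightarrow> q \<in> G \<Longrightarrow> \<exists>s\<in>G. (s, p) \<in> R \<and> (s, q) \<in> R"
  unfolding cond_filter_def by blast

text \<open>
  A sentence is regular if the set of conditions forcing it is a regular open set: closed downwards, and
  containing every condition below which it is dense.  All sentences of the forcing language are regular.
\<close>

definition regular :: "'p rel \<Rightarrow> 'p sentence \<Rightarrow> bool" where
  "regular R \<phi> \<longleftrightarrow> (\<forall>p q. \<phi> R p \<longrightarrow> (q, p) \<in> R \<longrightarrow> \<phi> R q) \<and>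
     (\<forall>p\<in>Field R. (\<forall>q. (q, p) \<in> R \<longrightarrow> (\<exists>s. (s, q) \<in> R \<and> \<phi> R s)) \<longrightarrow> \<phi> R p)"

lemma regular_mono: "regular R \<phi> \<Longrightarrow> \<phi> R p \<Longrightarrow> (q, p) \<in> R \<Longrightarrow> \<phi> R q"
  unfolding regular_def by blast

lemma regular_local:
  "regular R \<phi> \<Longrightarrow> p \<in> Field R \<Longrightarrow> (\<And>q. (q, p) \<in> R \<Longrightarrow> \<exists>s. (s, q) \<in> R \<and> \<phi> R s) \<Longrightarrow> \<phi> R p"
  unfolding regular_def by blast

text \<open>
  The truth lemma for \<open>\<phi>\<close>, with \<open>\<Phi>\<close> as the evaluation of \<open>\<phi>\<close> in a filter.
\<close>

definition mirrors :: "'p rel \<Rightarrow> 'p sentence \<Rightarrow> ('p set \<Rightarrow> bool) \<Rightarrow> bool" where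
  "mirrors R \<phi> \<Phi> \<longleftrightarrow> generically R (\<lambda>G. (\<exists>p\<in>G. \<phi> R p) \<longleftrightarrow> \<Phi> G)"

context forcing
begin

text \<open>
  The Rasiowa--Sikorski lemma: enumerate the dense sets, choose a descending sequence
  of conditions meeting them one after the other, and take the filter that it generates.
\<close>

lemma generic_exists:
  assumes "generically R P" "p \<in> Field R"
  obtains G where "cond_filter R G" "p \<in> G" "P G"
proof -
  from assms(1) obtain \<D> where \<D>: "countable \<D>" "\<And>D. D \<in> \<D> \<Longrightarrow> dense_in R D"
    "\<And>G. cond_filter R G \<Longrightarrow> (\<forall>D\<in>\<D>. G \<inter> D \<noteq> {}) \<Longrightarrow> P G"
    unfolding generically_def by blast
  \<comment> \<open>If there is nothing to meet, every step is free; the whole forcing notion is dense.\<close>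
  define E where "E n = (if \<D> = {} then Field R else from_nat_into \<D> n)" for n
  have E: "dense_in R (E n)" for n
    using \<D>(2) from_nat_into[of \<D>] leq_refl unfolding E_def dense_in_def by (cases "\<D> = {}") (simp, blast, simp)
  obtain f where f: "f 0 = p" "\<And>n. f (Suc n) \<in> E n \<and> (f (Suc n), f n) \<in> R"
  proof -
    have "\<exists>f. \<forall>n. (f n \<in> Field R \<and> (n = 0 \<longrightarrow> f n = p)) \<and> (f (Suc n) \<in> E n \<and> (f (Suc n), f n) \<in> R)"
    proof (rule dependent_nat_choice)
      show "\<exists>x. x \<in> Field R \<and> (0 = (0::nat) \<longrightarrow> x = p)" using assms(2) by blast
      fix x and n :: nat assume "x \<in> Field R \<and> (n = 0 \<longrightarrow> x = p)"
      then show "\<exists>y. (y \<in> Field R \<and> (Suc n = 0 \<longrightarrow> y = p)) \<and> y \<in> E n \<and> (y, x) \<in> R"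
        using E[of n] unfolding dense_in_def by (metis FieldI1 nat.distinct(1))
    qed
    then show ?thesis using that by metis
  qed
  have fF: "f n \<in> Field R" for n
    using f(2)[of n] by (auto intro: FieldI2)
  have dec: "m \<le> n \<Longrightarrow> (f n, f m) \<in> R" for m n
    by (induction n rule: dec_induct) (use fF leq_refl f(2) leq_trans in blast)+
  define G where "G = {q. \<exists>n. (f n, q) \<in> R}"
  have fG: "f n \<in> G" for n unfolding G_def using leq_refl fF by blast
  have G: "cond_filter R G"
    unfolding cond_filter_def
  proof (intro conjI ballI allI impI)
    show "G \<noteq> {}" using fG by blast
    show "G \<subseteq> Field R" by (auto simp: G_def intro: FieldI2)
    show "q \<in> G" if "p \<in> G" "(p, q) \<in> R" for p q
      using that leq_trans by (auto simp: G_def)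
    fix q q' assume "q \<in> G" "q' \<in> G"
    then obtain m n where "(f m, q) \<in> R" "(f n, q') \<in> R" by (auto simp: G_def)
    then show "\<exists>s\<in>G. (s, q) \<in> R \<and> (s, q') \<in> R"
      using leq_trans dec[of m "max m n"] dec[of n "max m n"] fG[of "max m n"] by auto
  qed
  moreover have "p \<in> G" using fG[of 0] f(1) by simp
  moreover have "G \<inter> D \<noteq> {}" if D: "D \<in> \<D>" for D
  proof -
    obtain n where "E n = D"
      using from_nat_into_surj[OF \<D>(1) D] D unfolding E_def by (metis empty_iff)
    then show ?thesis using f(2)[of n] fG by blast
  qed
  ultimately show ?thesis using that \<D>(3) by blast
qed

text \<open>
  The conditions that satisfy \<open>Q\<close> or have no extension satisfying \<open>Q\<close> are dense.
\<close>

lemma generically_decides: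
  "generically R (\<lambda>G. (\<exists>p\<in>G. Q p) \<or> (\<exists>p\<in>G. \<forall>q. (q, p) \<in> R \<longrightarrow> \<not> Q q))"
proof -
  let ?D = "{p. Q p \<or> (\<forall>q. (q, p) \<in> R \<longrightarrow> \<not> Q q)}"
  have "dense_in R ?D"
    unfolding dense_in_def
  proof
    fix p assume "p \<in> Field R"
    then show "\<exists>q\<in>?D. (q, p) \<in> R"
      using leq_refl[of p] by blast
  qed
  then show ?thesis
    unfolding generically_def by (intro exI[of _ "{?D}"]) auto
qed

lemma regular_ground: "regular R \<langle>Q\<rangle>"
  unfolding regular_def fGr_def using leq_refl by blast

lemma regular_mem: "regular R (a \<^bold>\<in> \<tau>)"
  unfolding regular_def fmem_def using leq_trans leq_refl by (meson FieldI1)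

lemma regular_not: "regular R \<phi> \<Longrightarrow> regular R (\<^bold>\<not> \<phi>)"
  unfolding regular_def fnot_def using leq_trans leq_refl by (meson FieldI1)

lemma regular_and: "regular R \<phi> \<Longrightarrow> regular R \<psi> \<Longrightarrow> regular R (\<phi> \<^bold>\<and> \<psi>)"
  unfolding regular_def fand_def by meson

lemma regular_all: "(\<And>x. regular R (\<phi> x)) \<Longrightarrow> regular R (\<^bold>\<forall>x. \<phi> x)"
  unfolding regular_def fall_def by meson

lemma regular_ex: "regular R (\<^bold>\<exists>x. \<phi> x)"
  unfolding regular_def fex_def using leq_trans leq_refl by (meson FieldI1)

lemma regular_imp: "regular R \<phi> \<Longrightarrow> regular R \<psi> \<Longrightarrow> regular R (\<phi> \<^bold>\<longrightarrow> \<psi>)"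
  unfolding fimp_def by (intro regular_not regular_and)

lemma regular_iff: "regular R \<phi> \<Longrightarrow> regular R \<psi> \<Longrightarrow> regular R (\<phi> \<^bold>\<longleftrightarrow> \<psi>)"
  unfolding fiff_def by (intro regular_imp regular_and)

lemmas regular_intros = regular_ground regular_mem regular_not regular_and regular_all regular_ex
  regular_imp regular_iff

lemma mirrors_self: "mirrors R \<phi> (\<lambda>G. \<exists>p\<in>G. \<phi> R p)"
  unfolding mirrors_def by (rule generically_mono[OF generically_filter]) simp

lemma mirrors_ground: "mirrors R \<langle>Q\<rangle> (\<lambda>G. Q)"
  unfolding mirrors_def
  by (rule generically_mono[OF generically_filter]) (auto simp: fGr_def cond_filter_def)

lemma mirrors_mem: "mirrors R (a \<^bold>\<in> \<tau>) (\<lambda>G. a \<in> val \<tau> G)"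
  unfolding mirrors_def
proof (rule generically_mono[OF generically_decides[of "\<lambda>q. \<exists>t. (a, t) \<in> \<tau> \<and> (q, t) \<in> R"]])
  fix G assume G: "cond_filter R G"
    and dec: "(\<exists>q\<in>G. \<exists>t. (a, t) \<in> \<tau> \<and> (q, t) \<in> R) \<or>
       (\<exists>p\<in>G. \<forall>q. (q, p) \<in> R \<longrightarrow> \<not> (\<exists>t. (a, t) \<in> \<tau> \<and> (q, t) \<in> R))"
  show "(\<exists>p\<in>G. (a \<^bold>\<in> \<tau>) R p) \<longleftrightarrow> a \<in> val \<tau> G"
  proof
    assume "\<exists>p\<in>G. (a \<^bold>\<in> \<tau>) R p"
    then obtain p where p: "p \<in> G" "(a \<^bold>\<in> \<tau>) R p" by blast
    from dec show "a \<in> val \<tau> G"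
    proof
      assume "\<exists>q\<in>G. \<exists>t. (a, t) \<in> \<tau> \<and> (q, t) \<in> R"
      then show ?thesis using cond_filter_up[OF G] by (auto simp: val_def)
    next
      assume "\<exists>p\<in>G. \<forall>q. (q, p) \<in> R \<longrightarrow> \<not> (\<exists>t. (a, t) \<in> \<tau> \<and> (q, t) \<in> R)"
      then obtain p' where p': "p' \<in> G" "\<forall>q. (q, p') \<in> R \<longrightarrow> \<not> (\<exists>t. (a, t) \<in> \<tau> \<and> (q, t) \<in> R)"
        by blast
      obtain s where "(s, p) \<in> R" "(s, p') \<in> R" using cond_filter_directed[OF G p(1) p'(1)] by blast
      then show ?thesis using p(2) p'(2) leq_trans unfolding fmem_def by meson
    qed
  next
    assume "a \<in> val \<tau> G"
    then obtain t where "t \<in> G" "(a, t) \<in> \<tau>" by (auto simp: val_def)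
    moreover have "(a \<^bold>\<in> \<tau>) R t" unfolding fmem_def using calculation leq_refl by (meson FieldI1)
    ultimately show "\<exists>p\<in>G. (a \<^bold>\<in> \<tau>) R p" by blast
  qed
qed

lemma mirrors_not:
  assumes "regular R \<phi>" "mirrors R \<phi> \<Phi>"
  shows "mirrors R (\<^bold>\<not> \<phi>) (\<lambda>G. \<not> \<Phi> G)"
  unfolding mirrors_def
proof (rule generically_mono[OF generically_conj[OF generically_decides[of "\<phi> R"] assms(2)[unfolded mirrors_def]]])
  fix G assume G: "cond_filter R G"
    and *: "((\<exists>p\<in>G. \<phi> R p) \<or> (\<exists>p\<in>G. \<forall>q. (q, p) \<in> R \<longrightarrow> \<not> \<phi> R q)) \<and> (\<exists>p\<in>G. \<phi> R p) = \<Phi> G"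
  show "(\<exists>p\<in>G. (\<^bold>\<not> \<phi>) R p) \<longleftrightarrow> \<not> \<Phi> G"
    using * cond_filter_directed[OF G] regular_mono[OF assms(1)] unfolding fnot_def by metis
qed

lemma mirrors_and:
  assumes "regular R \<phi>" "mirrors R \<phi> \<Phi>" "regular R \<psi>" "mirrors R \<psi> \<Psi>"
  shows "mirrors R (\<phi> \<^bold>\<and> \<psi>) (\<lambda>G. \<Phi> G \<and> \<Psi> G)"
  unfolding mirrors_def
proof (rule generically_mono[OF generically_conj[OF assms(2,4)[unfolded mirrors_def]]])
  fix G assume G: "cond_filter R G"
    and *: "(\<exists>p\<in>G. \<phi> R p) = \<Phi> G \<and> (\<exists>p\<in>G. \<psi> R p) = \<Psi> G"
  show "(\<exists>p\<in>G. (\<phi> \<^bold>\<and> \<psi>) R p) \<longleftrightarrow> \<Phi> G \<and> \<Psi> G"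
    using * cond_filter_directed[OF G] regular_mono[OF assms(1)] regular_mono[OF assms(3)]
    unfolding fand_def by metis
qed

lemma mirrors_imp:
  assumes "regular R \<phi>" "mirrors R \<phi> \<Phi>" "regular R \<psi>" "mirrors R \<psi> \<Psi>"
  shows "mirrors R (\<phi> \<^bold>\<longrightarrow> \<psi>) (\<lambda>G. \<Phi> G \<longrightarrow> \<Psi> G)"
proof -
  have "mirrors R (\<phi> \<^bold>\<longrightarrow> \<psi>) (\<lambda>G. \<not> (\<Phi> G \<and> \<not> \<Psi> G))"
    unfolding fimp_def by (intro mirrors_not mirrors_and regular_intros assms)
  then show ?thesis by simp
qed

lemma mirrors_iff:
  assumes "regular R \<phi>" "mirrors R \<phi> \<Phi>" "regular R \<psi>" "mirrors R \<psi> \<Psi>"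
  shows "mirrors R (\<phi> \<^bold>\<longleftrightarrow> \<psi>) (\<lambda>G. \<Phi> G \<longleftrightarrow> \<Psi> G)"
proof -
  have "mirrors R (\<phi> \<^bold>\<longleftrightarrow> \<psi>) (\<lambda>G. (\<Phi> G \<longrightarrow> \<Psi> G) \<and> (\<Psi> G \<longrightarrow> \<Phi> G))"
    unfolding fiff_def by (intro mirrors_imp mirrors_and regular_intros assms)
  then show ?thesis by (simp add: iff_conv_conj_imp)
qed

text \<open>
  The quantified variable has to range over a countable type, since the truth lemma is needed
  for all its instances simultaneously.
\<close>

lemma mirrors_ex:
  fixes \<phi> :: "'x::countable \<Rightarrow> 'p sentence"
  assumes "\<And>x. regular R (\<phi> x)" "\<And>x. mirrors R (\<phi> x) (\<Phi> x)"
  shows "mirrors R (\<^bold>\<exists>x. \<phi> x) (\<lambda>G. \<exists>x. \<Phi> x G)"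
  unfolding mirrors_def
proof (rule generically_mono[OF generically_conj[OF generically_decides[of "\<lambda>p. \<exists>x. \<phi> x R p"]
        generically_all[OF assms(2)[unfolded mirrors_def]]]])
  fix G assume G: "cond_filter R G"
    and *: "((\<exists>p\<in>G. \<exists>x. \<phi> x R p) \<or> (\<exists>p\<in>G. \<forall>q. (q, p) \<in> R \<longrightarrow> \<not> (\<exists>x. \<phi> x R q)))
       \<and> (\<forall>x. (\<exists>p\<in>G. \<phi> x R p) = \<Phi> x G)"
  show "(\<exists>p\<in>G. (\<^bold>\<exists>x. \<phi> x) R p) \<longleftrightarrow> (\<exists>x. \<Phi> x G)"
  proof
    assume "\<exists>p\<in>G. (\<^bold>\<exists>x. \<phi> x) R p"
    then show "\<exists>x. \<Phi> x G"
      using * cond_filter_directed[OF G] leq_trans unfolding fex_def by (metis (no_types, lifting))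
  next
    assume "\<exists>x. \<Phi> x G"
    then obtain p x where p: "p \<in> G" "\<phi> x R p" using * by blast
    then have "(\<^bold>\<exists>x. \<phi> x) R p"
      unfolding fex_def using regular_mono[OF assms(1)] leq_refl by (meson FieldI1)
    then show "\<exists>p\<in>G. (\<^bold>\<exists>x. \<phi> x) R p" using p by blast
  qed
qed

lemma mirrors_all:
  fixes \<phi> :: "'x::countable \<Rightarrow> 'p sentence"
  assumes "\<And>x. regular R (\<phi> x)" "\<And>x. mirrors R (\<phi> x) (\<Phi> x)"
  shows "mirrors R (\<^bold>\<forall>x. \<phi> x) (\<lambda>G. \<forall>x. \<Phi> x G)"
proof -
  have "mirrors R (\<^bold>\<not> (\<^bold>\<exists>x. \<^bold>\<not> \<phi> x)) (\<lambda>G. \<not> (\<exists>x. \<not> \<Phi> x G))"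
    by (intro mirrors_not mirrors_ex regular_intros assms)
  then have "generically R (\<lambda>G. (\<exists>p\<in>G. (\<^bold>\<not> (\<^bold>\<exists>x. \<^bold>\<not> \<phi> x)) R p) \<longleftrightarrow> (\<forall>x. \<Phi> x G))"
    unfolding mirrors_def by simp
  then show ?thesis
    unfolding mirrors_def
  proof (rule generically_mono)
    fix G assume G: "cond_filter R G" and *: "(\<exists>p\<in>G. (\<^bold>\<not> (\<^bold>\<exists>x. \<^bold>\<not> \<phi> x)) R p) \<longleftrightarrow> (\<forall>x. \<Phi> x G)"
    have "(\<^bold>\<not> (\<^bold>\<exists>x. \<^bold>\<not> \<phi> x)) R p \<longleftrightarrow> (\<^bold>\<forall>x. \<phi> x) R p" if "p \<in> G" for p
    proof
      have p: "p \<in> Field R" using that G by (auto simp: cond_filter_def)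
      assume L: "(\<^bold>\<not> (\<^bold>\<exists>x. \<^bold>\<not> \<phi> x)) R p"
      show "(\<^bold>\<forall>x. \<phi> x) R p"
        unfolding fall_def
      proof
        fix x
        show "\<phi> x R p"
        proof (rule regular_local[OF assms(1) p])
          fix q assume "(q, p) \<in> R"
          then show "\<exists>s. (s, q) \<in> R \<and> \<phi> x R s"
            using L leq_trans leq_refl unfolding fex_def fnot_def by (metis FieldI1)
        qed
      qed
    next
      assume "(\<^bold>\<forall>x. \<phi> x) R p"
      then show "(\<^bold>\<not> (\<^bold>\<exists>x. \<^bold>\<not> \<phi> x)) R p"
        unfolding fex_def fnot_def fall_def using regular_mono[OF assms(1)] leq_refl leq_trans
        by (metis FieldI1)
    qed
    then show "(\<exists>p\<in>G. (\<^bold>\<forall>x. \<phi> x) R p) \<longleftrightarrow> (\<forall>x. \<Phi> x G)" using * by blast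
  qed
qed

lemmas mirrors_intros = mirrors_ground mirrors_mem mirrors_not mirrors_and mirrors_imp mirrors_iff
  mirrors_ex mirrors_all

text \<open>
  From right to left: every \<open>q\<close> below \<open>p\<close> lies in a sufficiently generic filter; this filter contains
  \<open>p\<close>, so by the truth lemma it has a member forcing \<open>\<phi>\<close>, and such a member has a common extension with \<open>q\<close>.
  Regularity of \<open>\<phi>\<close> then gives the claim for \<open>p\<close>.
\<close>

lemma forces_iff_generically:
  assumes "regular R \<phi>" "mirrors R \<phi> \<Phi>" "p \<in> Field R"
  shows "\<phi> R p \<longleftrightarrow> generically R (\<lambda>G. p \<in> G \<longrightarrow> \<Phi> G)"
proof
  assume "\<phi> R p"
  then show "generically R (\<lambda>G. p \<in> G \<longrightarrow> \<Phi> G)"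
    by (intro generically_mono[OF assms(2)[unfolded mirrors_def]]) auto
next
  assume gen: "generically R (\<lambda>G. p \<in> G \<longrightarrow> \<Phi> G)"
  show "\<phi> R p"
  proof (rule regular_local[OF assms(1,3)])
    fix q assume q: "(q, p) \<in> R"
    obtain G where G: "cond_filter R G" "q \<in> G" "p \<in> G \<longrightarrow> \<Phi> G" "(\<exists>p\<in>G. \<phi> R p) \<longleftrightarrow> \<Phi> G"
      using generic_exists[OF generically_conj[OF gen assms(2)[unfolded mirrors_def]]] FieldI1[OF q]
      by metis
    then obtain s where "s \<in> G" "\<phi> R s" using cond_filter_up[OF G(1)] q by blast
    then show "\<exists>s. (s, q) \<in> R \<and> \<phi> R s"
      using cond_filter_directed[OF G(1) _ G(2)] regular_mono[OF assms(1)] by blast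
  qed
qed

end

section \<open>Names of LE-conditions\<close>

text \<open>
  Conditions whose \<open>\<phi>\<close> decays at a prescribed rate.  The triples \<open>(d, s, k)\<close> split LE into countably many
  linked pieces.
\<close>

definition LE_cond_rate :: "(nat \<Rightarrow> nat) \<Rightarrow> nat \<Rightarrow> cond set" where
  "LE_cond_rate b k = {(d, s, \<phi>).
     length s = length d \<and> (\<forall>n < length d. s ! n < b n) \<and> (\<forall>n. \<phi> n \<subseteq> {..<b n}) \<and>
     (\<forall>n \<ge> length d. real (card (\<phi> n)) / real (b n) \<le> 2 powr (- (real n / 2 ^ k)))}"

lemma LE_cond_iff_rate: "c \<in> LE_cond b \<longleftrightarrow> (\<exists>k. c \<in> LE_cond_rate b k)"
  by (cases c) (auto simp: LE_cond_def LE_cond_rate_def)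

lemma code_of_eq_iff:
  "Z = code_of (d, s, \<phi>) \<longleftrightarrow>
     (\<forall>d' s'. Inl (d', s') \<in> Z \<longleftrightarrow> d' = d \<and> s' = s) \<and> (\<forall>n m. Inr (n, m) \<in> Z \<longleftrightarrow> m \<in> \<phi> n)"
proof -
  have "Z = code_of (d, s, \<phi>) \<longleftrightarrow> (\<forall>z. z \<in> Z \<longleftrightarrow> z \<in> code_of (d, s, \<phi>))" by blast
  also have "\<dots> \<longleftrightarrow> (\<forall>u. Inl u \<in> Z \<longleftrightarrow> Inl u \<in> code_of (d, s, \<phi>)) \<and> (\<forall>u. Inr u \<in> Z \<longleftrightarrow> Inr u \<in> code_of (d, s, \<phi>))"
    by (metis sum.exhaust)
  finally show ?thesis by (auto simp: code_of_def)
qed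

lemma code_of_inject: "code_of c = code_of c' \<longleftrightarrow> c = c'"
proof (cases c, cases c')
  fix d s \<phi> d' s' \<phi>' assume "c = (d, s, \<phi>)" "c' = (d', s', \<phi>')"
  then show ?thesis
    by (simp add: code_of_eq_iff) (auto simp: code_of_def fun_eq_iff)
qed

lemma code_of_rate_iff:
  "(\<exists>\<phi>. Z = code_of (d, s, \<phi>) \<and> (d, s, \<phi>) \<in> LE_cond_rate b k) \<longleftrightarrow>
     Inl (d, s) \<in> Z \<and> (\<forall>d' s'. Inl (d', s') \<in> Z \<longrightarrow> d' = d \<and> s' = s) \<and>
     (length s = length d \<and> (\<forall>n < length d. s ! n < b n)) \<and>
     (\<forall>n m. Inr (n, m) \<in> Z \<longrightarrow> m < b n) \<and>
     (\<forall>n. length d \<le> n \<longrightarrow> real (card {m. Inr (n, m) \<in> Z}) / real (b n) \<le> 2 powr (- (real n / 2 ^ k)))"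
    (is "?L \<longleftrightarrow> ?R")
proof
  assume ?L
  then obtain \<phi> where \<phi>: "Z = code_of (d, s, \<phi>)" "(d, s, \<phi>) \<in> LE_cond_rate b k" by blast
  have "{m. Inr (n, m) \<in> Z} = \<phi> n" for n
    using \<phi>(1) by (simp add: code_of_eq_iff)
  then show ?R
    using \<phi>(2) \<phi>(1)[unfolded code_of_eq_iff] by (simp add: LE_cond_rate_def subset_iff)
next
  assume R: ?R
  define \<phi> where "\<phi> n = {m. Inr (n, m) \<in> Z}" for n
  have "Z = code_of (d, s, \<phi>)"
    unfolding code_of_eq_iff using R by (auto simp: \<phi>_def)
  moreover have "(d, s, \<phi>) \<in> LE_cond_rate b k"
    unfolding LE_cond_rate_def \<phi>_def using R by blast
  ultimately show ?L by blast
qed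

lemma code_of_LE_cond_iff:
  "(\<exists>c\<in>LE_cond b. Z = code_of c) \<longleftrightarrow>
     (\<exists>d s. Inl (d, s) \<in> Z \<and> (\<forall>d' s'. Inl (d', s') \<in> Z \<longrightarrow> d' = d \<and> s' = s) \<and>
     (length s = length d \<and> (\<forall>n < length d. s ! n < b n)) \<and>
     (\<forall>n m. Inr (n, m) \<in> Z \<longrightarrow> m < b n) \<and>
     (\<exists>k. \<forall>n. length d \<le> n \<longrightarrow> real (card {m. Inr (n, m) \<in> Z}) / real (b n) \<le> 2 powr (- (real n / 2 ^ k))))"
proof -
  have "(\<exists>c\<in>LE_cond b. Z = code_of c) \<longleftrightarrow>
    (\<exists>d s k \<phi>. Z = code_of (d, s, \<phi>) \<and> (d, s, \<phi>) \<in> LE_cond_rate b k)"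
    unfolding Bex_def LE_cond_iff_rate split_paired_Ex by blast
  then show ?thesis unfolding code_of_rate_iff by blast
qed

definition f_small_section :: "(nat \<Rightarrow> nat) \<Rightarrow> (code, 'p) name \<Rightarrow> nat \<Rightarrow> nat \<Rightarrow> 'p sentence" where
  "f_small_section b \<tau> k n =
     (\<^bold>\<exists>A. (\<^bold>\<forall>m. Inr (n, m) \<^bold>\<in> \<tau> \<^bold>\<longleftrightarrow> \<langle>m \<in> A\<rangle>) \<^bold>\<and>
              \<langle>real (card A) / real (b n) \<le> 2 powr (- (real n / 2 ^ k))\<rangle>)"

definition f_LE_cond_stem ::
    "(nat \<Rightarrow> nat) \<Rightarrow> (code, 'p) name \<Rightarrow> bool list \<Rightarrow> nat list \<Rightarrow> nat \<Rightarrow> 'p sentence" where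
  "f_LE_cond_stem b \<tau> d s k = 
     (Inl (d, s) \<^bold>\<in> \<tau> \<^bold>\<and> (\<^bold>\<forall>d'. \<^bold>\<forall>s'. Inl (d', s') \<^bold>\<in> \<tau> \<^bold>\<longrightarrow> \<langle>d' = d \<and> s' = s\<rangle>) \<^bold>\<and>
        \<langle>length s = length d \<and> (\<forall>n < length d. s ! n < b n)\<rangle> \<^bold>\<and>
        (\<^bold>\<forall>n. \<^bold>\<forall>m. Inr (n, m) \<^bold>\<in> \<tau> \<^bold>\<longrightarrow> \<langle>m < b n\<rangle>) \<^bold>\<and>
        (\<^bold>\<forall>n. \<langle>length d \<le> n\<rangle> \<^bold>\<longrightarrow> f_small_section b \<tau> k n))"

context forcing
begin

text \<open>
  The sentence \<open>f_small_section\<close> quantifies over all sets \<open>A\<close> of the ground model, an uncountable type, so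
  that \<open>mirrors_ex\<close> does not apply.  As long as the section of the value at \<open>n\<close> is contained in the finite set
  \<open>b(n)\<close>, only finite \<open>A\<close> matter, and these are the sets of elements of the countably many lists.
\<close>

lemma truth_small_section:
  "generically R (\<lambda>G. \<forall>n k. {m. Inr (n, m) \<in> val \<tau> G} \<subseteq> {..<b n} \<longrightarrow>
     ((\<exists>p\<in>G. f_small_section b \<tau> k n R p) \<longleftrightarrow>
      real (card {m. Inr (n, m) \<in> val \<tau> G}) / real (b n) \<le> 2 powr (- (real n / 2 ^ k))))"
proof (intro generically_all)
  fix n k
  define \<psi> where "\<psi> A = (\<^bold>\<forall>m. Inr (n, m) \<^bold>\<in> \<tau> \<^bold>\<longleftrightarrow> \<langle>m \<in> A\<rangle>)" for A
  define Q where "Q A \<longleftrightarrow> real (card A) / real (b n) \<le> 2 powr (- (real n / 2 ^ k))" for A :: "nat set"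
  have f: "f_small_section b \<tau> k n = (\<^bold>\<exists>A. \<psi> A \<^bold>\<and> \<langle>Q A\<rangle>)"
    by (simp add: f_small_section_def \<psi>_def Q_def)
  have 1: "generically R (\<lambda>G. \<forall>xs. (\<exists>p\<in>G. \<psi> (set xs) R p) \<longleftrightarrow> (\<forall>m. Inr (n, m) \<in> val \<tau> G \<longleftrightarrow> m \<in> set xs))"
  proof (intro generically_all)
    fix xs
    have "mirrors R (\<psi> (set xs)) (\<lambda>G. \<forall>m. Inr (n, m) \<in> val \<tau> G \<longleftrightarrow> m \<in> set xs)"
      unfolding \<psi>_def by (intro mirrors_intros regular_intros)
    then show "generically R (\<lambda>G. (\<exists>p\<in>G. \<psi> (set xs) R p) \<longleftrightarrow> (\<forall>m. Inr (n, m) \<in> val \<tau> G \<longleftrightarrow> m \<in> set xs))"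
      by (simp add: mirrors_def)
  qed
  have 2: "generically R (\<lambda>G. \<forall>m B. (\<exists>p\<in>G. (Inr (n, m) \<^bold>\<in> \<tau> \<^bold>\<longleftrightarrow> \<langle>B\<rangle>) R p) \<longleftrightarrow> (Inr (n, m) \<in> val \<tau> G \<longleftrightarrow> B))"
  proof (intro generically_all)
    fix m B
    have "mirrors R (Inr (n, m) \<^bold>\<in> \<tau> \<^bold>\<longleftrightarrow> \<langle>B\<rangle>) (\<lambda>G. Inr (n, m) \<in> val \<tau> G \<longleftrightarrow> B)"
      by (intro mirrors_intros regular_intros)
    then show "generically R (\<lambda>G. (\<exists>p\<in>G. (Inr (n, m) \<^bold>\<in> \<tau> \<^bold>\<longleftrightarrow> \<langle>B\<rangle>) R p) \<longleftrightarrow> (Inr (n, m) \<in> val \<tau> G \<longleftrightarrow> B))"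
      by (simp add: mirrors_def)
  qed
  show "generically R (\<lambda>G. {m. Inr (n, m) \<in> val \<tau> G} \<subseteq> {..<b n} \<longrightarrow>
     ((\<exists>p\<in>G. f_small_section b \<tau> k n R p) \<longleftrightarrow>
      real (card {m. Inr (n, m) \<in> val \<tau> G}) / real (b n) \<le> 2 powr (- (real n / 2 ^ k))))"
  proof (rule generically_mono[OF generically_conj[OF 1 generically_conj[OF 2
        generically_decides[of "\<lambda>p. \<exists>A. (\<psi> A \<^bold>\<and> \<langle>Q A\<rangle>) R p"]]]], intro impI)
    fix G assume G: "cond_filter R G" and sub: "{m. Inr (n, m) \<in> val \<tau> G} \<subseteq> {..<b n}"
      and *: "(\<forall>xs. (\<exists>p\<in>G. \<psi> (set xs) R p) \<longleftrightarrow> (\<forall>m. Inr (n, m) \<in> val \<tau> G \<longleftrightarrow> m \<in> set xs)) \<and>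
         (\<forall>m B. (\<exists>p\<in>G. (Inr (n, m) \<^bold>\<in> \<tau> \<^bold>\<longleftrightarrow> \<langle>B\<rangle>) R p) \<longleftrightarrow> (Inr (n, m) \<in> val \<tau> G \<longleftrightarrow> B)) \<and>
         ((\<exists>p\<in>G. \<exists>A. (\<psi> A \<^bold>\<and> \<langle>Q A\<rangle>) R p) \<or> (\<exists>p\<in>G. \<forall>q. (q, p) \<in> R \<longrightarrow> \<not> (\<exists>A. (\<psi> A \<^bold>\<and> \<langle>Q A\<rangle>) R q)))"
    let ?V = "{m. Inr (n, m) \<in> val \<tau> G}"
    have "(\<exists>p\<in>G. f_small_section b \<tau> k n R p) \<longleftrightarrow> Q ?V"
    proof
      assume "\<exists>p\<in>G. f_small_section b \<tau> k n R p"
      then obtain p where p: "p \<in> G" "\<And>q. (q, p) \<in> R \<Longrightarrow> \<exists>s A. (s, q) \<in> R \<and> (\<psi> A \<^bold>\<and> \<langle>Q A\<rangle>) R s"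
        unfolding f fex_def by blast
      have "\<exists>p\<in>G. \<exists>A. (\<psi> A \<^bold>\<and> \<langle>Q A\<rangle>) R p"
      proof (rule ccontr)
        assume "\<not> ?thesis"
        then obtain p' where p': "p' \<in> G" "\<forall>q. (q, p') \<in> R \<longrightarrow> \<not> (\<exists>A. (\<psi> A \<^bold>\<and> \<langle>Q A\<rangle>) R q)"
          using * by blast
        obtain s where "(s, p) \<in> R" "(s, p') \<in> R"
          using cond_filter_directed[OF G p(1) p'(1)] by blast
        then show False using p(2) p'(2) leq_trans by blast
      qed
      then obtain q A where q: "q \<in> G" "\<psi> A R q" "Q A"
        by (auto simp: fand_def fGr_def)
      have "Inr (n, m) \<in> val \<tau> G \<longleftrightarrow> m \<in> A" for m
        using q(1,2) * unfolding \<psi>_def fall_def by blast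
      then show "Q ?V" using q(3) by simp
    next
      assume Q: "Q ?V"
      obtain xs where xs: "set xs = ?V"
        using finite_list finite_subset[OF sub] by blast
      then obtain p where p: "p \<in> G" "\<psi> (set xs) R p" using * by blast
      have "regular R (\<psi> A)" for A unfolding \<psi>_def by (intro regular_intros)
      then have "f_small_section b \<tau> k n R p"
        using p(2) Q xs unfolding f fex_def fand_def fGr_def
        by (metis FieldI1 leq_refl regular_mono)
      then show "\<exists>p\<in>G. f_small_section b \<tau> k n R p" using p(1) by blast
    qed
    then show "(\<exists>p\<in>G. f_small_section b \<tau> k n R p) \<longleftrightarrow>
        real (card ?V) / real (b n) \<le> 2 powr (- (real n / 2 ^ k))"
      by (simp add: Q_def)
  qed
qed

lemma truth_small_section_all:
  "generically R (\<lambda>G. (\<forall>n m. Inr (n, m) \<in> val \<tau> G \<longrightarrow> m < b n) \<longrightarrow>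
     (\<forall>n k. (\<exists>p\<in>G. f_small_section b \<tau> k n R p) =
      (real (card {m. Inr (n, m) \<in> val \<tau> G}) / real (b n) \<le> 2 powr (- (real n / 2 ^ k)))))"
  by (rule generically_mono[OF truth_small_section[where b = b and \<tau> = \<tau>]]) (simp add: subset_iff)

text \<open>
  Congruence rule for the shape shared by the sentences and their evaluations: the smallness
  clause \<open>D\<close> may be replaced under the assumption \<open>C\<close> that all sections are bounded.
\<close>

lemma rate_cong: "(C \<Longrightarrow> D = E) \<Longrightarrow> (A \<and> B \<and> L \<and> C \<and> D) = (A \<and> B \<and> L \<and> C \<and> E)"
  by blast

lemma regular_LE_cond_stem: "regular R (f_LE_cond_stem b \<tau> d s k)"
  unfolding f_LE_cond_stem_def f_small_section_def by (intro regular_intros)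

lemma mirrors_generically_cong:
  assumes "mirrors R \<phi> \<Phi>" "generically R (\<lambda>G. \<Phi> G \<longleftrightarrow> \<Psi> G)"
  shows "mirrors R \<phi> \<Psi>"
  unfolding mirrors_def
  by (rule generically_mono[OF generically_conj[OF assms(1)[unfolded mirrors_def] assms(2)]]) auto

lemma mirrors_LE_cond_stem:
  "mirrors R (f_LE_cond_stem b \<tau> d s k)
     (\<lambda>G. \<exists>\<phi>. val \<tau> G = code_of (d, s, \<phi>) \<and> (d, s, \<phi>) \<in> LE_cond_rate b k)"
proof (rule mirrors_generically_cong)
  show "mirrors R (f_LE_cond_stem b \<tau> d s k)
     (\<lambda>G. Inl (d, s) \<in> val \<tau> G \<and> (\<forall>d' s'. Inl (d', s') \<in> val \<tau> G \<longrightarrow> d' = d \<and> s' = s) \<and>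
        (length s = length d \<and> (\<forall>n < length d. s ! n < b n)) \<and>
        (\<forall>n m. Inr (n, m) \<in> val \<tau> G \<longrightarrow> m < b n) \<and>
        (\<forall>n. length d \<le> n \<longrightarrow> (\<exists>p\<in>G. f_small_section b \<tau> k n R p)))"
    unfolding f_LE_cond_stem_def
    by (intro mirrors_intros regular_intros mirrors_self | simp add: f_small_section_def regular_ex)+
  show "generically R (\<lambda>G. (Inl (d, s) \<in> val \<tau> G \<and> (\<forall>d' s'. Inl (d', s') \<in> val \<tau> G \<longrightarrow> d' = d \<and> s' = s) \<and>
        (length s = length d \<and> (\<forall>n < length d. s ! n < b n)) \<and>
        (\<forall>n m. Inr (n, m) \<in> val \<tau> G \<longrightarrow> m < b n) \<and>
        (\<forall>n. length d \<le> n \<longrightarrow> (\<exists>p\<in>G. f_small_section b \<tau> k n R p))) \<longleftrightarrow>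
     (\<exists>\<phi>. val \<tau> G = code_of (d, s, \<phi>) \<and> (d, s, \<phi>) \<in> LE_cond_rate b k))"
    unfolding code_of_rate_iff
    by (rule generically_mono[OF truth_small_section_all[where b = b and \<tau> = \<tau>]], rule rate_cong) simp
qed

lemma regular_LE_cond: "regular R (f_LE_cond b \<tau>)"
  unfolding f_LE_cond_def by (rule regular_ex)

lemma mirrors_LE_cond: "mirrors R (f_LE_cond b \<tau>) (\<lambda>G. \<exists>c\<in>LE_cond b. val \<tau> G = code_of c)"
proof (rule mirrors_generically_cong)
  have reg: "regular R (f_small_section b \<tau> k n)" for k n
    by (simp add: f_small_section_def regular_ex)
  show "mirrors R (f_LE_cond b \<tau>)
     (\<lambda>G. \<exists>d s. Inl (d, s) \<in> val \<tau> G \<and> (\<forall>d' s'. Inl (d', s') \<in> val \<tau> G \<longrightarrow> d' = d \<and> s' = s) \<and>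
        (length s = length d \<and> (\<forall>n < length d. s ! n < b n)) \<and>
        (\<forall>n m. Inr (n, m) \<in> val \<tau> G \<longrightarrow> m < b n) \<and>
        (\<exists>k. \<forall>n. length d \<le> n \<longrightarrow> (\<exists>p\<in>G. f_small_section b \<tau> k n R p)))"
    unfolding f_LE_cond_def f_small_section_def[symmetric]
    by (intro mirrors_intros regular_intros mirrors_self reg)
  show "generically R (\<lambda>G. (\<exists>d s. Inl (d, s) \<in> val \<tau> G \<and> (\<forall>d' s'. Inl (d', s') \<in> val \<tau> G \<longrightarrow> d' = d \<and> s' = s) \<and>
        (length s = length d \<and> (\<forall>n < length d. s ! n < b n)) \<and>
        (\<forall>n m. Inr (n, m) \<in> val \<tau> G \<longrightarrow> m < b n) \<and>
        (\<exists>k. \<forall>n. length d \<le> n \<longrightarrow> (\<exists>p\<in>G. f_small_section b \<tau> k n R p))) \<longleftrightarrow>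
     (\<exists>c\<in>LE_cond b. val \<tau> G = code_of c))"
    unfolding code_of_LE_cond_iff
    by (rule generically_mono[OF truth_small_section_all[where b = b and \<tau> = \<tau>]], rule ex_cong1, rule ex_cong1, rule rate_cong) simp
qed

lemma forces_LE_cond_iff:
  assumes "p \<in> Field R"
  shows "f_LE_cond b \<tau> R p \<longleftrightarrow>
    generically R (\<lambda>G. p \<in> G \<longrightarrow> (\<exists>c\<in>LE_cond b. val \<tau> G = code_of c))"
  by (rule forces_iff_generically[OF regular_LE_cond mirrors_LE_cond assms])

lemma regular_LE_le: "regular R (f_LE_le \<sigma> \<tau>)"
  unfolding f_LE_le_def by (intro regular_intros)

lemma mirrors_LE_le:
  "mirrors R (f_LE_le \<sigma> \<tau>) (\<lambda>G. \<forall>d' s' d s. Inl (d', s') \<in> val \<sigma> G \<and> Inl (d, s) \<in> val \<tau> G \<longrightarrow>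
        (prefix d d' \<and> prefix s s') \<and>
        (\<forall>n m. Inr (n, m) \<in> val \<tau> G \<longrightarrow> Inr (n, m) \<in> val \<sigma> G) \<and>
        (\<forall>n. n \<in> ones d' - ones d \<longrightarrow> Inr (n, s' ! n) \<notin> val \<tau> G))"
  unfolding f_LE_le_def by (intro mirrors_intros regular_intros)

text \<open>
  If both names are forced to be conditions, the clauses of \<open>f_LE_le\<close>, evaluated in a filter, say exactly
  that the two values are related by the order of LE.
\<close>

lemma forces_LE_le_iff:
  assumes "p \<in> Field R" "f_LE_cond b \<sigma> R p" "f_LE_cond b \<tau> R p"
  shows "f_LE_le \<sigma> \<tau> R p \<longleftrightarrow>
    generically R (\<lambda>G. p \<in> G \<longrightarrow> (\<exists>c'\<in>LE_cond b. \<exists>c\<in>LE_cond b.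
       val \<sigma> G = code_of c' \<and> val \<tau> G = code_of c \<and> (c', c) \<in> LE_order b))"
    (is "_ \<longleftrightarrow> generically R ?P")
proof -
  let ?Q = "\<lambda>G. p \<in> G \<longrightarrow> (\<exists>c\<in>LE_cond b. val \<sigma> G = code_of c) \<and> (\<exists>c\<in>LE_cond b. val \<tau> G = code_of c)"
  let ?M = "\<lambda>G. p \<in> G \<longrightarrow> (\<forall>d' s' d s. Inl (d', s') \<in> val \<sigma> G \<and> Inl (d, s) \<in> val \<tau> G \<longrightarrow>
        (prefix d d' \<and> prefix s s') \<and>
        (\<forall>n m. Inr (n, m) \<in> val \<tau> G \<longrightarrow> Inr (n, m) \<in> val \<sigma> G) \<and>
        (\<forall>n. n \<in> ones d' - ones d \<longrightarrow> Inr (n, s' ! n) \<notin> val \<tau> G))"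
  have eq: "?Q G \<Longrightarrow> ?M G \<longleftrightarrow> ?P G" for G
  proof (cases "p \<in> G")
    case True
    assume "?Q G"
    then obtain c' c where c: "c' \<in> LE_cond b" "c \<in> LE_cond b" "val \<sigma> G = code_of c'" "val \<tau> G = code_of c"
      using True by blast
    obtain d s \<phi> d' s' \<phi>' where [simp]: "c = (d, s, \<phi>)" "c' = (d', s', \<phi>')"
      by (cases c, cases c')
    show ?thesis
      using c True by (simp add: code_of_inject Bex_def) (auto simp: code_of_def LE_order_def subset_iff)
  qed auto
  have Q: "generically R ?Q"
    by (rule generically_mono[OF generically_conj[OF assms(2,3)[unfolded forces_LE_cond_iff[OF assms(1)]]]]) auto
  have "f_LE_le \<sigma> \<tau> R p \<longleftrightarrow> generically R ?M"
    by (rule forces_iff_generically[OF regular_LE_le mirrors_LE_le assms(1)])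
  also have "\<dots> \<longleftrightarrow> generically R ?P"
  proof
    assume "generically R ?M"
    from generically_conj[OF this Q] show "generically R ?P"
    proof (rule generically_mono)
      fix G assume *: "?M G \<and> ?Q G"
      show "?P G" by (rule iffD1[OF eq[OF conjunct2[OF *]] conjunct1[OF *]])
    qed
  next
    assume "generically R ?P"
    from generically_conj[OF this Q] show "generically R ?M"
    proof (rule generically_mono)
      fix G assume *: "?P G \<and> ?Q G"
      show "?M G" by (rule iffD2[OF eq[OF conjunct2[OF *]] conjunct1[OF *]])
    qed
  qed
  finally show ?thesis .
qed

end

section \<open>Combinatorics of LE\<close>

definition pad :: "'a \<Rightarrow> nat \<Rightarrow> 'a list \<Rightarrow> 'a list" where
  "pad a L xs = xs @ replicate (L - length xs) a"

lemma length_pad: "length (pad a L xs) = max (length xs) L"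
  by (simp add: pad_def)

lemma prefix_pad: "prefix xs (pad a L xs)"
  by (simp add: pad_def)

lemma ones_pad: "ones (pad False L d) = ones d"
proof -
  have "n \<in> ones (pad False L d) \<longleftrightarrow> n \<in> ones d" for n
    by (cases "n < length d") (auto simp: ones_def pad_def nth_append)
  then show ?thesis by blast
qed

lemma nth_pad_less:
  assumes "\<And>n. n < length s \<Longrightarrow> s ! n < b n" "\<And>n. 0 < b n" "n < length (pad 0 L s)"
  shows "pad 0 L s ! n < (b n :: nat)"
proof (cases "n < length s")
  case True
  then show ?thesis using assms(1) by (simp add: pad_def nth_append)
next
  case False
  then have "pad 0 L s ! n = 0" using assms(3) by (simp add: pad_def nth_append)
  then show ?thesis using assms(2) by simp
qed

text \<open>
  Twice \<open>2 powr -n/2\<^sup>k\<close> is \<open>2 powr (1 - n/2\<^sup>k)\<close>, and \<open>n \<ge> 2\<^sup>k\<^sup>+\<^sup>1\<close> makes the summand \<open>1\<close> at most half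
  of \<open>n/2\<^sup>k\<close>.
\<close>

lemma rate_sum_bound:
  assumes "n \<ge> 2 ^ Suc k" "x \<le> 2 powr (- (real n / 2 ^ k))" "y \<le> 2 powr (- (real n / 2 ^ k))"
  shows "x + y \<le> 2 powr (- (real n / 2 ^ Suc k))"
proof -
  have n: "real n \<ge> 2 ^ Suc k" using assms(1) by (metis of_nat_le_iff of_nat_numeral of_nat_power)
  have "x + y \<le> 2 * 2 powr (- (real n / 2 ^ k))" using assms(2,3) by simp
  also have "\<dots> = 2 powr (1 - real n / 2 ^ k)" by (simp add: powr_diff powr_minus divide_inverse)
  also have "\<dots> \<le> 2 powr (- (real n / 2 ^ Suc k))"
  proof (rule powr_mono)
    have "real n / 2 ^ k = 2 * (real n / 2 ^ Suc k)" by simp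
    moreover have "real n / 2 ^ Suc k \<ge> 1" using n by simp
    ultimately show "1 - real n / 2 ^ k \<le> - (real n / 2 ^ Suc k)" by linarith
  qed simp
  finally show ?thesis .
qed

lemma small_section_rate:
  assumes "2 ^ n \<le> b n" "card A \<le> 1"
  shows "real (card A) / real (b n) \<le> 2 powr (- (real n / 2 ^ k))"
proof -
  have b: "real (b n) \<ge> 2 ^ n" using assms(1) by (metis of_nat_le_iff of_nat_numeral of_nat_power)
  have "(0::real) < 2 ^ n" by simp
  with b have b0: "0 < real (b n)" by linarith
  have "real (card A) / real (b n) \<le> 1 / real (b n)" using assms(2) b0 by (intro divide_right_mono) auto
  also have "\<dots> \<le> 1 / 2 ^ n" using b b0 by (intro divide_left_mono) auto
  also have "\<dots> = 2 powr (- real n)" by (simp add: powr_minus powr_realpow field_simps)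
  also have "\<dots> \<le> 2 powr (- (real n / 2 ^ k))"
    by (intro powr_mono) (auto simp: divide_le_eq mult_le_cancel_left1)
  finally show ?thesis .
qed

text \<open>
  The basic step of the whole proof.  Padding adds no elements to \<open>D\<close>, hence is compatible with
  every \<open>\<phi>\<close>; it serves to reach the length from which on the rate can absorb the factor 2.
\<close>

lemma LE_cond_pad_Un:
  assumes c: "(d, s, \<phi>) \<in> LE_cond_rate b k" and b: "\<And>n. 0 < b n"
    and \<psi>: "\<And>n. \<psi> n \<subseteq> {..<b n}"
    and rate: "\<And>n. n \<ge> L \<Longrightarrow> real (card (\<psi> n)) / real (b n) \<le> 2 powr (- (real n / 2 ^ k))"
    and L: "L \<ge> 2 ^ Suc k"
  shows "(pad False L d, pad 0 L s, \<lambda>n. \<phi> n \<union> \<psi> n) \<in> LE_cond b"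
    and "((pad False L d, pad 0 L s, \<lambda>n. \<phi> n \<union> \<psi> n), (d, s, \<phi>)) \<in> LE_order b"
proof -
  have c': "length s = length d" "\<forall>n < length d. s ! n < b n" "\<And>n. \<phi> n \<subseteq> {..<b n}"
     "\<And>n. n \<ge> length d \<Longrightarrow> real (card (\<phi> n)) / real (b n) \<le> 2 powr (- (real n / 2 ^ k))"
    using c by (auto simp: LE_cond_rate_def)
  have "real (card (\<phi> n \<union> \<psi> n)) / real (b n) \<le> 2 powr (- (real n / 2 ^ Suc k))"
    if "n \<ge> length (pad False L d)" for n
  proof -
    have n: "n \<ge> length d" "n \<ge> L" using that by (auto simp: length_pad)
    have "real (card (\<phi> n \<union> \<psi> n)) / real (b n) \<le> real (card (\<phi> n)) / real (b n) + real (card (\<psi> n)) / real (b n)"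
      using card_Un_le[of "\<phi> n" "\<psi> n"] by (simp flip: add_divide_distrib add: divide_right_mono)
    also have "\<dots> \<le> 2 powr (- (real n / 2 ^ Suc k))"
      using L n by (intro rate_sum_bound c'(4) rate) auto
    finally show ?thesis .
  qed
  then show 1: "(pad False L d, pad 0 L s, \<lambda>n. \<phi> n \<union> \<psi> n) \<in> LE_cond b"
    using c'(1,2,3) \<psi> nth_pad_less[of s b _ L] b
    unfolding LE_cond_iff_rate LE_cond_rate_def
    by (intro exI[of _ "Suc k"]) (auto simp: length_pad)
  show "((pad False L d, pad 0 L s, \<lambda>n. \<phi> n \<union> \<psi> n), (d, s, \<phi>)) \<in> LE_order b"
    using 1 c LE_cond_iff_rate by (auto simp: LE_order_def prefix_pad ones_pad)
qed

lemma LE_cond_add_one: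
  assumes c: "(d, s, \<phi>) \<in> LE_cond b" and b: "\<And>n. 0 < b n"
    and N: "length d \<le> N" "m < b N" "m \<notin> \<phi> N"
  shows "(pad False N d @ [True], pad 0 N s @ [m], \<phi>) \<in> LE_cond b"
    and "((pad False N d @ [True], pad 0 N s @ [m], \<phi>), (d, s, \<phi>)) \<in> LE_order b"
proof -
  obtain k where c': "length s = length d" "\<forall>n < length d. s ! n < b n" "\<And>n. \<phi> n \<subseteq> {..<b n}"
     "\<And>n. n \<ge> length d \<Longrightarrow> real (card (\<phi> n)) / real (b n) \<le> 2 powr (- (real n / 2 ^ k))"
    using c by (auto simp: LE_cond_def)
  have len: "length (pad False N d) = N" "length (pad 0 N s) = N" using N c' by (auto simp: length_pad)
  show 1: "(pad False N d @ [True], pad 0 N s @ [m], \<phi>) \<in> LE_cond b"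
    unfolding LE_cond_iff_rate
  proof (rule exI[of _ k])
    have "(pad 0 N s @ [m]) ! n < b n" if "n < Suc N" for n
      using that nth_pad_less[of s b n N] c' b N len by (auto simp: nth_append less_Suc_eq)
    then show "(pad False N d @ [True], pad 0 N s @ [m], \<phi>) \<in> LE_cond_rate b k"
      unfolding LE_cond_rate_def using c' N len by auto
  qed
  have "ones (pad False N d @ [True]) = insert N (ones d)"
    unfolding ones_pad[of N d, symmetric] using len by (auto simp: ones_def nth_append less_Suc_eq)
  moreover have "(pad 0 N s @ [m]) ! N = m" using len by (simp add: nth_append)
  ultimately show "((pad False N d @ [True], pad 0 N s @ [m], \<phi>), (d, s, \<phi>)) \<in> LE_order b"
    using 1 c N by (auto simp: LE_order_def prefix_pad)
qed

text \<open>
  For \<open>n = 0\<close> the bound on \<open>\<phi>(n)\<close> is 1 and allows \<open>\<phi>(0) = b(0)\<close>, whence the hypothesis \<open>0 < N\<close>.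
\<close>

lemma LE_cond_section_proper:
  assumes "(d, s, \<phi>) \<in> LE_cond b" "length d \<le> N" "0 < N" "\<And>n. 0 < b n"
  obtains m where "m < b N" "m \<notin> \<phi> N"
proof -
  obtain k where k: "\<phi> N \<subseteq> {..<b N}" "real (card (\<phi> N)) / real (b N) \<le> 2 powr (- (real N / 2 ^ k))"
    using assms(1,2) by (auto simp: LE_cond_def)
  have "2 powr (- (real N / 2 ^ k)) < 2 powr 0"
    using assms(3) by (intro powr_less_mono) auto
  with k(2) have "real (card (\<phi> N)) / real (b N) < 1" by simp
  then have "card (\<phi> N) < b N" using assms(4)[of N] by simp
  then have "\<phi> N \<noteq> {..<b N}" by (metis card_lessThan less_irrefl)
  then have "\<not> {..<b N} \<subseteq> \<phi> N" using k(1) by blast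
  then show ?thesis using that by blast
qed

lemma LE_order_refl: "c \<in> LE_cond b \<Longrightarrow> (c, c) \<in> LE_order b"
  by (cases c) (auto simp: LE_order_def)

text \<open>
  A position that is new in the stem of \<open>c''\<close> relative to \<open>c\<close> was added either by \<open>c'\<close>, where \<open>c'\<close>
  respects \<open>c\<close>, or later, where \<open>c''\<close> respects the larger \<open>\<phi>\<close> of \<open>c'\<close>.
\<close>

lemma LE_order_trans:
  assumes "(c'', c') \<in> LE_order b" "(c', c) \<in> LE_order b"
  shows "(c'', c) \<in> LE_order b"
proof -
  obtain d s \<phi> d' s' \<phi>' d'' s'' \<phi>'' where eq: "c = (d, s, \<phi>)" "c' = (d', s', \<phi>')" "c'' = (d'', s'', \<phi>'')"
    by (cases c, cases c', cases c'')
  have a: "c \<in> LE_cond b" "c'' \<in> LE_cond b" "prefix d d'" "prefix s s'" "prefix d' d''" "prefix s' s''" 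
     "\<And>n. \<phi> n \<subseteq> \<phi>' n" "\<And>n. \<phi>' n \<subseteq> \<phi>'' n" "length s' = length d'" 
     "\<And>n. n \<in> ones d' - ones d \<Longrightarrow> s' ! n \<notin> \<phi> n" "\<And>n. n \<in> ones d'' - ones d' \<Longrightarrow> s'' ! n \<notin> \<phi>' n"
    using assms by (auto simp: LE_order_def LE_cond_def eq)
  have "s'' ! n \<notin> \<phi> n" if "n \<in> ones d'' - ones d" for n
  proof (cases "n \<in> ones d'")
    case True
    then have "s'' ! n = s' ! n" using a(6,9) by (auto simp: ones_def prefix_def nth_append)
    then show ?thesis using True a(10) that by auto
  next
    case False
    then show ?thesis using that a(8,7,11) by blast
  qed
  moreover have "prefix d d''" "prefix s s''" using a(3-6) prefix_order.trans by blast+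
  moreover have "\<phi> n \<subseteq> \<phi>'' n" for n using a(7,8) by blast
  ultimately show ?thesis using a(1,2) by (simp add: LE_order_def eq)
qed

lemma forcing_LE_order: "forcing (LE_order b)"
proof
  show "(p, p) \<in> LE_order b" if "p \<in> Field (LE_order b)" for p
    using that by (simp add: LE_order_refl Field_LE_order)
  show "(p, s) \<in> LE_order b" if "(p, q) \<in> LE_order b" "(q, s) \<in> LE_order b" for p q s
    by (rule LE_order_trans[OF that])
qed

section \<open>Reading a pair off a forcing notion\<close>

lemma forces_ground: "\<langle>Q\<rangle> R p \<longleftrightarrow> Q"
  by (simp add: fGr_def)

lemma forces_not: "(\<^bold>\<not> \<phi>) R p \<longleftrightarrow> (\<forall>q. (q, p) \<in> R \<longrightarrow> \<not> \<phi> R q)"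
  by (simp add: fnot_def)

lemma forces_and: "(\<phi> \<^bold>\<and> \<psi>) R p \<longleftrightarrow> \<phi> R p \<and> \<psi> R p"
  by (simp add: fand_def)

lemma forces_imp: "(\<phi> \<^bold>\<longrightarrow> \<psi>) R p \<longleftrightarrow> (\<forall>q. (q, p) \<in> R \<longrightarrow> \<not> (\<phi> R q \<and> (\<^bold>\<not> \<psi>) R q))"
  by (simp add: fimp_def fnot_def fand_def)

lemma forces_all: "(\<^bold>\<forall>x. \<phi> x) R p \<longleftrightarrow> (\<forall>x. \<phi> x R p)"
  by (simp add: fall_def)

lemma forces_ex: "(\<^bold>\<exists>x. \<phi> x) R p \<longleftrightarrow> (\<forall>q. (q, p) \<in> R \<longrightarrow> (\<exists>r x. (r, q) \<in> R \<and> \<phi> x R r))"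
  by (simp add: fex_def)

lemmas forces_allI = iffD2[OF forces_all, OF allI]
lemmas forces_exI = iffD2[OF forces_ex, OF allI, OF impI]

text \<open>
  Here \<open>W p d s\<close> is meant as ``\<open>p\<close> decides that \<open>(d, s)\<close> is an initial part of the stems of the generic filter''.
  There are two instances: LE itself, and a coordinate of the iteration.
\<close>

locale stem_reading = forcing R for R :: "'p rel" +
  fixes b :: "nat \<Rightarrow> nat" and W :: "'p \<Rightarrow> bool list \<Rightarrow> nat list \<Rightarrow> bool"
  assumes stem_bounded: "W p d s \<Longrightarrow> length s = length d \<and> (\<forall>n < length s. s ! n < b n)"
    and stem_field: "W p d s \<Longrightarrow> p \<in> Field R"
    and stem_agree: "W p d s \<Longrightarrow> W q d' s' \<Longrightarrow> (t, p) \<in> R \<Longrightarrow> (t, q) \<in> R \<Longrightarrow> n < length s \<Longrightarrow> n < length s' \<Longrightarrow> s ! n = s' ! n"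
    and stem_dense: "p \<in> Field R \<Longrightarrow> \<exists>q d s n. (q, p) \<in> R \<and> W q d s \<and> N \<le> n \<and> n \<in> ones d"
begin

definition read_D :: "(nat, 'p) name" where
  "read_D = {(n, p). \<exists>d s. W p d s \<and> n \<in> ones d}"

definition read_y :: "(nat \<times> nat, 'p) name" where
  "read_y = {((n, m), p). \<exists>d s. W p d s \<and> n < length s \<and> s ! n = m}"

lemma mem_nameI: "(a, p) \<in> \<tau> \<Longrightarrow> p \<in> Field R \<Longrightarrow> (a \<^bold>\<in> \<tau>) R p"
  unfolding fmem_def
proof (intro allI impI)
  fix q assume "(a, p) \<in> \<tau>" "(q, p) \<in> R"
  then show "\<exists>r t. (r, q) \<in> R \<and> (a, t) \<in> \<tau> \<and> (r, t) \<in> R"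
    using leq_refl[of q] FieldI1[of q p R] by blast
qed

lemma read_D_infinite: "f_infinite read_D R p"
  unfolding f_infinite_def
proof (intro forces_allI forces_exI)
  fix k q assume "(q, p) \<in> R"
  then obtain t d s n where "(t, q) \<in> R" "W t d s" "k \<le> n" "n \<in> ones d"
    using stem_dense[OF FieldI1, of q p k] by blast
  then show "\<exists>t n. (t, q) \<in> R \<and> (\<langle>k \<le> n\<rangle> \<^bold>\<and> n \<^bold>\<in> read_D) R t"
    using mem_nameI[of n t read_D] by (auto simp: fand_def fGr_def read_D_def intro: FieldI1)
qed

lemma read_y_prod: "f_prod_b b read_y R p"
  unfolding f_prod_b_def
proof (intro forces_allI forces_exI)
  fix n q assume "(q, p) \<in> R"
  then obtain t d s n' where t: "(t, q) \<in> R" "W t d s" "n \<le> n'" "n' \<in> ones d"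
    using stem_dense[OF FieldI1, of q p n] by blast
  then have n: "n < length s" "s ! n < b n"
    using stem_bounded[OF t(2)] by (auto simp: ones_def)
  have tF: "t \<in> Field R" using t(1) by (rule FieldI1)
  have "((n, s ! n) \<^bold>\<in> read_y) R t"
    using t n tF by (intro mem_nameI) (auto simp: read_y_def)
  moreover have "((n, m') \<^bold>\<in> read_y \<^bold>\<longrightarrow> \<langle>m' = s ! n\<rangle>) R t" for m'
    unfolding forces_imp forces_not forces_ground
  proof (intro allI impI notI)
    fix u assume "(u, t) \<in> R" "((n, m') \<^bold>\<in> read_y) R u \<and> (\<forall>q. (q, u) \<in> R \<longrightarrow> m' \<noteq> s ! n)"
    then have u: "(u, t) \<in> R" "((n, m') \<^bold>\<in> read_y) R u" "\<forall>q. (q, u) \<in> R \<longrightarrow> m' \<noteq> s ! n"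
      by blast+
    then obtain v w where v: "(v, u) \<in> R" "((n, m'), w) \<in> read_y" "(v, w) \<in> R"
      unfolding fmem_def using leq_refl FieldI1 by meson
    then obtain d' s' where "W w d' s'" "n < length s'" "s' ! n = m'" by (auto simp: read_y_def)
    then have "m' = s ! n"
      using stem_agree[OF _ t(2) v(3) _ _ n(1)] leq_trans[OF v(1) u(1)] by blast
    then show False using u(3) v(1) by blast
  qed
  ultimately show "\<exists>t m. (t, q) \<in> R \<and> (\<langle>m < b n\<rangle> \<^bold>\<and> (n, m) \<^bold>\<in> read_y \<^bold>\<and> (\<^bold>\<forall>m'. (n, m') \<^bold>\<in> read_y \<^bold>\<longrightarrow> \<langle>m' = m\<rangle>)) R t"
    using t(1) n(2) by (auto simp: fand_def fGr_def fall_def)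
qed

text \<open>
  To force that the pair read off avoids \<open>x\<close> it suffices to find, below every condition, some \<open>u\<close> and \<open>L\<close> such
  that no extension of \<open>u\<close> in which a stem puts \<open>n \<ge> L\<close> into \<open>D\<close> forces that stem's value at \<open>n\<close> to be \<open>x(n)\<close>.
  Below a condition forcing a coincidence at \<open>n\<close>, one stem witnesses \<open>n\<close> being in \<open>D\<close> and another the value at
  \<open>n\<close>; stems being coherent, the first has that value too.
\<close>

lemma read_neq_star:
  assumes avoid: "\<And>q. (q, p) \<in> R \<Longrightarrow> \<exists>u L. (u, q) \<in> R \<and>
      (\<forall>v d s n w. W v d s \<longrightarrow> (w, v) \<in> R \<longrightarrow> (w, u) \<in> R \<longrightarrow> L \<le> n \<longrightarrow> n \<in> ones d \<longrightarrow> \<not> ((n, s ! n) \<^bold>\<in> x) R w)"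
  shows "f_neq_star x read_D read_y R p"
  unfolding f_neq_star_def
proof (intro forces_allI forces_exI)
  fix q assume "(q, p) \<in> R"
  from avoid[OF this] obtain u L where u: "(u, q) \<in> R"
    and L: "\<And>v d s n w. W v d s \<Longrightarrow> (w, v) \<in> R \<Longrightarrow> (w, u) \<in> R \<Longrightarrow> L \<le> n \<Longrightarrow> n \<in> ones d \<Longrightarrow> \<not> ((n, s ! n) \<^bold>\<in> x) R w"
    by blast
  let ?E = "\<lambda>n. \<^bold>\<exists>m. (n, m) \<^bold>\<in> x \<^bold>\<and> (n, m) \<^bold>\<in> read_y"
  have "(\<langle>L \<le> n\<rangle> \<^bold>\<and> n \<^bold>\<in> read_D \<^bold>\<longrightarrow> (\<^bold>\<not> ?E n)) R u" for n
    unfolding forces_imp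
  proof (intro allI impI notI, elim conjE)
    fix t assume t: "(t, u) \<in> R" "(\<langle>L \<le> n\<rangle> \<^bold>\<and> n \<^bold>\<in> read_D) R t" "(\<^bold>\<not> (\<^bold>\<not> ?E n)) R t"
    have n: "L \<le> n" "(n \<^bold>\<in> read_D) R t" using t(2) by (auto simp: fand_def fGr_def)
    obtain t1 where t1: "(t1, t) \<in> R" "?E n R t1"
      using t(3) leq_refl[OF FieldI1[OF t(1)]] unfolding forces_not[of "\<^bold>\<not> _"] forces_not[of "?E n"] by blast
    then obtain t2 m where t2: "(t2, t1) \<in> R" "((n, m) \<^bold>\<in> x) R t2" "((n, m) \<^bold>\<in> read_y) R t2"
      using leq_refl[OF FieldI1[OF t1(1)]] unfolding forces_ex forces_and by blast
    obtain t3 v where t3: "(t3, t2) \<in> R" "((n, m), v) \<in> read_y" "(t3, v) \<in> R"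
      using t2(3) leq_refl FieldI1[OF t2(1)] unfolding fmem_def by blast
    have t3t: "(t3, t) \<in> R" using t1(1) t2(1) t3(1) leq_trans by blast
    then obtain w v' where w: "(w, t3) \<in> R" "(n, v') \<in> read_D" "(w, v') \<in> R"
      using n(2) unfolding fmem_def by blast
    obtain d s where v: "W v d s" "n < length s" "s ! n = m" using t3(2) by (auto simp: read_y_def)
    obtain d' s' where v': "W v' d' s'" "n \<in> ones d'" using w(2) by (auto simp: read_D_def)
    have "n < length s'" using v' stem_bounded by (auto simp: ones_def)
    then have "s' ! n = m"
      using stem_agree[OF v(1) v'(1) _ w(3) v(2)] leq_trans[OF w(1) t3(3)] v(3) by simp
    moreover have "((n, m) \<^bold>\<in> x) R w"
      using regular_mono[OF regular_mem t2(2)] leq_trans[OF w(1) t3(1)] by blast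
    ultimately show False
      using L[OF v'(1) w(3) _ n(1) v'(2)] leq_trans[OF w(1)] t3t t(1) leq_trans by blast
  qed
  then show "\<exists>t N. (t, q) \<in> R \<and> (\<^bold>\<forall>n. \<langle>N \<le> n\<rangle> \<^bold>\<and> n \<^bold>\<in> read_D \<^bold>\<longrightarrow> (\<^bold>\<not> ?E n)) R t"
    using u unfolding fall_def by blast
qed

end

definition LE_stem :: "(nat \<Rightarrow> nat) \<Rightarrow> cond \<Rightarrow> bool list \<Rightarrow> nat list \<Rightarrow> bool" where
  "LE_stem b p d s \<longleftrightarrow> p \<in> LE_cond b \<and> (\<exists>\<phi>. p = (d, s, \<phi>))"

lemma stem_reading_LE:
  assumes b: "\<And>n. 0 < b n"
  shows "stem_reading (LE_order b) b (LE_stem b)"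
proof -
  interpret forcing "LE_order b" by (rule forcing_LE_order)
  show ?thesis
  proof
    show "length s = length d \<and> (\<forall>n < length s. s ! n < b n)" if "LE_stem b p d s" for p d s
      using that by (auto simp: LE_stem_def LE_cond_def)
    show "p \<in> Field (LE_order b)" if "LE_stem b p d s" for p d s
      using that by (auto simp: LE_stem_def Field_LE_order)
    show "s ! n = s' ! n" if "LE_stem b p d s" "LE_stem b q d' s'" "(t, p) \<in> LE_order b"
      "(t, q) \<in> LE_order b" "n < length s" "n < length s'" for p d s q d' s' t n
      using that by (auto simp: LE_stem_def LE_order_def prefix_def nth_append)
        (metis nth_append)
    show "\<exists>q d s n. (q, p) \<in> LE_order b \<and> LE_stem b q d s \<and> N \<le> n \<and> n \<in> ones d"
      if p: "p \<in> Field (LE_order b)" for p N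
    proof -
      obtain d s \<phi> where p_eq: "p = (d, s, \<phi>)" by (cases p)
      have c: "(d, s, \<phi>) \<in> LE_cond b" using p by (simp add: p_eq Field_LE_order)
      define n where "n = Suc (max N (length d))"
      have n: "length d \<le> n" "0 < n" "N \<le> n" by (auto simp: n_def)
      obtain m where m: "m < b n" "m \<notin> \<phi> n" using LE_cond_section_proper[OF c n(1,2) b] by blast
      have "n \<in> ones (pad False n d @ [True])"
        using n by (simp add: ones_def length_pad nth_append)
      then show ?thesis
        using LE_cond_add_one[OF c b n(1) m] n(3) unfolding p_eq LE_stem_def by blast
    qed
  qed
qed

text \<open>
  The condition \<open>u\<close> in the proof has \<open>x(n)\<close> among its forbidden values for all \<open>n\<close> and a stem of length
  \<open>L\<close>, so every \<open>n \<ge> L\<close> that an extension puts into \<open>D\<close> gets a value different from \<open>x(n)\<close>.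
\<close>

lemma LE_generic_pair:
  assumes b: "\<And>n. b n \<ge> 2 ^ n"
  shows "LE_order b \<tturnstile>
            f_infinite (D_name b) \<^bold>\<and> f_prod_b b (y_name b) \<^bold>\<and>
            (\<^bold>\<forall>x. \<langle>x \<in> prod_b b\<rangle> \<^bold>\<longrightarrow>
               f_neq_star (check (LE_order b) (graph_of x)) (D_name b) (y_name b))"
proof -
  have b0: "0 < b n" for n using b[of n] by (metis less_le_trans pos2 zero_less_power)
  interpret stem_reading "LE_order b" b "LE_stem b" by (rule stem_reading_LE[OF b0])
  have D: "D_name b = read_D" by (auto simp: D_name_def read_D_def LE_stem_def)
  have y: "y_name b = read_y" by (auto simp: y_name_def read_y_def LE_stem_def)
  have neq: "f_neq_star (check (LE_order b) (graph_of x)) read_D read_y (LE_order b) p"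
    if x: "x \<in> prod_b b" for x p
  proof (rule read_neq_star)
    fix q assume "(q, p) \<in> LE_order b"
    then have "q \<in> LE_cond b" using Field_LE_order FieldI1 by metis
    then obtain d s \<phi> k where q: "q = (d, s, \<phi>)" "(d, s, \<phi>) \<in> LE_cond_rate b k"
      unfolding LE_cond_iff_rate by (cases q) auto
    define L where "L = max (length d) (2 ^ Suc k)"
    define u where "u = (pad False L d, pad 0 L s, \<lambda>n. \<phi> n \<union> {x n})"
    have rate: "real (card {x n}) / real (b n) \<le> 2 powr (- (real n / 2 ^ k))" for n
      by (rule small_section_rate[OF b]) simp
    have uq: "(u, q) \<in> LE_order b"
      unfolding u_def q(1)
      by (rule LE_cond_pad_Un(2)[OF q(2) b0 _ rate]) (use x in \<open>auto simp: prod_b_def L_def\<close>)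
    have "\<not> ((n, sv ! n) \<^bold>\<in> check (LE_order b) (graph_of x)) (LE_order b) w"
      if h: "LE_stem b v dv sv" "(w, v) \<in> LE_order b" "(w, u) \<in> LE_order b" "L \<le> n" "n \<in> ones dv"
      for v dv sv n w
    proof -
      obtain dw sw \<phi>w where w: "w = (dw, sw, \<phi>w)" by (cases w)
      obtain \<phi>v where v: "v = (dv, sv, \<phi>v)" using h(1) by (auto simp: LE_stem_def)
      have "length sv = length dv" using h(1) by (auto simp: LE_stem_def LE_cond_def)
      then have "n \<in> ones dw" "sw ! n = sv ! n"
        using h(2,5) by (auto simp: w v LE_order_def ones_def prefix_def nth_append)
      moreover have "n \<notin> ones (pad False L d)"
        using h(4) by (simp add: ones_pad) (simp add: ones_def L_def)
      ultimately have "sv ! n \<noteq> x n" using h(3) by (auto simp: w u_def LE_order_def)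
      moreover have "w \<in> Field (LE_order b)" using h(2) by (rule FieldI1)
      ultimately show ?thesis
        using forces_check_mem[of "LE_order b" w "(n, sv ! n)" "graph_of x"] leq_refl
        by (auto simp: graph_of_def)
    qed
    then show "\<exists>u L. (u, q) \<in> LE_order b \<and> (\<forall>v dv sv n w. LE_stem b v dv sv \<longrightarrow> (w, v) \<in> LE_order b \<longrightarrow>
       (w, u) \<in> LE_order b \<longrightarrow> L \<le> n \<longrightarrow> n \<in> ones dv \<longrightarrow>
       \<not> ((n, sv ! n) \<^bold>\<in> check (LE_order b) (graph_of x)) (LE_order b) w)"
      using uq by blast
  qed
  have "(\<langle>x \<in> prod_b b\<rangle> \<^bold>\<longrightarrow> f_neq_star (check (LE_order b) (graph_of x)) read_D read_y) (LE_order b) p"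
    for x p
    using neq leq_refl FieldI1 unfolding fimp_def fnot_def fand_def fGr_def by metis
  then show ?thesis
    unfolding forced_def fand_def fall_def D y using read_D_infinite read_y_prod by blast
qed

section \<open>Deciding names\<close>

context forcing
begin

lemma LE_le_refl:
  assumes "p \<in> Field R" "f_LE_cond b \<tau> R p"
  shows "f_LE_le \<tau> \<tau> R p"
  unfolding forces_LE_le_iff[OF assms(1,2,2)]
  by (rule generically_mono[OF assms(2)[unfolded forces_LE_cond_iff[OF assms(1)]]])
     (meson LE_order_refl)

lemma LE_le_trans:
  assumes "p \<in> Field R" "f_LE_cond b \<rho> R p" "f_LE_cond b \<sigma> R p" "f_LE_cond b \<tau> R p"
    and "f_LE_le \<rho> \<sigma> R p" "f_LE_le \<sigma> \<tau> R p"
  shows "f_LE_le \<rho> \<tau> R p"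
proof -
  have 1: "generically R (\<lambda>G. p \<in> G \<longrightarrow> (\<exists>c'\<in>LE_cond b. \<exists>c\<in>LE_cond b.
       val \<rho> G = code_of c' \<and> val \<sigma> G = code_of c \<and> (c', c) \<in> LE_order b))"
    using assms(5) forces_LE_le_iff[OF assms(1,2,3)] by simp
  have 2: "generically R (\<lambda>G. p \<in> G \<longrightarrow> (\<exists>c'\<in>LE_cond b. \<exists>c\<in>LE_cond b.
       val \<sigma> G = code_of c' \<and> val \<tau> G = code_of c \<and> (c', c) \<in> LE_order b))"
    using assms(6) forces_LE_le_iff[OF assms(1,3,4)] by simp
  show ?thesis
    unfolding forces_LE_le_iff[OF assms(1,2,4)]
  proof (rule generically_mono[OF generically_conj[OF 1 2]], intro impI)
    fix G assume p: "p \<in> G" and *: "(p \<in> G \<longrightarrow> (\<exists>c'\<in>LE_cond b. \<exists>c\<in>LE_cond b.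
       val \<rho> G = code_of c' \<and> val \<sigma> G = code_of c \<and> (c', c) \<in> LE_order b)) \<and>
       (p \<in> G \<longrightarrow> (\<exists>c'\<in>LE_cond b. \<exists>c\<in>LE_cond b.
       val \<sigma> G = code_of c' \<and> val \<tau> G = code_of c \<and> (c', c) \<in> LE_order b))"
    obtain c1 c2 where c: "c1\<in>LE_cond b" "val \<rho> G = code_of c1" "val \<sigma> G = code_of c2" "(c1, c2) \<in> LE_order b"
      using * p by blast
    obtain c2' c3 where c': "c3\<in>LE_cond b" "val \<sigma> G = code_of c2'" "val \<tau> G = code_of c3" "(c2', c3) \<in> LE_order b"
      using * p by blast
    have "c2 = c2'" using c(3) c'(2) code_of_inject by metis
    then have "(c1, c3) \<in> LE_order b" using LE_order_trans c(4) c'(4) by blast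
    then show "\<exists>c'\<in>LE_cond b. \<exists>c\<in>LE_cond b.
       val \<rho> G = code_of c' \<and> val \<tau> G = code_of c \<and> (c', c) \<in> LE_order b"
      using c(1,2) c'(1,3) by blast
  qed
qed

lemma forces_LE_cond_stem_iff:
  assumes "p \<in> Field R"
  shows "f_LE_cond_stem b \<tau> d s k R p \<longleftrightarrow> generically R
     (\<lambda>G. p \<in> G \<longrightarrow> (\<exists>\<phi>. val \<tau> G = code_of (d, s, \<phi>) \<and> (d, s, \<phi>) \<in> LE_cond_rate b k))"
  by (rule forces_iff_generically[OF regular_LE_cond_stem mirrors_LE_cond_stem assms])

lemma forces_LE_cond_of_stem:
  assumes "p \<in> Field R" "f_LE_cond_stem b \<tau> d s k R p"
  shows "f_LE_cond b \<tau> R p"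
  unfolding forces_LE_cond_iff[OF assms(1)]
  by (rule generically_mono[OF assms(2)[unfolded forces_LE_cond_stem_iff[OF assms(1)]]])
     (metis LE_cond_iff_rate)

lemma truth_below:
  assumes "cond_filter R G" "p \<in> G" "regular R \<phi>" "\<exists>q\<in>G. \<phi> R q"
  shows "\<exists>q\<in>G. (q, p) \<in> R \<and> \<phi> R q"
proof -
  obtain q where q: "q \<in> G" "\<phi> R q" using assms(4) by blast
  obtain t where "t \<in> G" "(t, q) \<in> R" "(t, p) \<in> R"
    using cond_filter_directed[OF assms(1) q(1) assms(2)] by blast
  then show ?thesis using regular_mono[OF assms(3) q(2)] by blast
qed

text \<open>
  Densely many conditions decide stem and rate of a name of a condition: in a generic filter the value has
  some stem and rate, and by the truth lemma a member of the filter forces this.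
\<close>

lemma LE_cond_decide_stem:
  assumes p: "p \<in> Field R" and \<tau>: "f_LE_cond b \<tau> R p"
  obtains q d s k where "(q, p) \<in> R" "f_LE_cond_stem b \<tau> d s k R q"
proof -
  have gen: "generically R (\<lambda>G. \<forall>d s k. (\<exists>p\<in>G. f_LE_cond_stem b \<tau> d s k R p) \<longleftrightarrow>
      (\<exists>\<phi>. val \<tau> G = code_of (d, s, \<phi>) \<and> (d, s, \<phi>) \<in> LE_cond_rate b k))"
    by (intro generically_all mirrors_LE_cond_stem[unfolded mirrors_def])
  obtain G where G: "cond_filter R G" "p \<in> G"
    "\<forall>d s k. (\<exists>p\<in>G. f_LE_cond_stem b \<tau> d s k R p) \<longleftrightarrow>
      (\<exists>\<phi>. val \<tau> G = code_of (d, s, \<phi>) \<and> (d, s, \<phi>) \<in> LE_cond_rate b k)"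
    "\<exists>c\<in>LE_cond b. val \<tau> G = code_of c"
    by (rule generic_exists[OF generically_conj[OF gen \<tau>[unfolded forces_LE_cond_iff[OF p]]] p]) blast
  then obtain d s \<phi> k where "val \<tau> G = code_of (d, s, \<phi>)" "(d, s, \<phi>) \<in> LE_cond_rate b k"
    unfolding LE_cond_iff_rate Bex_def split_paired_Ex by blast
  then have "\<exists>q\<in>G. f_LE_cond_stem b \<tau> d s k R q" using G(3) by blast
  then show ?thesis using truth_below[OF G(1,2) regular_LE_cond_stem] that by blast
qed

text \<open>
  Supplies the value of \<open>y\<close> when \<open>n\<close> is added to \<open>D\<close>.
\<close>

lemma stem_decide_avoided:
  assumes p: "p \<in> Field R" and \<tau>: "f_LE_cond_stem b \<tau> d s k R p"
    and n: "length d \<le> n" "0 < n" and b: "\<And>n. 0 < b n"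
  obtains q m where "(q, p) \<in> R" "m < b n" "(\<^bold>\<not> Inr (n, m) \<^bold>\<in> \<tau>) R q"
proof -
  have gen: "generically R (\<lambda>G. \<forall>m. (\<exists>p\<in>G. (\<^bold>\<not> Inr (n, m) \<^bold>\<in> \<tau>) R p) \<longleftrightarrow> \<not> Inr (n, m) \<in> val \<tau> G)"
    using mirrors_not[OF regular_mem mirrors_mem] unfolding mirrors_def by (intro generically_all)
  obtain G where G: "cond_filter R G" "p \<in> G"
    "\<forall>m. (\<exists>p\<in>G. (\<^bold>\<not> Inr (n, m) \<^bold>\<in> \<tau>) R p) \<longleftrightarrow> \<not> Inr (n, m) \<in> val \<tau> G"
    "\<exists>\<phi>. val \<tau> G = code_of (d, s, \<phi>) \<and> (d, s, \<phi>) \<in> LE_cond_rate b k"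
    by (rule generic_exists[OF generically_conj[OF gen \<tau>[unfolded forces_LE_cond_stem_iff[OF p]]] p]) blast
  then obtain \<phi> where \<phi>: "val \<tau> G = code_of (d, s, \<phi>)" "(d, s, \<phi>) \<in> LE_cond b"
    unfolding LE_cond_iff_rate by blast
  obtain m where m: "m < b n" "m \<notin> \<phi> n" using LE_cond_section_proper[OF \<phi>(2) n b] by blast
  then have "Inr (n, m) \<notin> val \<tau> G" using \<phi>(1) by (simp add: code_of_eq_iff)
  then have "\<exists>q\<in>G. (\<^bold>\<not> Inr (n, m) \<^bold>\<in> \<tau>) R q" using G(3) by blast
  from truth_below[OF G(1,2) regular_not[OF regular_mem] this]
  obtain q where "(q, p) \<in> R" "(\<^bold>\<not> Inr (n, m) \<^bold>\<in> \<tau>) R q" by blast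
  then show ?thesis by (rule that[OF _ m(1)])
qed

text \<open>
  The value \<open>m\<close> is the only one forced by any extension of \<open>s\<close>, so that a condition below \<open>p\<close> forces
  at most one value (\<open>f_prod_b_unique\<close>).
\<close>

lemma f_prod_b_value:
  assumes y: "f_prod_b b y R p" and q: "(q, p) \<in> R"
  obtains s m where "(s, q) \<in> R" "m < b n" "((n, m) \<^bold>\<in> y) R s"
    "\<And>t m'. (t, s) \<in> R \<Longrightarrow> ((n, m') \<^bold>\<in> y) R t \<Longrightarrow> m' = m"
proof -
  obtain s m where s: "(s, q) \<in> R" "m < b n" "((n, m) \<^bold>\<in> y) R s"
    "\<And>m'. ((n, m') \<^bold>\<in> y \<^bold>\<longrightarrow> \<langle>m' = m\<rangle>) R s"
    using y q unfolding f_prod_b_def forces_all forces_ex forces_and forces_ground fall_def by blast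
  have "m' = m" if "(t, s) \<in> R" "((n, m') \<^bold>\<in> y) R t" for t m'
    using s(4)[of m'] that unfolding forces_imp forces_not forces_ground by blast
  then show ?thesis using that s by blast
qed

lemma f_prod_b_unique:
  assumes y: "f_prod_b b y R p" and q: "(q, p) \<in> R" "((n, m) \<^bold>\<in> y) R q" "((n, m') \<^bold>\<in> y) R q"
  shows "m = m'"
proof -
  obtain s m0 where "(s, q) \<in> R" "\<And>t m'. (t, s) \<in> R \<Longrightarrow> ((n, m') \<^bold>\<in> y) R t \<Longrightarrow> m' = m0"
    using f_prod_b_value[OF y q(1)] by metis
  then show ?thesis
    using regular_mono[OF regular_mem q(2)] regular_mono[OF regular_mem q(3)]
      leq_refl[OF FieldI1] by metis
qed

text \<open>
  A set of pairwise incompatible members of \<open>E\<close>, maximal by Zorn's lemma; if some \<open>e\<close> in \<open>E\<close> were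
  incompatible with all its members, \<open>e\<close> could be added.
\<close>

lemma maximal_antichain:
  "\<exists>T. T \<subseteq> E \<and> (\<forall>s\<in>T. \<forall>t\<in>T. s \<noteq> t \<longrightarrow> \<not> (\<exists>u. (u, s) \<in> R \<and> (u, t) \<in> R)) \<and>
    (\<forall>e\<in>E. e \<in> Field R \<longrightarrow> (\<exists>t\<in>T. \<exists>u. (u, e) \<in> R \<and> (u, t) \<in> R))"
proof -
  let ?anti = "\<lambda>T. \<forall>s\<in>T. \<forall>t\<in>T. s \<noteq> t \<longrightarrow> \<not> (\<exists>u. (u, s) \<in> R \<and> (u, t) \<in> R)"
  let ?\<A> = "{T. T \<subseteq> E \<and> ?anti T}"
  have "\<exists>M\<in>?\<A>. \<forall>X\<in>?\<A>. M \<subseteq> X \<longrightarrow> X = M"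
  proof (rule subset_Zorn')
    fix C assume C: "subset.chain ?\<A> C"
    have CA: "C \<subseteq> ?\<A>" and CT: "\<forall>S\<in>C. \<forall>T\<in>C. S \<subseteq> T \<or> T \<subseteq> S"
      using C by (simp_all add: subset_chain_def)
    have C1: "S \<subseteq> E" "?anti S" if "S \<in> C" for S
      using subsetD[OF CA that] by simp_all
    have C2: "S \<subseteq> T \<or> T \<subseteq> S" if "S \<in> C" "T \<in> C" for S T
      using CT that by simp
    have "?anti (\<Union>C)"
    proof (intro ballI impI)
      fix s t assume "s \<in> \<Union>C" "t \<in> \<Union>C" "s \<noteq> t"
      then obtain S T where "S \<in> C" "T \<in> C" "s \<in> S" "t \<in> T" by blast
      then have "(s \<in> T \<and> t \<in> T) \<or> (s \<in> S \<and> t \<in> S)" using C2[of S T] by blast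
      then show "\<not> (\<exists>u. (u, s) \<in> R \<and> (u, t) \<in> R)"
        using C1(2)[OF \<open>S \<in> C\<close>] C1(2)[OF \<open>T \<in> C\<close>] \<open>s \<noteq> t\<close> by blast
    qed
    then show "\<Union>C \<in> ?\<A>" using C1(1) by blast
  qed
  then obtain T where T: "T \<in> ?\<A>" "\<forall>X\<in>?\<A>. T \<subseteq> X \<longrightarrow> X = T" by (rule bexE)
  have "\<exists>t\<in>T. \<exists>u. (u, e) \<in> R \<and> (u, t) \<in> R" if e: "e \<in> E" "e \<in> Field R" for e
  proof (rule ccontr)
    assume no: "\<not> ?thesis"
    have "?anti (insert e T)"
    proof (intro ballI impI)
      fix s t assume "s \<in> insert e T" "t \<in> insert e T" "s \<noteq> t"
      then consider "s \<in> T" "t \<in> T" | "s = e" "t \<in> T" | "s \<in> T" "t = e" by blast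
      then show "\<not> (\<exists>u. (u, s) \<in> R \<and> (u, t) \<in> R)"
      proof cases
        case 1
        then show ?thesis using T(1) \<open>s \<noteq> t\<close> by simp
      qed (use no in blast)+
    qed
    then have "insert e T \<in> ?\<A>" using T(1) e(1) by simp
    \<comment> \<open>Maximality of \<open>T\<close>.\<close>
    from T(2)[rule_format, OF this] have "e \<in> T" by blast
    then show False using no leq_refl[OF e(2)] by blast
  qed
  then show ?thesis using T(1) by (intro exI[of _ T]) simp
qed

end

section \<open>Antichains of finite partial functions\<close>

text \<open>
  The countable chain condition for finite partial functions into a countable set, without
  \<open>\<Delta>\<close>-systems: by induction on a bound \<open>n\<close> for the sizes of the domains.  If \<open>f0\<close> is in the
  family, every other member has a value on the finite domain of \<open>f0\<close>, so the family is a countable union of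
  pieces whose members share a value \<open>v\<close> at a point \<open>i\<close>.  Removing \<open>i\<close> from the domains keeps the
  members of a piece pairwise incompatible and lowers the bound.
\<close>

lemma countable_incompatible_maps:
  fixes F :: "('i \<rightharpoonup> 'v::countable) set"
  assumes fin: "\<And>f. f \<in> F \<Longrightarrow> finite (dom f)"
    and inc: "\<And>f g. f \<in> F \<Longrightarrow> g \<in> F \<Longrightarrow> f \<noteq> g \<Longrightarrow> \<exists>i\<in>dom f \<inter> dom g. f i \<noteq> g i"
  shows "countable F"
proof -
  have "countable H" if "\<And>f. f \<in> H \<Longrightarrow> finite (dom f) \<and> card (dom f) \<le> n"
    "\<And>f g. f \<in> H \<Longrightarrow> g \<in> H \<Longrightarrow> f \<noteq> g \<Longrightarrow> \<exists>i\<in>dom f \<inter> dom g. f i \<noteq> g i"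
    for n and H :: "('i \<rightharpoonup> 'v) set"
    using that
  proof (induction n arbitrary: H)
    case 0
    have "f = Map.empty" if "f \<in> H" for f using 0(1)[OF that] by (metis card_0_eq dom_eq_empty_conv le_zero_eq)
    then have "H \<subseteq> {Map.empty}" by blast
    then show ?case by (rule countable_subset) simp
  next
    case (Suc n)
    show ?case
    proof (cases "H = {}")
      case False
      then obtain f0 where f0: "f0 \<in> H" by blast
      have sub: "H \<subseteq> {f0} \<union> (\<Union>i\<in>dom f0. \<Union>v. {g \<in> H. g i = Some v})"
      proof
        fix g assume g: "g \<in> H"
        show "g \<in> {f0} \<union> (\<Union>i\<in>dom f0. \<Union>v. {g \<in> H. g i = Some v})"
        proof (cases "g = f0")
          case False
          then obtain i where "i \<in> dom f0" "i \<in> dom g" using Suc.prems(2)[OF g f0] by blast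
          then show ?thesis using g by blast
        qed simp
      qed
      have "countable {g \<in> H. g i = Some v}" for i v
      proof -
        let ?e = "\<lambda>g. g(i := None)" and ?H = "{g \<in> H. g i = Some v}"
        have inj: "inj_on ?e ?H"
        proof (rule inj_onI)
          fix g h assume gh: "g \<in> ?H" "h \<in> ?H" "?e g = ?e h"
          have "g = (?e g)(i := Some v)" "h = (?e h)(i := Some v)" using gh(1,2) by (simp_all add: fun_upd_idem)
          then show "g = h" using gh(3) by simp
        qed
        have "countable (?e ` ?H)"
        proof (rule Suc.IH)
          show "finite (dom f) \<and> card (dom f) \<le> n" if f: "f \<in> ?e ` ?H" for f
          proof -
            obtain g where g: "g \<in> H" "g i = Some v" "f = ?e g" using f by blast
            then have "dom f = dom g - {i}" "i \<in> dom g" by auto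
            then show ?thesis using Suc.prems(1)[OF g(1)] by (simp add: le_diff_conv)
          qed
          fix f f' assume ff: "f \<in> ?e ` ?H" "f' \<in> ?e ` ?H" "f \<noteq> f'"
          obtain g g' where g: "g \<in> H" "g' \<in> H" "g i = g' i" "f = ?e g" "f' = ?e g'"
            using ff(1,2) by auto
          then have "g \<noteq> g'" using ff(3) by blast
          then obtain j where j: "j \<in> dom g" "j \<in> dom g'" "g j \<noteq> g' j"
            using Suc.prems(2)[OF g(1,2)] by blast
          then have "j \<noteq> i" using g(3) by blast
          then have "f j = g j" "f' j = g' j" by (simp_all add: g)
          then show "\<exists>j\<in>dom f \<inter> dom f'. f j \<noteq> f' j" using j by (intro bexI[of _ j]) auto
        qed
        then show ?thesis using inj by (rule countable_image_inj_on)
      qed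
      then have "countable ({f0} \<union> (\<Union>i\<in>dom f0. \<Union>v. {g \<in> H. g i = Some v}))"
        using Suc.prems(1)[OF f0] by (intro countable_Un countable_UN) (auto intro: countable_finite)
      then show ?thesis using sub by (rule countable_subset[rotated])
    qed simp
  qed
  then have "countable {f \<in> F. card (dom f) \<le> n}" for n
    using fin inc by (metis (no_types, lifting) mem_Collect_eq)
  then have "countable (\<Union>n. {f \<in> F. card (dom f) \<le> n})" by auto
  then show ?thesis by (rule countable_subset[rotated]) auto
qed

section \<open>Stages of the iteration\<close>

text \<open>
  The parameter \<open>K\<close> fixes the type \<open>'k\<close> that indexes the names inside conditions.
\<close>

locale LE_iter =
  fixes b :: "nat \<Rightarrow> nat" and r :: "'i rel" and K :: "'k itself"
  assumes b_large: "2 ^ n \<le> b n" and wo: "Well_order r" and inf: "infinite (UNIV :: 'k set)"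
begin

text \<open>
  For every set \<open>A\<close> of coordinates, \<open>conds A\<close> consists of the conditions with support in \<open>A\<close>.  The stages
  at the various \<open>\<gamma>\<close> and the full iteration are all of this form, with the same orders on common conditions.
\<close>

abbreviation stage_le :: "'i set \<Rightarrow> ('i, 'k) icond rel" where
  "stage_le A \<equiv> stage_order b r A (iter_stage b r)"

abbreviation conds :: "'i set \<Rightarrow> ('i, 'k) icond set" where
  "conds A \<equiv> stage_conds b r A (iter_stage b r)"

abbreviation stage_at :: "'i \<Rightarrow> ('i, 'k) icond rel" where
  "stage_at \<gamma> \<equiv> stage_le (underS r \<gamma>)"

lemma b_pos: "0 < b n"
  using b_large[of n] by (metis less_le_trans pos2 zero_less_power)

lemma iter_stage_eq: "iter_stage b r \<gamma> = stage_at \<gamma>"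
  by (rule iter_stage_unfold[OF wo])

lemma coords_restr: "coords (restr r p \<gamma>) \<delta> = (if \<delta> \<in> underS r \<gamma> then coords p \<delta> else None)"
  by (simp add: restr_def restrict_map_def)

lemma dom_restr: "dom (coords (restr r p \<gamma>)) = dom (coords p) \<inter> underS r \<gamma>"
  by (auto simp: restr_def)

lemma underS_trans: "\<delta> \<in> underS r \<gamma> \<Longrightarrow> underS r \<delta> \<subseteq> underS r \<gamma>"
  using wo unfolding well_order_on_def linear_order_on_def partial_order_on_def preorder_on_def
  by (auto simp: underS_def dest: transD antisymD)

lemma icond_eqI: "(\<And>\<delta>. coords p \<delta> = coords q \<delta>) \<Longrightarrow> p = q"
  by (cases p, cases q) auto

lemma restr_restr: "\<delta> \<in> underS r \<gamma> \<Longrightarrow> restr r (restr r p \<gamma>) \<delta> = restr r p \<delta>"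
  by (rule icond_eqI) (use underS_trans in \<open>auto simp: coords_restr\<close>)

lemma restr_cong: "(\<And>\<delta>. \<delta> \<in> underS r \<gamma> \<Longrightarrow> coords p \<delta> = coords q \<delta>) \<Longrightarrow> restr r p \<gamma> = restr r q \<gamma>"
  by (rule icond_eqI) (auto simp: coords_restr)

lemma restr_id: "dom (coords p) \<subseteq> underS r \<gamma> \<Longrightarrow> restr r p \<gamma> = p"
  by (rule icond_eqI, unfold coords_restr) (metis domIff subsetD)

lemma wf_r: "wf (r - Id)"
  using wo by (simp add: well_order_on_def)

lemma underS_induct:
  assumes "\<And>\<gamma>. (\<And>\<delta>. \<delta> \<in> underS r \<gamma> \<Longrightarrow> P \<delta>) \<Longrightarrow> P \<gamma>"
  shows "P \<gamma>"
  using wf_r by (induction \<gamma> rule: wf_induct_rule) (use assms in \<open>auto simp: underS_def\<close>)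

text \<open>
  The recursion behind conditions and order, with the earlier stages written in the same form as the stage
  under consideration.
\<close>

lemma conds_iff_Field:
  "p \<in> conds A \<longleftrightarrow> finite (dom (coords p)) \<and> dom (coords p) \<subseteq> A \<and>
     (\<forall>\<gamma> \<tau>. coords p \<gamma> = Some \<tau> \<longrightarrow> restr r p \<gamma> \<in> Field (stage_at \<gamma>) \<and> snd ` nm \<tau> \<subseteq> Field (stage_at \<gamma>) \<and>
        f_LE_cond b (nm \<tau>) (stage_at \<gamma>) (restr r p \<gamma>))"
  by (simp only: iter_stage_eq[symmetric]) (simp add: stage_conds_def)

lemma stage_le_iff:
  "(q, p) \<in> stage_le A \<longleftrightarrow> q \<in> conds A \<and> p \<in> conds A \<and> dom (coords p) \<subseteq> dom (coords q) \<and>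
     (\<forall>\<gamma> \<sigma> \<tau>. coords q \<gamma> = Some \<sigma> \<longrightarrow> coords p \<gamma> = Some \<tau> \<longrightarrow>
           f_LE_le (nm \<sigma>) (nm \<tau>) (stage_at \<gamma>) (restr r q \<gamma>))"
  by (simp only: iter_stage_eq[symmetric]) (simp add: stage_order_def)

text \<open>
  Forcing with a stage presupposes a preorder, while the order of a stage is defined by forcing with
  the earlier stages.  The circle is broken by induction: reflexivity and transitivity at \<open>\<gamma>\<close> come
  from those of the sentence \<open>f_LE_le\<close>, which are available if stage \<open>\<gamma>\<close> is a preorder.
\<close>

lemma stage_preorder_step:
  assumes IH: "\<And>\<gamma>. \<gamma> \<in> A \<Longrightarrow> forcing (stage_at \<gamma>) \<and> Field (stage_at \<gamma>) = conds (underS r \<gamma>)"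
  shows "forcing (stage_le A) \<and> Field (stage_le A) = conds A"
proof -
  have refl: "(p, p) \<in> stage_le A" if p: "p \<in> conds A" for p
    unfolding stage_le_iff
  proof (intro conjI allI impI)
    fix \<gamma> \<sigma> \<tau> assume \<sigma>: "coords p \<gamma> = Some \<sigma>" "coords p \<gamma> = Some \<tau>"
    then have "\<gamma> \<in> A" using p unfolding conds_iff_Field by blast
    then interpret forcing "stage_at \<gamma>" using IH by simp
    show "f_LE_le (nm \<sigma>) (nm \<tau>) (stage_at \<gamma>) (restr r p \<gamma>)"
      using \<sigma> p LE_le_refl unfolding conds_iff_Field[of p A] by (metis option.inject)
  qed (use p in auto)
  have F: "Field (stage_le A) = conds A"
  proof
    show "Field (stage_le A) \<subseteq> conds A" unfolding Field_def using stage_le_iff by blast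
    show "conds A \<subseteq> Field (stage_le A)" by (intro subsetI FieldI1[OF refl])
  qed
  have trans: "(q, p) \<in> stage_le A" if qs: "(q, s) \<in> stage_le A" and sp: "(s, p) \<in> stage_le A" for p q s
    unfolding stage_le_iff
  proof (intro conjI allI impI)
    show "q \<in> conds A" "p \<in> conds A" "dom (coords p) \<subseteq> dom (coords q)"
      using qs sp unfolding stage_le_iff by blast+
    fix \<gamma> \<sigma> \<tau> assume \<sigma>: "coords q \<gamma> = Some \<sigma>" "coords p \<gamma> = Some \<tau>"
    then obtain \<rho> where \<rho>: "coords s \<gamma> = Some \<rho>" using sp unfolding stage_le_iff by blast
    have \<gamma>: "\<gamma> \<in> A" using \<sigma> qs unfolding stage_le_iff conds_iff_Field[of q] by blast
    interpret forcing "stage_at \<gamma>" using IH[OF \<gamma>] by simp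
    have q: "restr r q \<gamma> \<in> Field (stage_at \<gamma>)" "f_LE_cond b (nm \<sigma>) (stage_at \<gamma>) (restr r q \<gamma>)"
      using qs \<sigma> unfolding stage_le_iff conds_iff_Field[of q] by blast+
    have s: "restr r s \<gamma> \<in> Field (stage_at \<gamma>)" "f_LE_cond b (nm \<rho>) (stage_at \<gamma>) (restr r s \<gamma>)"
      using qs \<rho> unfolding stage_le_iff conds_iff_Field[of s] by blast+
    have p: "restr r p \<gamma> \<in> Field (stage_at \<gamma>)" "f_LE_cond b (nm \<tau>) (stage_at \<gamma>) (restr r p \<gamma>)"
      using sp \<sigma> unfolding stage_le_iff conds_iff_Field[of p] by blast+
    have le: "f_LE_le (nm \<sigma>) (nm \<rho>) (stage_at \<gamma>) (restr r q \<gamma>)" "f_LE_le (nm \<rho>) (nm \<tau>) (stage_at \<gamma>) (restr r s \<gamma>)"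
      using qs sp \<rho> \<sigma> unfolding stage_le_iff[of q] stage_le_iff[of s] by blast+
    have R: "(restr r x \<gamma>, restr r y \<gamma>) \<in> stage_at \<gamma>"
      if xy: "(x, y) \<in> stage_le A" "restr r x \<gamma> \<in> Field (stage_at \<gamma>)" "restr r y \<gamma> \<in> Field (stage_at \<gamma>)" for x y
    proof -
      have "restr r x \<gamma> \<in> conds (underS r \<gamma>)" "restr r y \<gamma> \<in> conds (underS r \<gamma>)"
        using xy(2,3) IH[OF \<gamma>] by blast+
      moreover have "dom (coords (restr r y \<gamma>)) \<subseteq> dom (coords (restr r x \<gamma>))"
        using xy(1) unfolding stage_le_iff dom_restr by blast
      moreover have "f_LE_le (nm \<sigma>') (nm \<tau>') (stage_at \<delta>) (restr r (restr r x \<gamma>) \<delta>)"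
        if "coords (restr r x \<gamma>) \<delta> = Some \<sigma>'" "coords (restr r y \<gamma>) \<delta> = Some \<tau>'" for \<delta> \<sigma>' \<tau>'
        using that xy(1) restr_restr[of \<delta> \<gamma> x] unfolding stage_le_iff[of x]
        by (auto simp: coords_restr split: if_splits)
      ultimately show ?thesis unfolding stage_le_iff[of "restr r x \<gamma>"] by blast
    qed
    have qs': "(restr r q \<gamma>, restr r s \<gamma>) \<in> stage_at \<gamma>" using R[OF qs q(1) s(1)] .
    have sp': "(restr r s \<gamma>, restr r p \<gamma>) \<in> stage_at \<gamma>" using R[OF sp s(1) p(1)] .
    show "f_LE_le (nm \<sigma>) (nm \<tau>) (stage_at \<gamma>) (restr r q \<gamma>)"
      by (rule LE_le_trans[OF q(1,2) regular_mono[OF regular_LE_cond s(2) qs']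
            regular_mono[OF regular_LE_cond p(2) leq_trans[OF qs' sp']] le(1)
            regular_mono[OF regular_LE_le le(2) qs']])
  qed
  show ?thesis
    using F refl trans by (simp add: forcing_def)
qed

lemma stage_at_preorder: "forcing (stage_at \<gamma>) \<and> Field (stage_at \<gamma>) = conds (underS r \<gamma>)"
  by (induction \<gamma> rule: underS_induct) (rule stage_preorder_step)

lemma forcing_stage_le: "forcing (stage_le A)" and Field_stage_le: "Field (stage_le A) = conds A"
  using stage_preorder_step[of A] stage_at_preorder by blast+

lemma conds_iff:
  "p \<in> conds A \<longleftrightarrow> finite (dom (coords p)) \<and> dom (coords p) \<subseteq> A \<and>
     (\<forall>\<gamma> \<tau>. coords p \<gamma> = Some \<tau> \<longrightarrow> restr r p \<gamma> \<in> conds (underS r \<gamma>) \<and>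
        snd ` nm \<tau> \<subseteq> conds (underS r \<gamma>) \<and> f_LE_cond b (nm \<tau>) (stage_at \<gamma>) (restr r p \<gamma>))"
  by (simp add: conds_iff_Field[of p] Field_stage_le)

lemma restr_conds:
  assumes "p \<in> conds A" shows "restr r p \<gamma> \<in> conds (underS r \<gamma>)"
  unfolding conds_iff[of "restr r p \<gamma>"]
proof (intro conjI allI impI)
  show "finite (dom (coords (restr r p \<gamma>)))" using assms by (auto simp: dom_restr conds_iff[of p])
  show "dom (coords (restr r p \<gamma>)) \<subseteq> underS r \<gamma>" by (simp add: dom_restr)
  fix \<delta> \<tau> assume "coords (restr r p \<gamma>) \<delta> = Some \<tau>"
  then have \<delta>: "\<delta> \<in> underS r \<gamma>" "coords p \<delta> = Some \<tau>" by (auto simp: coords_restr split: if_splits)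
  show "restr r (restr r p \<gamma>) \<delta> \<in> conds (underS r \<delta>)" "snd ` nm \<tau> \<subseteq> conds (underS r \<delta>)"
    "f_LE_cond b (nm \<tau>) (stage_at \<delta>) (restr r (restr r p \<gamma>) \<delta>)"
    using assms \<delta>(2) unfolding restr_restr[OF \<delta>(1)] conds_iff[of p] by blast+
qed

lemma restr_stage_le:
  assumes "(q, p) \<in> stage_le A" shows "(restr r q \<gamma>, restr r p \<gamma>) \<in> stage_at \<gamma>"
  unfolding stage_le_iff[of "restr r q \<gamma>"]
proof (intro conjI allI impI)
  show "restr r q \<gamma> \<in> conds (underS r \<gamma>)" "restr r p \<gamma> \<in> conds (underS r \<gamma>)"
    using assms restr_conds unfolding stage_le_iff by blast+
  show "dom (coords (restr r p \<gamma>)) \<subseteq> dom (coords (restr r q \<gamma>))"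
    using assms unfolding stage_le_iff dom_restr by blast
  fix \<delta> \<sigma> \<tau> assume "coords (restr r q \<gamma>) \<delta> = Some \<sigma>" "coords (restr r p \<gamma>) \<delta> = Some \<tau>"
  then have \<delta>: "\<delta> \<in> underS r \<gamma>" "coords q \<delta> = Some \<sigma>" "coords p \<delta> = Some \<tau>"
    by (auto simp: coords_restr split: if_splits)
  show "f_LE_le (nm \<sigma>) (nm \<tau>) (stage_at \<delta>) (restr r (restr r q \<gamma>) \<delta>)"
    using assms \<delta>(2,3) unfolding restr_restr[OF \<delta>(1)] stage_le_iff[of q] by blast
qed

lemma conds_mono: "p \<in> conds A \<Longrightarrow> dom (coords p) \<subseteq> B \<Longrightarrow> p \<in> conds B"
  unfolding conds_iff[of p] by blast

lemma stage_le_refl: "p \<in> conds A \<Longrightarrow> (p, p) \<in> stage_le A"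
  by (rule forcing.leq_refl[OF forcing_stage_le]) (simp add: Field_stage_le)

lemma stage_le_trans: "(p, q) \<in> stage_le A \<Longrightarrow> (q, s) \<in> stage_le A \<Longrightarrow> (p, s) \<in> stage_le A"
  by (rule forcing.leq_trans[OF forcing_stage_le])

lemma stage_le_conds: "(q, p) \<in> stage_le A \<Longrightarrow> q \<in> conds A" "(q, p) \<in> stage_le A \<Longrightarrow> p \<in> conds A"
  unfolding stage_le_iff by blast+

lemma stage_le_mono: "(q, p) \<in> stage_le A \<Longrightarrow> A \<subseteq> B \<Longrightarrow> (q, p) \<in> stage_le B"
proof -
  assume qp: "(q, p) \<in> stage_le A" and AB: "A \<subseteq> B"
  have up: "x \<in> conds B" if "x \<in> conds A" for x
    by (rule conds_mono[OF that]) (use that[unfolded conds_iff[of x]] AB in blast)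
  have "q \<in> conds B" "p \<in> conds B" by (rule up, rule stage_le_conds[OF qp])+
  then show "(q, p) \<in> stage_le B" using qp[unfolded stage_le_iff[of q p]] unfolding stage_le_iff[of q p] by simp
qed

text \<open>
  Serves as the condition attached to the elements of a name that are present in any case.
\<close>

definition weakest :: "('i, 'k) icond" where "weakest = ICond Map.empty"

lemma weakest_conds: "weakest \<in> conds A"
  unfolding conds_iff[of weakest] by (simp add: weakest_def)

lemma weakest_max: "p \<in> conds A \<Longrightarrow> (p, weakest) \<in> stage_le A"
  using weakest_conds[of A] unfolding stage_le_iff by (simp add: weakest_def)

text \<open>
  All conditions below are built by this lemma.  To see that \<open>u\<close> is a condition extending all
  members of \<open>P\<close>, argue at each coordinate \<open>\<gamma>\<close> of its support, assuming that \<open>u\<close> up to \<open>\<gamma>\<close> already is a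
  condition extending the members of \<open>P\<close> up to \<open>\<gamma>\<close>.
\<close>

lemma common_extension:
  assumes fin: "finite (dom (coords u))" "dom (coords u) \<subseteq> A"
    and P: "\<And>p. p \<in> P \<Longrightarrow> p \<in> conds A \<and> dom (coords p) \<subseteq> dom (coords u)"
    and step: "\<And>\<gamma> \<sigma>. coords u \<gamma> = Some \<sigma> \<Longrightarrow> restr r u \<gamma> \<in> conds (underS r \<gamma>) \<Longrightarrow>
       (\<And>p. p \<in> P \<Longrightarrow> (restr r u \<gamma>, restr r p \<gamma>) \<in> stage_at \<gamma>) \<Longrightarrow>
       snd ` nm \<sigma> \<subseteq> conds (underS r \<gamma>) \<and> f_LE_cond b (nm \<sigma>) (stage_at \<gamma>) (restr r u \<gamma>) \<and>
       (\<forall>p\<in>P. \<forall>\<tau>. coords p \<gamma> = Some \<tau> \<longrightarrow> f_LE_le (nm \<sigma>) (nm \<tau>) (stage_at \<gamma>) (restr r u \<gamma>))"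
    and p: "p \<in> P"
  shows "(u, p) \<in> stage_le A"
proof -
  have below: "restr r u \<gamma> \<in> conds (underS r \<gamma>) \<and> (\<forall>p\<in>P. (restr r u \<gamma>, restr r p \<gamma>) \<in> stage_at \<gamma>)" for \<gamma>
  proof (induction \<gamma> rule: underS_induct)
    case (1 \<gamma>)
    have st: "restr r (restr r u \<gamma>) \<delta> \<in> conds (underS r \<delta>) \<and>
       snd ` nm \<sigma> \<subseteq> conds (underS r \<delta>) \<and> f_LE_cond b (nm \<sigma>) (stage_at \<delta>) (restr r (restr r u \<gamma>) \<delta>) \<and>
       (\<forall>p\<in>P. \<forall>\<tau>. coords p \<delta> = Some \<tau> \<longrightarrow> f_LE_le (nm \<sigma>) (nm \<tau>) (stage_at \<delta>) (restr r (restr r u \<gamma>) \<delta>))"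
      if "coords (restr r u \<gamma>) \<delta> = Some \<sigma>" for \<delta> \<sigma>
    proof -
      have \<delta>: "\<delta> \<in> underS r \<gamma>" "coords u \<delta> = Some \<sigma>" using that by (auto simp: coords_restr split: if_splits)
      show ?thesis unfolding restr_restr[OF \<delta>(1)] using step[OF \<delta>(2)] 1[OF \<delta>(1)] by blast
    qed
    have u: "restr r u \<gamma> \<in> conds (underS r \<gamma>)"
      unfolding conds_iff[of "restr r u \<gamma>"] using fin(1) st by (simp add: dom_restr)
    have "(restr r u \<gamma>, restr r p \<gamma>) \<in> stage_at \<gamma>" if p: "p \<in> P" for p
      unfolding stage_le_iff[of "restr r u \<gamma>"]
    proof (intro conjI allI impI)
      show "restr r p \<gamma> \<in> conds (underS r \<gamma>)" using P[OF p] restr_conds by blast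
      show "dom (coords (restr r p \<gamma>)) \<subseteq> dom (coords (restr r u \<gamma>))"
        using P[OF p] unfolding dom_restr by blast
      fix \<delta> \<sigma> \<tau> assume *: "coords (restr r u \<gamma>) \<delta> = Some \<sigma>" "coords (restr r p \<gamma>) \<delta> = Some \<tau>"
      have "coords p \<delta> = Some \<tau>" using *(2) by (simp add: coords_restr split: if_splits)
      then show "f_LE_le (nm \<sigma>) (nm \<tau>) (stage_at \<delta>) (restr r (restr r u \<gamma>) \<delta>)" using st[OF *(1)] p by blast
    qed (rule u)
    then show ?case using u by blast
  qed
  have st: "snd ` nm \<sigma> \<subseteq> conds (underS r \<delta>) \<and> f_LE_cond b (nm \<sigma>) (stage_at \<delta>) (restr r u \<delta>) \<and>
       (\<forall>p\<in>P. \<forall>\<tau>. coords p \<delta> = Some \<tau> \<longrightarrow> f_LE_le (nm \<sigma>) (nm \<tau>) (stage_at \<delta>) (restr r u \<delta>))"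
      if "coords u \<delta> = Some \<sigma>" for \<delta> \<sigma>
    using step[OF that] below by blast
  have "u \<in> conds A"
    unfolding conds_iff[of u] using fin below st by blast
  then show ?thesis
    unfolding stage_le_iff[of u] using P[OF p] st p by blast
qed

text \<open>
  The condition \<open>q\<close> with the part below \<open>\<gamma>\<close> replaced by \<open>t\<close> and the name at \<open>\<gamma>\<close> replaced by \<open>\<sigma>\<close>.  If \<open>t\<close> extends the part of \<open>q\<close>
  below \<open>\<gamma>\<close> and forces \<open>\<sigma>\<close> to be stronger than the old name, the coordinates above \<open>\<gamma>\<close> remain names of
  conditions, because what they need is forced by the part of \<open>q\<close> below them.
\<close>

definition splice :: "'i \<Rightarrow> ('i, 'k) icond \<Rightarrow> ('k \<Rightarrow> (code \<times> ('i, 'k) icond) option) \<Rightarrow> ('i, 'k) icond \<Rightarrow> ('i, 'k) icond" where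
  "splice \<gamma> t \<sigma> q = ICond (\<lambda>\<delta>. if \<delta> \<in> underS r \<gamma> then coords t \<delta> else if \<delta> = \<gamma> then Some \<sigma> else coords q \<delta>)"

lemma coords_splice: "coords (splice \<gamma> t \<sigma> q) \<delta> =
    (if \<delta> \<in> underS r \<gamma> then coords t \<delta> else if \<delta> = \<gamma> then Some \<sigma> else coords q \<delta>)"
  by (simp add: splice_def)

lemma underS_irrefl: "\<gamma> \<notin> underS r \<gamma>"
  by (simp add: underS_def)

lemma splice_at: "coords (splice \<gamma> t \<sigma> q) \<gamma> = Some \<sigma>"
  by (simp add: coords_splice underS_irrefl)

lemma splice_below: "t \<in> conds (underS r \<gamma>) \<Longrightarrow> restr r (splice \<gamma> t \<sigma> q) \<gamma> = t"
  by (rule trans[OF restr_cong restr_id, of _ _ t]) (auto simp: coords_splice conds_iff[of t])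

lemma splice_ext:
  assumes q: "q \<in> conds A" and \<gamma>: "\<gamma> \<in> A" "underS r \<gamma> \<subseteq> A" and t: "(t, restr r q \<gamma>) \<in> stage_at \<gamma>"
    and \<sigma>: "snd ` nm \<sigma> \<subseteq> conds (underS r \<gamma>)" "f_LE_cond b (nm \<sigma>) (stage_at \<gamma>) t"
      "\<And>\<tau>. coords q \<gamma> = Some \<tau> \<Longrightarrow> f_LE_le (nm \<sigma>) (nm \<tau>) (stage_at \<gamma>) t"
  shows "(splice \<gamma> t \<sigma> q, q) \<in> stage_le A"
proof (rule common_extension[where P = "{q}"])
  let ?u = "splice \<gamma> t \<sigma> q"
  have tc: "t \<in> conds (underS r \<gamma>)" by (rule stage_le_conds[OF t])
  have td: "dom (coords t) \<subseteq> underS r \<gamma>" "finite (dom (coords t))" using tc unfolding conds_iff[of t] by blast+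
  have qd: "dom (coords q) \<subseteq> A" "finite (dom (coords q))" using q unfolding conds_iff[of q] by blast+
  have ud: "dom (coords ?u) \<subseteq> insert \<gamma> (dom (coords t) \<union> dom (coords q))"
    by (auto simp: coords_splice split: if_splits)
  then show "finite (dom (coords ?u))" by (rule finite_subset) (use td qd in simp)
  show "dom (coords ?u) \<subseteq> A" using ud td qd \<gamma> by blast
  show "p \<in> conds A \<and> dom (coords p) \<subseteq> dom (coords ?u)" if "p \<in> {q}" for p
  proof -
    have "dom (coords q) \<inter> underS r \<gamma> \<subseteq> dom (coords t)"
      using t unfolding stage_le_iff[of t] dom_restr by blast
    then have "dom (coords q) \<subseteq> dom (coords ?u)"
      by (auto simp: coords_splice domIff subset_iff)
    then show ?thesis using that q by simp
  qed
  fix \<delta> \<rho>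
  assume \<delta>: "coords ?u \<delta> = Some \<rho>" "restr r ?u \<delta> \<in> conds (underS r \<delta>)"
    and le: "\<And>p. p \<in> {q} \<Longrightarrow> (restr r ?u \<delta>, restr r p \<delta>) \<in> stage_at \<delta>"
  show "snd ` nm \<rho> \<subseteq> conds (underS r \<delta>) \<and> f_LE_cond b (nm \<rho>) (stage_at \<delta>) (restr r ?u \<delta>) \<and>
       (\<forall>p\<in>{q}. \<forall>\<tau>. coords p \<delta> = Some \<tau> \<longrightarrow> f_LE_le (nm \<rho>) (nm \<tau>) (stage_at \<delta>) (restr r ?u \<delta>))"
  proof (cases "\<delta> \<in> underS r \<gamma>")
    case True
    then have \<rho>: "coords t \<delta> = Some \<rho>" using \<delta>(1) by (simp add: coords_splice)
    have "restr r ?u \<delta> = restr r t \<delta>"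
      by (rule restr_cong) (use underS_trans[OF True] in \<open>auto simp: coords_splice\<close>)
    moreover have "snd ` nm \<rho> \<subseteq> conds (underS r \<delta>) \<and> f_LE_cond b (nm \<rho>) (stage_at \<delta>) (restr r t \<delta>)"
      using tc \<rho> unfolding conds_iff[of t] by blast
    moreover have "f_LE_le (nm \<rho>) (nm \<tau>) (stage_at \<delta>) (restr r t \<delta>)" if "coords q \<delta> = Some \<tau>" for \<tau>
      using t \<rho> that True unfolding stage_le_iff[of t] by (auto simp: coords_restr)
    ultimately show ?thesis by simp
  next
    case False
    show ?thesis
    proof (cases "\<delta> = \<gamma>")
      case True
      have "restr r ?u \<delta> = t" using splice_below[OF tc] True by simp
      moreover have "\<rho> = \<sigma>" using \<delta>(1) True by (simp add: splice_at)
      ultimately show ?thesis using \<sigma> True by simp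
    next
      case neq: False
      then have \<rho>: "coords q \<delta> = Some \<rho>" using \<delta>(1) False by (simp add: coords_splice)
      interpret forcing "stage_at \<delta>" by (rule forcing_stage_le)
      have c: "f_LE_cond b (nm \<rho>) (stage_at \<delta>) (restr r ?u \<delta>)"
        using regular_mono[OF regular_LE_cond _ le] q \<rho> unfolding conds_iff[of q] by blast
      moreover have "f_LE_le (nm \<rho>) (nm \<rho>) (stage_at \<delta>) (restr r ?u \<delta>)"
        by (rule LE_le_refl[OF _ c]) (use \<delta>(2) Field_stage_le in blast)
      moreover have "snd ` nm \<rho> \<subseteq> conds (underS r \<delta>)" using q \<rho> unfolding conds_iff[of q] by blast
      ultimately show ?thesis using \<rho> by simp
    qed
  qed
qed simp

end

section \<open>Compatibility and the countable chain condition\<close>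

text \<open>
  The names that occur inside conditions are, up to presentation, the names of cardinality at most that of
  \<open>'k\<close>.  As \<open>'k\<close> is infinite, these are closed under unions and comprise all countable names.
\<close>

lemma countable_small:
  assumes "countable Z" "infinite (UNIV :: 'k set)"
  shows "|Z| \<le>o |UNIV :: 'k set|"
proof -
  obtain f :: "_ \<Rightarrow> nat" where "inj_on f Z" using assms(1) by (auto simp: countable_def)
  then have "|Z| \<le>o |UNIV :: nat set|" by (rule card_of_ordLeqI) simp
  then show ?thesis using assms(2) infinite_iff_card_of_nat ordLeq_transitive by blast
qed

lemma Un_small:
  assumes "infinite (UNIV :: 'k set)" "|A| \<le>o |UNIV :: 'k set|" "|B| \<le>o |UNIV :: 'k set|"
  shows "|A \<union> B| \<le>o |UNIV :: 'k set|"
  by (rule card_of_Un_ordLeq_infinite_Field[OF _ assms(2,3) card_of_Card_order])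
     (simp add: assms(1) Field_card_of)

lemma nm_small:
  fixes f :: "'k \<Rightarrow> (code \<times> ('i, 'k) icond) option"
  shows "|nm f| \<le>o |UNIV :: 'k set|"
proof -
  have "nm f \<subseteq> (\<lambda>j. the (f j)) ` UNIV"
    unfolding nm_def image_def by (auto, metis option.sel)
  then show ?thesis by (rule ordLeq_transitive[OF card_of_mono1 card_of_image])
qed

lemma nm_surj:
  fixes Z :: "(code \<times> ('i, 'k) icond) set"
  assumes "|Z| \<le>o |UNIV :: 'k set|"
  obtains f where "nm f = Z"
proof (cases "Z = {}")
  case True
  then have "nm (\<lambda>_. None) = Z" by (simp add: nm_def)
  then show ?thesis by (rule that)
next
  case False
  obtain g :: "'k \<Rightarrow> _" where g: "g ` UNIV = Z"
    using iffD2[OF card_of_ordLeq2[OF False] assms] by (rule exE)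
  have "nm (\<lambda>j. Some (g j)) = Z" using g by (auto simp: nm_def intro: range_eqI[OF sym])
  then show ?thesis by (rule that)
qed

lemma val_Un: "val (Z \<union> Z') G = val Z G \<union> val Z' G"
  by (auto simp: val_def)

context LE_iter
begin

lemma underS_sub_Field: "underS r \<gamma> \<subseteq> Field r"
  by (auto simp: underS_def intro: FieldI1)

lemma finite_max:
  assumes "finite D" "D \<noteq> {}" "D \<subseteq> Field r"
  obtains \<gamma> where "\<gamma> \<in> D" "D \<subseteq> insert \<gamma> (underS r \<gamma>)"
proof -
  have "\<exists>\<gamma>\<in>D. D \<subseteq> insert \<gamma> (underS r \<gamma>)"
    using assms
  proof (induction D rule: finite_ne_induct)
    case (insert x D)
    then obtain \<gamma> where \<gamma>: "\<gamma> \<in> D" "D \<subseteq> insert \<gamma> (underS r \<gamma>)" by auto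
    have tot: "total_on (Field r) r" 
      using wo by (simp add: well_order_on_def linear_order_on_def)
    show ?case
    proof (cases "x = \<gamma> \<or> x \<in> underS r \<gamma>")
      case True
      then show ?thesis using \<gamma> by blast
    next
      case False
      then have "\<gamma> \<in> underS r x" using tot insert.prems \<gamma>(1) by (auto simp: total_on_def underS_def)
      then show ?thesis using \<gamma>(2) underS_trans[of \<gamma> x] by blast
    qed
  qed simp
  then show ?thesis using that by blast
qed

text \<open>
  The name of a condition with stem \<open>(d, s)\<close> that forbids the values which \<open>Z\<close> forbids; the stem of
  \<open>Z\<close> is discarded.
\<close>

definition stem_name :: "bool list \<Rightarrow> nat list \<Rightarrow> (code, ('i, 'k) icond) name \<Rightarrow> (code, ('i, 'k) icond) name" where
  "stem_name d s Z = insert (Inl (d, s), weakest) {(c, t). \<exists>x. c = Inr x \<and> (Inr x, t) \<in> Z}"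

lemma stem_name_small:
  assumes "|Z| \<le>o |UNIV :: 'k set|"
  shows "|stem_name d s Z| \<le>o |UNIV :: 'k set|"
proof -
  have "|{(Inl (d, s), weakest)} \<union> Z| \<le>o |UNIV :: 'k set|"
    by (rule Un_small[OF inf countable_small[OF _ inf] assms]) simp
  moreover have "stem_name d s Z \<subseteq> {(Inl (d, s), weakest)} \<union> Z" by (auto simp: stem_name_def)
  ultimately show ?thesis using ordLeq_transitive[OF card_of_mono1] by blast
qed

lemma stem_name_conds: "snd ` Z \<subseteq> conds A \<Longrightarrow> snd ` stem_name d s Z \<subseteq> conds A"
  using weakest_conds[of A] by (force simp: stem_name_def)

lemma val_stem_name:
  assumes G: "cond_filter (stage_le A) G"
  shows "val (stem_name d s Z) G = code_of (d, s, \<lambda>n. {m. Inr (n, m) \<in> val Z G})"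
proof -
  obtain p where p: "p \<in> G" "p \<in> conds A" using G Field_stage_le unfolding cond_filter_def by blast
  have "weakest \<in> G" by (rule cond_filter_up[OF G p(1) weakest_max[OF p(2)]])
  then show ?thesis unfolding code_of_eq_iff by (auto simp: val_def stem_name_def)
qed

lemma obtain_stem_name:
  assumes "|Z| \<le>o |UNIV :: 'k set|"
  obtains \<sigma> where "nm \<sigma> = stem_name d s Z"
  using nm_surj[OF stem_name_small[OF assms]] by blast

text \<open>
  A missing coordinate \<open>\<gamma>\<close> is first filled with a name of the weakest condition of LE, whose stem is
  empty.  The last clause records that nothing is changed above \<open>\<gamma>\<close>.
\<close>

lemma stem_decided:
  assumes p: "p \<in> conds A" and \<gamma>: "\<gamma> \<in> A" "underS r \<gamma> \<subseteq> A"
  obtains u \<tau> d s k where "(u, p) \<in> stage_le A" "coords u \<gamma> = Some \<tau>"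
    "f_LE_cond_stem b (nm \<tau>) d s k (stage_at \<gamma>) (restr r u \<gamma>)"
    "\<And>\<delta>. \<delta> \<notin> insert \<gamma> (underS r \<gamma>) \<Longrightarrow> coords u \<delta> = coords p \<delta>"
proof -
  interpret forcing "stage_at \<gamma>" by (rule forcing_stage_le)
  have rp: "restr r p \<gamma> \<in> conds (underS r \<gamma>)" by (rule restr_conds[OF p])
  obtain \<tau> where \<tau>: "snd ` nm \<tau> \<subseteq> conds (underS r \<gamma>)" "f_LE_cond b (nm \<tau>) (stage_at \<gamma>) (restr r p \<gamma>)"
    "\<And>\<tau>'. coords p \<gamma> = Some \<tau>' \<Longrightarrow> \<tau>' = \<tau>"
  proof (cases "coords p \<gamma>")
    case (Some \<tau>)
    then show ?thesis using that p unfolding conds_iff[of p] by simp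
  next
    case None
    \<comment> \<open>The weakest condition of LE.\<close>
    obtain \<sigma> where \<sigma>: "nm \<sigma> = stem_name [] [] {}"
      using obtain_stem_name[OF countable_small[OF _ inf]] by blast
    have "([], [], \<lambda>n. {}) \<in> LE_cond b" by (simp add: LE_cond_def)
    moreover have "val (nm \<sigma>) G = code_of ([], [], \<lambda>n. {})" if "cond_filter (stage_at \<gamma>) G" for G
      unfolding \<sigma> val_stem_name[OF that] by (simp add: val_def)
    ultimately have "f_LE_cond b (nm \<sigma>) (stage_at \<gamma>) (restr r p \<gamma>)"
      using forces_LE_cond_iff[of "restr r p \<gamma>"] rp generically_mono[OF generically_filter]
      unfolding Field_stage_le by (smt (verit, best))
    moreover have "snd ` nm \<sigma> \<subseteq> conds (underS r \<gamma>)" unfolding \<sigma> by (rule stem_name_conds) simp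
    ultimately show ?thesis using that None by simp
  qed
  obtain t d s k where t: "(t, restr r p \<gamma>) \<in> stage_at \<gamma>" "f_LE_cond_stem b (nm \<tau>) d s k (stage_at \<gamma>) t"
    using LE_cond_decide_stem[OF _ \<tau>(2)] rp unfolding Field_stage_le by blast
  have tc: "t \<in> conds (underS r \<gamma>)" by (rule stage_le_conds[OF t(1)])
  have c: "f_LE_cond b (nm \<tau>) (stage_at \<gamma>) t" by (rule regular_mono[OF regular_LE_cond \<tau>(2) t(1)])
  have "(splice \<gamma> t \<tau> p, p) \<in> stage_le A"
  proof (rule splice_ext[OF p \<gamma> t(1) \<tau>(1) c])
    fix \<tau>' assume "coords p \<gamma> = Some \<tau>'"
    then have "\<tau>' = \<tau>" by (rule \<tau>(3))
    then show "f_LE_le (nm \<tau>) (nm \<tau>') (stage_at \<gamma>) t" using LE_le_refl[OF _ c] tc Field_stage_le by simp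
  qed
  moreover have "restr r (splice \<gamma> t \<tau> p) \<gamma> = t" by (rule splice_below[OF tc])
  ultimately show ?thesis using that[of "splice \<gamma> t \<tau> p" \<tau>] t(2) by (simp add: splice_at coords_splice)
qed

text \<open>
  Such conditions are the ones on which the linkedness of LE can be used coordinatewise.
\<close>

definition determines :: "('i, 'k) icond \<Rightarrow> ('i \<rightharpoonup> bool list \<times> nat list \<times> nat) \<Rightarrow> bool" where
  "determines p f \<longleftrightarrow> dom f = dom (coords p) \<and> (\<forall>\<gamma> \<tau>. coords p \<gamma> = Some \<tau> \<longrightarrow>
     (\<exists>d s k. f \<gamma> = Some (d, s, k) \<and> f_LE_cond_stem b (nm \<tau>) d s k (stage_at \<gamma>) (restr r p \<gamma>)))"

text \<open>
  Decide stem and rate at the largest coordinate \<open>\<gamma>\<close> of the support first.  This may enlarge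
  the support below \<open>\<gamma>\<close>; the part below \<open>\<gamma>\<close> is then extended to a determined condition of stage \<open>\<gamma>\<close>, which
  cannot undo the decision at \<open>\<gamma>\<close>.
\<close>

lemma determined_dense_step:
  assumes A: "A \<subseteq> Field r" "\<And>\<gamma>. \<gamma> \<in> A \<Longrightarrow> underS r \<gamma> \<subseteq> A"
    and IH: "\<And>\<gamma> p. \<gamma> \<in> A \<Longrightarrow> p \<in> conds (underS r \<gamma>) \<Longrightarrow> \<exists>q f. (q, p) \<in> stage_at \<gamma> \<and> determines q f"
    and p: "p \<in> conds A"
  shows "\<exists>q f. (q, p) \<in> stage_le A \<and> determines q f"
proof (cases "dom (coords p) = {}")
  case True
  then have "determines p Map.empty" by (simp add: determines_def)
  then show ?thesis using stage_le_refl[OF p] by blast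
next
  case False
  have dp: "finite (dom (coords p))" "dom (coords p) \<subseteq> A" using p unfolding conds_iff[of p] by blast+
  obtain \<gamma> where \<gamma>: "\<gamma> \<in> dom (coords p)" "dom (coords p) \<subseteq> insert \<gamma> (underS r \<gamma>)"
    using finite_max[OF dp(1) False] dp(2) A(1) by blast
  have \<gamma>A: "\<gamma> \<in> A" using \<gamma>(1) dp(2) by blast
  obtain u \<tau> d s k where u: "(u, p) \<in> stage_le A" "coords u \<gamma> = Some \<tau>"
    "f_LE_cond_stem b (nm \<tau>) d s k (stage_at \<gamma>) (restr r u \<gamma>)"
    "\<And>\<delta>. \<delta> \<notin> insert \<gamma> (underS r \<gamma>) \<Longrightarrow> coords u \<delta> = coords p \<delta>"
    by (rule stem_decided[OF p \<gamma>A A(2)[OF \<gamma>A]]) (rule that)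
  have uc: "u \<in> conds A" by (rule stage_le_conds[OF u(1)])
  interpret forcing "stage_at \<gamma>" by (rule forcing_stage_le)
  obtain t f where t: "(t, restr r u \<gamma>) \<in> stage_at \<gamma>" "determines t f"
    using IH[OF \<gamma>A restr_conds[OF uc]] by blast
  have tc: "t \<in> conds (underS r \<gamma>)" by (rule stage_le_conds[OF t(1)])
  then have tF: "t \<in> Field (stage_at \<gamma>)" by (simp add: Field_stage_le)
  have stem: "f_LE_cond_stem b (nm \<tau>) d s k (stage_at \<gamma>) t"
    by (rule regular_mono[OF regular_LE_cond_stem u(3) t(1)])
  have c: "f_LE_cond b (nm \<tau>) (stage_at \<gamma>) t" by (rule forces_LE_cond_of_stem[OF tF stem])
  let ?v = "splice \<gamma> t \<tau> u"
  have \<tau>: "snd ` nm \<tau> \<subseteq> conds (underS r \<gamma>)" using uc u(2) unfolding conds_iff[of u] by blast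
  have "(?v, u) \<in> stage_le A"
  proof (rule splice_ext[OF uc \<gamma>A A(2)[OF \<gamma>A] t(1) \<tau> c])
    fix \<tau>' assume "coords u \<gamma> = Some \<tau>'"
    then show "f_LE_le (nm \<tau>) (nm \<tau>') (stage_at \<gamma>) t" using u(2) LE_le_refl[OF tF c] by simp
  qed
  then have vp: "(?v, p) \<in> stage_le A" using u(1) stage_le_trans by blast
  have td: "dom (coords t) \<subseteq> underS r \<gamma>" using tc unfolding conds_iff[of t] by blast
  have cv: "coords ?v \<delta> = (if \<delta> = \<gamma> then Some \<tau> else coords t \<delta>)" for \<delta>
  proof (cases "\<delta> \<in> insert \<gamma> (underS r \<gamma>)")
    case True
    then show ?thesis using underS_irrefl by (auto simp: coords_splice)
  next
    case False
    then have "coords p \<delta> = None" "coords t \<delta> = None" using \<gamma>(2) td by blast+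
    then show ?thesis using False u(4)[OF False] by (simp add: coords_splice)
  qed
  have "determines ?v (f(\<gamma> \<mapsto> (d, s, k)))"
    unfolding determines_def
  proof (intro conjI allI impI)
    show "dom (f(\<gamma> \<mapsto> (d, s, k))) = dom (coords ?v)"
    proof -
      have "coords ?v = (coords t)(\<gamma> \<mapsto> \<tau>)" by (rule ext) (simp add: cv)
      moreover have "dom f = dom (coords t)" using t(2) unfolding determines_def by blast
      ultimately show ?thesis by simp
    qed
    fix \<delta> \<rho> assume \<rho>: "coords ?v \<delta> = Some \<rho>"
    show "\<exists>d' s' k'. (f(\<gamma> \<mapsto> (d, s, k))) \<delta> = Some (d', s', k') \<and>
        f_LE_cond_stem b (nm \<rho>) d' s' k' (stage_at \<delta>) (restr r ?v \<delta>)"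
    proof (cases "\<delta> = \<gamma>")
      case True
      then show ?thesis using \<rho> stem by (simp add: cv splice_below[OF tc])
    next
      case False
      then have t\<delta>: "coords t \<delta> = Some \<rho>" using \<rho> by (simp add: cv)
      then have \<delta>: "\<delta> \<in> underS r \<gamma>" using td by blast
      have "restr r ?v \<delta> = restr r t \<delta>"
        by (rule restr_cong) (use underS_trans[OF \<delta>] in \<open>auto simp: coords_splice\<close>)
      then show ?thesis using t(2) t\<delta> False unfolding determines_def by simp
    qed
  qed
  then show ?thesis using vp by blast
qed

lemma determined_dense:
  assumes "A \<subseteq> Field r" "\<And>\<gamma>. \<gamma> \<in> A \<Longrightarrow> underS r \<gamma> \<subseteq> A" "p \<in> conds A"
  shows "\<exists>q f. (q, p) \<in> stage_le A \<and> determines q f"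
proof -
  have "\<forall>p\<in>conds (underS r \<gamma>). \<exists>q f. (q, p) \<in> stage_at \<gamma> \<and> determines q f" for \<gamma>
  proof (induction \<gamma> rule: underS_induct)
    case (1 \<gamma>)
    show ?case
    proof
      fix p assume p: "p \<in> conds (underS r \<gamma>)"
      show "\<exists>q f. (q, p) \<in> stage_at \<gamma> \<and> determines q f"
      proof (rule determined_dense_step[OF underS_sub_Field underS_trans _ p])
        fix \<delta> p assume "\<delta> \<in> underS r \<gamma>" "p \<in> conds (underS r \<delta>)"
        then show "\<exists>q f. (q, p) \<in> stage_at \<delta> \<and> determines q f" using 1 by simp
      qed
    qed
  qed
  then show ?thesis by (intro determined_dense_step[OF assms(1,2) _ assms(3)]) simp_all
qed

text \<open>
  On the common support, stems and rates agree, so two conditions of LE named at such a coordinate are compatible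
  by \<open>LE_cond_pad_Un\<close>; a name of a common extension is obtained by padding the stem and uniting the two names.
\<close>

lemma determined_compatible:
  assumes p: "p \<in> conds A" "determines p f" and q: "q \<in> conds A" "determines q g"
    and agree: "\<And>i. i \<in> dom f \<inter> dom g \<Longrightarrow> f i = g i"
  shows "\<exists>u. (u, p) \<in> stage_le A \<and> (u, q) \<in> stage_le A"
proof -
  \<comment> \<open>The length to which \<open>LE_cond_pad_Un\<close> pads a stem of rate \<open>k\<close>.\<close>
  define N where "N \<gamma> = (case f \<gamma> of None \<Rightarrow> 0 | Some (d, s, k) \<Rightarrow> max (length d) (2 ^ Suc k))" for \<gamma>
  define w where "w \<gamma> \<sigma> \<tau> = (SOME \<rho>. \<exists>d s k. f \<gamma> = Some (d, s, k) \<and>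
      nm \<rho> = stem_name (pad False (N \<gamma>) d) (pad 0 (N \<gamma>) s) (nm \<sigma> \<union> nm \<tau>))" for \<gamma> and \<sigma> \<tau> :: "'k \<Rightarrow> (code \<times> ('i, 'k) icond) option"
  define u where "u = ICond (\<lambda>\<gamma>. case coords p \<gamma> of None \<Rightarrow> coords q \<gamma>
     | Some \<sigma> \<Rightarrow> (case coords q \<gamma> of None \<Rightarrow> Some \<sigma> | Some \<tau> \<Rightarrow> Some (w \<gamma> \<sigma> \<tau>)))"
  have cu: "coords u \<gamma> = (case coords p \<gamma> of None \<Rightarrow> coords q \<gamma>
     | Some \<sigma> \<Rightarrow> (case coords q \<gamma> of None \<Rightarrow> Some \<sigma> | Some \<tau> \<Rightarrow> Some (w \<gamma> \<sigma> \<tau>)))" for \<gamma>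
    by (simp add: u_def)
  have du: "dom (coords u) = dom (coords p) \<union> dom (coords q)"
    by (auto simp: cu split: option.splits)
  \<comment> \<open>A given name still names a condition at \<open>u\<close>; this settles the coordinates in only one of the supports.\<close>
  have one: "snd ` nm \<sigma> \<subseteq> conds (underS r \<gamma>) \<and> f_LE_cond b (nm \<sigma>) (stage_at \<gamma>) (restr r u \<gamma>) \<and>
      f_LE_le (nm \<sigma>) (nm \<sigma>) (stage_at \<gamma>) (restr r u \<gamma>)"
    if "x \<in> conds A" "coords x \<gamma> = Some \<sigma>" "(restr r u \<gamma>, restr r x \<gamma>) \<in> stage_at \<gamma>" for x \<gamma> \<sigma>
  proof -
    interpret forcing "stage_at \<gamma>" by (rule forcing_stage_le)
    have x: "snd ` nm \<sigma> \<subseteq> conds (underS r \<gamma>)" "f_LE_cond b (nm \<sigma>) (stage_at \<gamma>) (restr r x \<gamma>)"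
      using that(1,2) unfolding conds_iff[of x] by blast+
    have c: "f_LE_cond b (nm \<sigma>) (stage_at \<gamma>) (restr r u \<gamma>)"
      by (rule regular_mono[OF regular_LE_cond x(2) that(3)])
    then show ?thesis using x(1) LE_le_refl[OF FieldI1[OF that(3)]] by blast
  qed
  \<comment> \<open>At a common coordinate: the value of the new name lies below both given values.\<close>
  have both: "snd ` nm \<rho> \<subseteq> conds (underS r \<gamma>) \<and> f_LE_cond b (nm \<rho>) (stage_at \<gamma>) (restr r u \<gamma>) \<and>
      f_LE_le (nm \<rho>) (nm \<sigma>) (stage_at \<gamma>) (restr r u \<gamma>) \<and> f_LE_le (nm \<rho>) (nm \<tau>) (stage_at \<gamma>) (restr r u \<gamma>)"
    if \<sigma>: "coords p \<gamma> = Some \<sigma>" and \<tau>: "coords q \<gamma> = Some \<tau>" and \<rho>: "\<rho> = w \<gamma> \<sigma> \<tau>"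
      and le: "(restr r u \<gamma>, restr r p \<gamma>) \<in> stage_at \<gamma>" "(restr r u \<gamma>, restr r q \<gamma>) \<in> stage_at \<gamma>" for \<gamma> \<rho> \<sigma> \<tau>
  proof -
    interpret forcing "stage_at \<gamma>" by (rule forcing_stage_le)
    let ?u = "restr r u \<gamma>"
    have uF: "?u \<in> Field (stage_at \<gamma>)" by (rule FieldI1[OF le(1)])
    obtain d s k where f: "f \<gamma> = Some (d, s, k)" "f_LE_cond_stem b (nm \<sigma>) d s k (stage_at \<gamma>) (restr r p \<gamma>)"
      using p(2) \<sigma> unfolding determines_def by blast
    have "f \<gamma> = g \<gamma>"
      using agree[of \<gamma>] \<sigma> \<tau> p(2) q(2) unfolding determines_def by blast
    then have g: "f_LE_cond_stem b (nm \<tau>) d s k (stage_at \<gamma>) (restr r q \<gamma>)"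
      using q(2) \<tau> f(1) unfolding determines_def by fastforce
    let ?N = "max (length d) (2 ^ Suc k)"
    let ?Z = "nm \<sigma> \<union> nm \<tau>"
    let ?d = "pad False ?N d" and ?s = "pad 0 ?N s"
    have ex: "\<exists>\<rho> :: 'k \<Rightarrow> _. nm \<rho> = stem_name ?d ?s ?Z"
      using obtain_stem_name[OF Un_small[OF inf nm_small nm_small]] by metis
    have "w \<gamma> \<sigma> \<tau> = (SOME \<rho>. nm \<rho> = stem_name ?d ?s ?Z)"
      by (simp add: w_def N_def f(1))
    then have \<rho>_nm: "nm \<rho> = stem_name ?d ?s ?Z"
      using someI_ex[OF ex] unfolding \<rho> by simp
    have sub: "snd ` nm \<rho> \<subseteq> conds (underS r \<gamma>)"
      unfolding \<rho>_nm using one[OF p(1) \<sigma> le(1)] one[OF q(1) \<tau> le(2)]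
      by (intro stem_name_conds) blast
    have gen: "generically (stage_at \<gamma>) (\<lambda>G. ?u \<in> G \<longrightarrow> (\<exists>c\<in>LE_cond b. \<exists>c1\<in>LE_cond b. \<exists>c2\<in>LE_cond b.
        val (nm \<rho>) G = code_of c \<and> val (nm \<sigma>) G = code_of c1 \<and> val (nm \<tau>) G = code_of c2 \<and>
        (c, c1) \<in> LE_order b \<and> (c, c2) \<in> LE_order b))"
    proof (rule generically_mono[OF generically_conj[OF
          regular_mono[OF regular_LE_cond_stem f(2) le(1), unfolded forces_LE_cond_stem_iff[OF uF]]
          regular_mono[OF regular_LE_cond_stem g le(2), unfolded forces_LE_cond_stem_iff[OF uF]]]], intro impI)
      fix G assume G: "cond_filter (stage_at \<gamma>) G" "?u \<in> G"
        and *: "(?u \<in> G \<longrightarrow> (\<exists>\<phi>. val (nm \<sigma>) G = code_of (d, s, \<phi>) \<and> (d, s, \<phi>) \<in> LE_cond_rate b k)) \<and>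
          (?u \<in> G \<longrightarrow> (\<exists>\<phi>. val (nm \<tau>) G = code_of (d, s, \<phi>) \<and> (d, s, \<phi>) \<in> LE_cond_rate b k))"
      obtain \<phi> where \<phi>: "val (nm \<sigma>) G = code_of (d, s, \<phi>)" "(d, s, \<phi>) \<in> LE_cond_rate b k"
        using * G(2) by blast
      obtain \<psi> where \<psi>: "val (nm \<tau>) G = code_of (d, s, \<psi>)" "(d, s, \<psi>) \<in> LE_cond_rate b k"
        using * G(2) by blast
      have "{m. Inr (n, m) \<in> val ?Z G} = \<phi> n \<union> \<psi> n" for n
        unfolding val_Un \<phi>(1) \<psi>(1) by (auto simp: code_of_def)
      then have v: "val (nm \<rho>) G = code_of (?d, ?s, \<lambda>n. \<phi> n \<union> \<psi> n)"
        unfolding \<rho>_nm val_stem_name[OF G(1)] by simp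
      have r1: "\<chi> n \<subseteq> {..<b n}" "n \<ge> ?N \<Longrightarrow> real (card (\<chi> n)) / real (b n) \<le> 2 powr (- (real n / 2 ^ k))"
        if "(d, s, \<chi>) \<in> LE_cond_rate b k" for \<chi> n
        using that by (auto simp: LE_cond_rate_def)
      have c1: "(?d, ?s, \<lambda>n. \<phi> n \<union> \<psi> n) \<in> LE_cond b" "((?d, ?s, \<lambda>n. \<phi> n \<union> \<psi> n), (d, s, \<phi>)) \<in> LE_order b"
        by (rule LE_cond_pad_Un[OF \<phi>(2) b_pos r1[OF \<psi>(2)]]; simp)+
      have "((?d, ?s, \<lambda>n. \<psi> n \<union> \<phi> n), (d, s, \<psi>)) \<in> LE_order b"
        by (rule LE_cond_pad_Un[OF \<psi>(2) b_pos r1[OF \<phi>(2)]]; simp)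
      then have c2: "((?d, ?s, \<lambda>n. \<phi> n \<union> \<psi> n), (d, s, \<psi>)) \<in> LE_order b" by (simp add: Un_commute)
      show "\<exists>c\<in>LE_cond b. \<exists>c1\<in>LE_cond b. \<exists>c2\<in>LE_cond b.
        val (nm \<rho>) G = code_of c \<and> val (nm \<sigma>) G = code_of c1 \<and> val (nm \<tau>) G = code_of c2 \<and>
        (c, c1) \<in> LE_order b \<and> (c, c2) \<in> LE_order b"
        using v c1 c2 \<phi> \<psi> LE_cond_iff_rate by blast
    qed
    have c: "f_LE_cond b (nm \<rho>) (stage_at \<gamma>) ?u"
      unfolding forces_LE_cond_iff[OF uF] by (rule generically_mono[OF gen]) blast
    have c': "f_LE_cond b (nm \<sigma>) (stage_at \<gamma>) ?u" "f_LE_cond b (nm \<tau>) (stage_at \<gamma>) ?u"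
      using one[OF p(1) \<sigma> le(1)] one[OF q(1) \<tau> le(2)] by blast+
    have "f_LE_le (nm \<rho>) (nm \<sigma>) (stage_at \<gamma>) ?u"
      unfolding forces_LE_le_iff[OF uF c c'(1)] by (rule generically_mono[OF gen]) blast
    moreover have "f_LE_le (nm \<rho>) (nm \<tau>) (stage_at \<gamma>) ?u"
      unfolding forces_LE_le_iff[OF uF c c'(2)] by (rule generically_mono[OF gen]) blast
    ultimately show ?thesis using sub c by blast
  qed
  have dp: "finite (dom (coords p))" "dom (coords p) \<subseteq> A" using p(1) unfolding conds_iff[of p] by blast+
  have dq: "finite (dom (coords q))" "dom (coords q) \<subseteq> A" using q(1) unfolding conds_iff[of q] by blast+
  have "(u, x) \<in> stage_le A" if "x \<in> {p, q}" for x
  proof (rule common_extension[OF _ _ _ _ that])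
    show "finite (dom (coords u))" "dom (coords u) \<subseteq> A" using dp dq du by simp_all
    show "y \<in> conds A \<and> dom (coords y) \<subseteq> dom (coords u)" if "y \<in> {p, q}" for y
      using that p(1) q(1) du by blast
    fix \<gamma> \<rho>
    assume \<rho>: "coords u \<gamma> = Some \<rho>" and le: "\<And>y. y \<in> {p, q} \<Longrightarrow> (restr r u \<gamma>, restr r y \<gamma>) \<in> stage_at \<gamma>"
    have le': "(restr r u \<gamma>, restr r p \<gamma>) \<in> stage_at \<gamma>" "(restr r u \<gamma>, restr r q \<gamma>) \<in> stage_at \<gamma>"
      using le by simp_all
    show "snd ` nm \<rho> \<subseteq> conds (underS r \<gamma>) \<and> f_LE_cond b (nm \<rho>) (stage_at \<gamma>) (restr r u \<gamma>) \<and>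
       (\<forall>y\<in>{p, q}. \<forall>\<tau>. coords y \<gamma> = Some \<tau> \<longrightarrow> f_LE_le (nm \<rho>) (nm \<tau>) (stage_at \<gamma>) (restr r u \<gamma>))"
    proof (cases "coords p \<gamma>")
      case None
      then have q\<gamma>: "coords q \<gamma> = Some \<rho>" using \<rho> by (simp add: cu)
      show ?thesis using one[OF q(1) q\<gamma> le'(2)] None q\<gamma> by simp
    next
      case (Some \<sigma>)
      show ?thesis
      proof (cases "coords q \<gamma>")
        case None
        then have "\<rho> = \<sigma>" using \<rho> Some by (simp add: cu)
        then show ?thesis using one[OF p(1) Some le'(1)] None Some by simp
      next
        case (Some \<tau>)
        then have "\<rho> = w \<gamma> \<sigma> \<tau>" using \<rho> \<open>coords p \<gamma> = Some \<sigma>\<close> by (simp add: cu)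
        from both[OF \<open>coords p \<gamma> = Some \<sigma>\<close> Some this le']
        show ?thesis using \<open>coords p \<gamma> = Some \<sigma>\<close> Some by simp
      qed
    qed
  qed
  then show ?thesis by blast
qed

lemma countable_antichain:
  assumes A: "A \<subseteq> Field r" "\<And>\<gamma>. \<gamma> \<in> A \<Longrightarrow> underS r \<gamma> \<subseteq> A" and X: "X \<subseteq> conds A"
    and anti: "\<And>p q. p \<in> X \<Longrightarrow> q \<in> X \<Longrightarrow> p \<noteq> q \<Longrightarrow> \<not> (\<exists>u. (u, p) \<in> stage_le A \<and> (u, q) \<in> stage_le A)"
  shows "countable X"
proof -
  have "\<forall>p\<in>X. \<exists>q f. (q, p) \<in> stage_le A \<and> determines q f"
    using determined_dense[OF A] X by blast
  then obtain Q F where QF: "\<And>p. p \<in> X \<Longrightarrow> (Q p, p) \<in> stage_le A \<and> determines (Q p) (F p)" by metis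
  have inc: "\<exists>i\<in>dom (F p) \<inter> dom (F q). F p i \<noteq> F q i" if pq: "p \<in> X" "q \<in> X" "p \<noteq> q" for p q
  proof (rule ccontr)
    assume "\<not> ?thesis"
    then have agree: "\<And>i. i \<in> dom (F p) \<inter> dom (F q) \<Longrightarrow> F p i = F q i" by blast
    have "Q p \<in> conds A" "Q q \<in> conds A" using QF pq stage_le_conds(1) by blast+
    then obtain u where "(u, Q p) \<in> stage_le A" "(u, Q q) \<in> stage_le A"
      using determined_compatible[of "Q p" A "F p" "Q q" "F q"] agree QF pq by blast
    then have "(u, p) \<in> stage_le A" "(u, q) \<in> stage_le A" using QF pq stage_le_trans by blast+
    then show False using anti[OF pq] by blast
  qed
  have inj: "inj_on F X"
  proof (rule inj_onI, rule ccontr)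
    fix p q assume "p \<in> X" "q \<in> X" "F p = F q" "p \<noteq> q"
    then show False using inc by force
  qed
  have "countable (F ` X)"
  proof (rule countable_incompatible_maps)
    show "finite (dom f)" if fX: "f \<in> F ` X" for f
    proof -
      obtain p where p: "p \<in> X" "f = F p" using fX by blast
      then have "dom f = dom (coords (Q p))" "Q p \<in> conds A"
        using QF stage_le_conds(1) unfolding determines_def by blast+
      then show ?thesis unfolding conds_iff[of "Q p"] by simp
    qed
    show "\<exists>i\<in>dom f \<inter> dom g. f i \<noteq> g i" if "f \<in> F ` X" "g \<in> F ` X" "f \<noteq> g" for f g
      using that inc by blast
  qed
  then show ?thesis using inj by (rule countable_image_inj_on)
qed

end

context LE_iter
begin

section \<open>The generic pair at a coordinate\<close>

abbreviation iter_le :: "('i, 'k) icond rel" where "iter_le \<equiv> stage_le (Field r)"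

text \<open>
  The decision relation by which the pair of coordinate \<open>\<gamma>\<close> is read off the iteration.
\<close>

definition reads :: "'i \<Rightarrow> ('i, 'k) icond \<Rightarrow> bool list \<Rightarrow> nat list \<Rightarrow> bool" where
  "reads \<gamma> u d s \<longleftrightarrow> u \<in> conds (Field r) \<and>
     (\<exists>\<tau>. coords u \<gamma> = Some \<tau> \<and> (Inl (d, s) \<^bold>\<in> nm \<tau>) (stage_at \<gamma>) (restr r u \<gamma>))"

lemma reads_generic:
  assumes u: "reads \<gamma> u d s" and w: "(w, u) \<in> iter_le" and \<sigma>: "coords w \<gamma> = Some \<sigma>"
  shows "generically (stage_at \<gamma>) (\<lambda>G. restr r w \<gamma> \<in> G \<longrightarrow>
     (\<exists>c \<phi>. val (nm \<sigma>) G = code_of c \<and> (c, (d, s, \<phi>)) \<in> LE_order b))"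
proof -
  interpret forcing "stage_at \<gamma>" by (rule forcing_stage_le)
  obtain \<tau> where \<tau>: "coords u \<gamma> = Some \<tau>" "(Inl (d, s) \<^bold>\<in> nm \<tau>) (stage_at \<gamma>) (restr r u \<gamma>)"
    using u unfolding reads_def by blast
  have wu: "(restr r w \<gamma>, restr r u \<gamma>) \<in> stage_at \<gamma>" by (rule restr_stage_le[OF w])
  have wF: "restr r w \<gamma> \<in> Field (stage_at \<gamma>)" by (rule FieldI1[OF wu])
  have "f_LE_cond b (nm \<tau>) (stage_at \<gamma>) (restr r u \<gamma>)"
    using stage_le_conds(2)[OF w] \<tau>(1) unfolding conds_iff[of u] by blast
  then have c\<tau>: "f_LE_cond b (nm \<tau>) (stage_at \<gamma>) (restr r w \<gamma>)" by (rule regular_mono[OF regular_LE_cond _ wu])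
  have c\<sigma>: "f_LE_cond b (nm \<sigma>) (stage_at \<gamma>) (restr r w \<gamma>)"
    using stage_le_conds(1)[OF w] \<sigma> unfolding conds_iff[of w] by blast
  have le: "f_LE_le (nm \<sigma>) (nm \<tau>) (stage_at \<gamma>) (restr r w \<gamma>)"
    using w \<sigma> \<tau>(1) unfolding stage_le_iff[of w] by blast
  have mem: "(Inl (d, s) \<^bold>\<in> nm \<tau>) (stage_at \<gamma>) (restr r w \<gamma>)"
    by (rule regular_mono[OF regular_mem \<tau>(2) wu])
  show ?thesis
  proof (rule generically_mono[OF generically_conj[OF
        le[unfolded forces_LE_le_iff[OF wF c\<sigma> c\<tau>]]
        mem[unfolded forces_iff_generically[OF regular_mem mirrors_mem wF]]]], intro impI)
    fix G assume "restr r w \<gamma> \<in> G" and "(restr r w \<gamma> \<in> G \<longrightarrow> (\<exists>c'\<in>LE_cond b. \<exists>c\<in>LE_cond b.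
       val (nm \<sigma>) G = code_of c' \<and> val (nm \<tau>) G = code_of c \<and> (c', c) \<in> LE_order b)) \<and>
       (restr r w \<gamma> \<in> G \<longrightarrow> Inl (d, s) \<in> val (nm \<tau>) G)"
    then obtain c' c where c: "val (nm \<sigma>) G = code_of c'" "val (nm \<tau>) G = code_of c" "(c', c) \<in> LE_order b"
      "Inl (d, s) \<in> val (nm \<tau>) G"
      by blast
    then obtain \<phi> where "c = (d, s, \<phi>)" by (cases c) (auto simp: code_of_def)
    then show "\<exists>c \<phi>. val (nm \<sigma>) G = code_of c \<and> (c, (d, s, \<phi>)) \<in> LE_order b"
      using c(1,3) by blast
  qed
qed

lemma coords_le: "(w, u) \<in> stage_le A \<Longrightarrow> coords u \<gamma> = Some \<tau> \<Longrightarrow> \<exists>\<sigma>. coords w \<gamma> = Some \<sigma>"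
  unfolding stage_le_iff[of w] by blast

text \<open>
  Extending a condition at coordinate \<open>\<gamma>\<close> to a prescribed stem and additional forbidden values
  \<open>Z\<close>: it suffices that \<open>t\<close> forces the resulting value to be an extension in the sense of LE.
\<close>

lemma extend_stem:
  assumes \<gamma>: "\<gamma> \<in> Field r" and q: "q \<in> conds (Field r)" "coords q \<gamma> = Some \<tau>"
    and t: "(t, restr r q \<gamma>) \<in> stage_at \<gamma>"
    and Z: "|Z| \<le>o |UNIV :: 'k set|" "snd ` Z \<subseteq> conds (underS r \<gamma>)"
    and gen: "generically (stage_at \<gamma>) (\<lambda>G. t \<in> G \<longrightarrow> (\<exists>c. val (nm \<tau>) G = code_of c \<and>
      ((d, s, \<lambda>n. {m. Inr (n, m) \<in> val (nm \<tau> \<union> Z) G}), c) \<in> LE_order b))"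
  obtains u \<sigma> where "(u, q) \<in> iter_le" "restr r u \<gamma> = t" "coords u \<gamma> = Some \<sigma>"
    "nm \<sigma> = stem_name d s (nm \<tau> \<union> Z)" "reads \<gamma> u d s"
proof -
  interpret forcing "stage_at \<gamma>" by (rule forcing_stage_le)
  obtain \<sigma> where \<sigma>: "nm \<sigma> = stem_name d s (nm \<tau> \<union> Z)"
    using obtain_stem_name[OF Un_small[OF inf nm_small Z(1)]] by metis
  have tF: "t \<in> Field (stage_at \<gamma>)" by (rule FieldI1[OF t])
  have \<tau>: "snd ` nm \<tau> \<subseteq> conds (underS r \<gamma>)" "f_LE_cond b (nm \<tau>) (stage_at \<gamma>) (restr r q \<gamma>)"
    using q unfolding conds_iff[of q] by blast+
  have c\<tau>: "f_LE_cond b (nm \<tau>) (stage_at \<gamma>) t" by (rule regular_mono[OF regular_LE_cond \<tau>(2) t])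
  have sub: "snd ` nm \<sigma> \<subseteq> conds (underS r \<gamma>)"
    unfolding \<sigma> by (rule stem_name_conds) (use \<tau>(1) Z(2) in blast)
  have gen': "generically (stage_at \<gamma>) (\<lambda>G. t \<in> G \<longrightarrow> (\<exists>c'\<in>LE_cond b. \<exists>c\<in>LE_cond b.
      val (nm \<sigma>) G = code_of c' \<and> val (nm \<tau>) G = code_of c \<and> (c', c) \<in> LE_order b))"
  proof (rule generically_mono[OF gen], intro impI)
    fix G assume G: "cond_filter (stage_at \<gamma>) G" "t \<in> G" and *: "t \<in> G \<longrightarrow> (\<exists>c. val (nm \<tau>) G = code_of c \<and>
      ((d, s, \<lambda>n. {m. Inr (n, m) \<in> val (nm \<tau> \<union> Z) G}), c) \<in> LE_order b)"
    then obtain c where c: "val (nm \<tau>) G = code_of c"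
      "((d, s, \<lambda>n. {m. Inr (n, m) \<in> val (nm \<tau> \<union> Z) G}), c) \<in> LE_order b" by blast
    have "c \<in> LE_cond b" "(d, s, \<lambda>n. {m. Inr (n, m) \<in> val (nm \<tau> \<union> Z) G}) \<in> LE_cond b"
      using FieldI1[OF c(2)] FieldI2[OF c(2)] by (simp_all add: Field_LE_order)
    then show "\<exists>c'\<in>LE_cond b. \<exists>c\<in>LE_cond b.
      val (nm \<sigma>) G = code_of c' \<and> val (nm \<tau>) G = code_of c \<and> (c', c) \<in> LE_order b"
      using c val_stem_name[OF G(1)] unfolding \<sigma> by blast
  qed
  have c\<sigma>: "f_LE_cond b (nm \<sigma>) (stage_at \<gamma>) t"
    unfolding forces_LE_cond_iff[OF tF] by (rule generically_mono[OF gen']) blast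
  have le: "f_LE_le (nm \<sigma>) (nm \<tau>) (stage_at \<gamma>) t"
    unfolding forces_LE_le_iff[OF tF c\<sigma> c\<tau>] by (rule gen')
  let ?u = "splice \<gamma> t \<sigma> q"
  have u: "(?u, q) \<in> iter_le"
    by (rule splice_ext[OF q(1) \<gamma> underS_sub_Field t sub c\<sigma>]) (use q(2) le in simp)
  have tc: "t \<in> conds (underS r \<gamma>)" by (rule stage_le_conds(1)[OF t])
  have r: "restr r ?u \<gamma> = t" by (rule splice_below[OF tc])
  have "(Inl (d, s) \<^bold>\<in> nm \<sigma>) (stage_at \<gamma>) t"
    unfolding fmem_def
  proof (intro allI impI)
    fix v assume "(v, t) \<in> stage_at \<gamma>"
    then have v: "v \<in> conds (underS r \<gamma>)" by (rule stage_le_conds(1))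
    have "(Inl (d, s), weakest) \<in> nm \<sigma>" unfolding \<sigma> stem_name_def by simp
    then show "\<exists>r t. (r, v) \<in> stage_at \<gamma> \<and> (Inl (d, s), t) \<in> nm \<sigma> \<and> (r, t) \<in> stage_at \<gamma>"
      using stage_le_refl[OF v] weakest_max[OF v] by blast
  qed
  then have "reads \<gamma> ?u d s" unfolding reads_def r using stage_le_conds(1)[OF u] splice_at by blast
  then show ?thesis by (rule that[OF u r splice_at \<sigma>])
qed

lemma reads_dense:
  assumes \<gamma>: "\<gamma> \<in> Field r" and p: "p \<in> conds (Field r)"
  shows "\<exists>q d s n. (q, p) \<in> iter_le \<and> reads \<gamma> q d s \<and> N \<le> n \<and> n \<in> ones d"
proof -
  interpret forcing "stage_at \<gamma>" by (rule forcing_stage_le)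
  obtain q \<tau> d s k where q: "(q, p) \<in> iter_le" "coords q \<gamma> = Some \<tau>"
    "f_LE_cond_stem b (nm \<tau>) d s k (stage_at \<gamma>) (restr r q \<gamma>)"
    by (rule stem_decided[OF p \<gamma> underS_sub_Field]) (rule that)
  have qc: "q \<in> conds (Field r)" by (rule stage_le_conds(1)[OF q(1)])
  have rq: "restr r q \<gamma> \<in> Field (stage_at \<gamma>)" using restr_conds[OF qc] by (simp add: Field_stage_le)
  define n where "n = Suc (max N (length d))"
  have n: "length d \<le> n" "0 < n" "N \<le> n" by (auto simp: n_def)
  obtain t m where t: "(t, restr r q \<gamma>) \<in> stage_at \<gamma>" "m < b n" "(\<^bold>\<not> Inr (n, m) \<^bold>\<in> nm \<tau>) (stage_at \<gamma>) t"
    by (rule stem_decide_avoided[OF rq q(3) n(1,2) b_pos]) (rule that)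
  have tF: "t \<in> Field (stage_at \<gamma>)" by (rule FieldI1[OF t(1)])
  have stem: "f_LE_cond_stem b (nm \<tau>) d s k (stage_at \<gamma>) t"
    by (rule regular_mono[OF regular_LE_cond_stem q(3) t(1)])
  let ?d = "pad False n d @ [True]" and ?s = "pad 0 n s @ [m]"
  have gen: "generically (stage_at \<gamma>) (\<lambda>G. t \<in> G \<longrightarrow> (\<exists>c. val (nm \<tau>) G = code_of c \<and>
      ((?d, ?s, \<lambda>n. {m. Inr (n, m) \<in> val (nm \<tau> \<union> {}) G}), c) \<in> LE_order b))"
  proof (rule generically_mono[OF generically_conj[OF
        stem[unfolded forces_LE_cond_stem_iff[OF tF]]
        t(3)[unfolded forces_iff_generically[OF regular_not[OF regular_mem] mirrors_not[OF regular_mem mirrors_mem] tF]]]],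
      intro impI)
    fix G assume "t \<in> G" and "(t \<in> G \<longrightarrow> (\<exists>\<phi>. val (nm \<tau>) G = code_of (d, s, \<phi>) \<and> (d, s, \<phi>) \<in> LE_cond_rate b k)) \<and>
        (t \<in> G \<longrightarrow> Inr (n, m) \<notin> val (nm \<tau>) G)"
    then obtain \<phi> where \<phi>: "val (nm \<tau>) G = code_of (d, s, \<phi>)" "(d, s, \<phi>) \<in> LE_cond b"
      "Inr (n, m) \<notin> val (nm \<tau>) G"
      using LE_cond_iff_rate by blast
    have eq: "{m. Inr (n, m) \<in> val (nm \<tau> \<union> {}) G} = \<phi> n" for n
      using \<phi>(1)[unfolded code_of_eq_iff] by simp
    then have "m \<notin> \<phi> n" using \<phi>(3) by auto
    then show "\<exists>c. val (nm \<tau>) G = code_of c \<and>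
      ((?d, ?s, \<lambda>n. {m. Inr (n, m) \<in> val (nm \<tau> \<union> {}) G}), c) \<in> LE_order b"
      unfolding eq using LE_cond_add_one(2)[OF \<phi>(2) b_pos n(1) t(2)] \<phi>(1) by blast
  qed
  obtain u \<sigma> where u: "(u, q) \<in> iter_le" "reads \<gamma> u ?d ?s"
    by (rule extend_stem[OF \<gamma> qc q(2) t(1) _ _ gen]) (simp_all add: countable_small inf)
  have "n \<in> ones ?d" using n by (simp add: ones_def length_pad nth_append)
  then show ?thesis using stage_le_trans[OF u(1) q(1)] u(2) n(3) by blast
qed

lemma stem_reading_at:
  assumes \<gamma>: "\<gamma> \<in> Field r"
  shows "stem_reading iter_le b (reads \<gamma>)"
proof -
  interpret forcing iter_le by (rule forcing_stage_le)
  have generic: "\<exists>c \<phi>. (c, (d, s, \<phi>)) \<in> LE_order b"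
    if "reads \<gamma> p d s" for p d s
  proof -
    obtain \<tau> where "coords p \<gamma> = Some \<tau>" "p \<in> conds (Field r)" using \<open>reads \<gamma> p d s\<close> unfolding reads_def by blast
    then have gen: "generically (stage_at \<gamma>) (\<lambda>G. restr r p \<gamma> \<in> G \<longrightarrow>
     (\<exists>c \<phi>. val (nm \<tau>) G = code_of c \<and> (c, (d, s, \<phi>)) \<in> LE_order b))"
      using reads_generic[OF \<open>reads \<gamma> p d s\<close> stage_le_refl] by blast
    have F: "restr r p \<gamma> \<in> Field (stage_at \<gamma>)" using restr_conds[OF \<open>p \<in> conds (Field r)\<close>] by (simp add: Field_stage_le)
    show ?thesis by (rule forcing.generic_exists[OF forcing_stage_le gen F]) blast
  qed
  show ?thesis
  proof
    show "length s = length d \<and> (\<forall>n < length s. s ! n < b n)" if h: "reads \<gamma> p d s" for p d s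
    proof -
      obtain c \<phi> where "(c, (d, s, \<phi>)) \<in> LE_order b" using generic[OF h] by blast
      then have "(d, s, \<phi>) \<in> LE_cond b" unfolding Field_LE_order[symmetric] by (rule FieldI2)
      then show ?thesis by (auto simp: LE_cond_def)
    qed
    show "p \<in> Field iter_le" if "reads \<gamma> p d s" for p d s
      using that unfolding reads_def Field_stage_le by blast
    show "s ! n = s' ! n" if h: "reads \<gamma> p d s" "reads \<gamma> q d' s'" "(t, p) \<in> iter_le" "(t, q) \<in> iter_le"
      "n < length s" "n < length s'" for p d s q d' s' t n
    proof -
      obtain \<tau> where "coords p \<gamma> = Some \<tau>" using h(1) unfolding reads_def by blast
      then obtain \<sigma> where \<sigma>: "coords t \<gamma> = Some \<sigma>" using coords_le[OF h(3)] by blast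
      have F: "restr r t \<gamma> \<in> Field (stage_at \<gamma>)" using restr_conds[OF stage_le_conds(1)[OF h(3)]] by (simp add: Field_stage_le)
      obtain G c \<phi> c' \<phi>' where "val (nm \<sigma>) G = code_of c" "(c, (d, s, \<phi>)) \<in> LE_order b"
         "val (nm \<sigma>) G = code_of c'" "(c', (d', s', \<phi>')) \<in> LE_order b"
        by (rule forcing.generic_exists[OF forcing_stage_le generically_conj[OF
              reads_generic[OF h(1,3) \<sigma>] reads_generic[OF h(2,4) \<sigma>]] F]) (blast intro: that)
      then have "(c, (d, s, \<phi>)) \<in> LE_order b" "(c, (d', s', \<phi>')) \<in> LE_order b"
        by (simp_all add: code_of_inject)
      then have "prefix s (fst (snd c))" "prefix s' (fst (snd c))"
        by (cases c, simp add: LE_order_def)+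
      then show ?thesis using h(5,6) by (metis nth_append prefix_def)
    qed
    show "\<exists>q d s n. (q, p) \<in> iter_le \<and> reads \<gamma> q d s \<and> N \<le> n \<and> n \<in> ones d" if "p \<in> Field iter_le" for p N
      using reads_dense[OF \<gamma>] that unfolding Field_stage_le by blast
  qed
qed

text \<open>
  The analogue, over stage \<open>\<gamma>\<close>, of forbidding the values of a ground-model \<open>x\<close>.  The sets \<open>T n\<close> are countable
  sets of conditions of stage \<open>\<gamma>\<close>, predense below \<open>p\<close>, that decide \<open>x(n)\<close>; so the name \<open>Z\<close> in the proof
  is a countable name over stage \<open>\<gamma>\<close> of the set of all pairs \<open>(n, x(n))\<close>.  Its sections have at
  most one element, because conditions below \<open>p\<close> force at most one value.  Predensity is needed to see that a
  later coincidence of \<open>y\<close> with \<open>x\<close> at \<open>n\<close> is one with a value that \<open>Z\<close> has in the generic filter.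
\<close>

lemma avoid_name:
  assumes \<gamma>: "\<gamma> \<in> Field r"
    and x: "f_prod_b b x iter_le p"
    and T: "\<And>n. countable (T n)" "\<And>n t. t \<in> T n \<Longrightarrow> (t, p) \<in> iter_le \<and> dom (coords t) \<subseteq> underS r \<gamma> \<and> (\<exists>m. ((n, m) \<^bold>\<in> x) iter_le t)"
      "\<And>n q. (q, p) \<in> iter_le \<Longrightarrow> \<exists>t\<in>T n. \<exists>u. (u, q) \<in> iter_le \<and> (u, t) \<in> iter_le"
    and q: "(q, p) \<in> iter_le"
  shows "\<exists>u L. (u, q) \<in> iter_le \<and> (\<forall>v d s n w. reads \<gamma> v d s \<longrightarrow> (w, v) \<in> iter_le \<longrightarrow> (w, u) \<in> iter_le \<longrightarrow>
     L \<le> n \<longrightarrow> n \<in> ones d \<longrightarrow> \<not> ((n, s ! n) \<^bold>\<in> x) iter_le w)"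
proof -
  interpret P: forcing iter_le by (rule forcing_stage_le)
  interpret forcing "stage_at \<gamma>" by (rule forcing_stage_le)
  have unique: "m = m'" if "(w, p) \<in> iter_le" "((n, m) \<^bold>\<in> x) iter_le w" "((n, m') \<^bold>\<in> x) iter_le w" for w n m m'
    by (rule P.f_prod_b_unique[OF x that])
  have bound: "m < b n" if w: "(w, p) \<in> iter_le" "((n, m) \<^bold>\<in> x) iter_le w" for w n m
  proof -
    obtain s m' where s: "(s, w) \<in> iter_le" "m' < b n" "((n, m') \<^bold>\<in> x) iter_le s"
      by (rule P.f_prod_b_value[OF x w(1)]) (rule that)
    have "((n, m) \<^bold>\<in> x) iter_le s" by (rule regular_mono[OF P.regular_mem w(2) s(1)])
    then have "m = m'" using unique[OF stage_le_trans[OF s(1) w(1)]] s(3) by blast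
    then show ?thesis using s(2) by simp
  qed
  obtain u0 \<tau> d s k where u0: "(u0, q) \<in> iter_le" "coords u0 \<gamma> = Some \<tau>"
    "f_LE_cond_stem b (nm \<tau>) d s k (stage_at \<gamma>) (restr r u0 \<gamma>)"
    by (rule stem_decided[OF stage_le_conds(1)[OF q] \<gamma> underS_sub_Field]) (rule that)
  have u0c: "u0 \<in> conds (Field r)" by (rule stage_le_conds(1)[OF u0(1)])
  let ?t = "restr r u0 \<gamma>"
  have tc: "?t \<in> conds (underS r \<gamma>)" by (rule restr_conds[OF u0c])
  then have tF: "?t \<in> Field (stage_at \<gamma>)" by (simp add: Field_stage_le)
  define L where "L = max (length d) (2 ^ Suc k)"
  define Z :: "(code, ('i, 'k) icond) name" where
    "Z = {(Inr (n, m), t) | n m t. t \<in> T n \<and> ((n, m) \<^bold>\<in> x) iter_le t}"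
  have Tc: "t \<in> conds (underS r \<gamma>)" if "t \<in> T n" for t n
    using T(2)[OF that] conds_mono[OF stage_le_conds(1)] by blast
  have Zc: "snd ` Z \<subseteq> conds (underS r \<gamma>)" unfolding Z_def using Tc by auto
  have "Z \<subseteq> (\<Union>n. \<Union>m. Pair (Inr (n, m)) ` T n)" unfolding Z_def by auto
  then have "countable Z" by (rule countable_subset) (use T(1) in simp)
  then have Zs: "|Z| \<le>o |UNIV :: 'k set|" by (rule countable_small[OF _ inf])
  let ?d = "pad False L d" and ?s = "pad 0 L s"
  have gen: "generically (stage_at \<gamma>) (\<lambda>G. ?t \<in> G \<longrightarrow> (\<exists>c. val (nm \<tau>) G = code_of c \<and>
      ((?d, ?s, \<lambda>n. {m. Inr (n, m) \<in> val (nm \<tau> \<union> Z) G}), c) \<in> LE_order b))"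
  proof (rule generically_mono[OF u0(3)[unfolded forces_LE_cond_stem_iff[OF tF]]], intro impI)
    fix G assume G: "cond_filter (stage_at \<gamma>) G" "?t \<in> G"
      and "?t \<in> G \<longrightarrow> (\<exists>\<phi>. val (nm \<tau>) G = code_of (d, s, \<phi>) \<and> (d, s, \<phi>) \<in> LE_cond_rate b k)"
    then obtain \<phi> where \<phi>: "val (nm \<tau>) G = code_of (d, s, \<phi>)" "(d, s, \<phi>) \<in> LE_cond_rate b k" by blast
    define \<psi> where "\<psi> n = {m. Inr (n, m) \<in> val Z G}" for n
    have eq: "{m. Inr (n, m) \<in> val (nm \<tau> \<union> Z) G} = \<phi> n \<union> \<psi> n" for n
      using \<phi>(1)[unfolded code_of_eq_iff] by (auto simp: val_Un \<psi>_def)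
    have \<psi>D: "\<exists>t\<in>G. t \<in> T n \<and> ((n, m) \<^bold>\<in> x) iter_le t" if "m \<in> \<psi> n" for m n
      using that unfolding \<psi>_def val_def Z_def by auto
    have \<psi>b: "\<psi> n \<subseteq> {..<b n}" for n
    proof
      fix m assume "m \<in> \<psi> n"
      then show "m \<in> {..<b n}" using \<psi>D T(2) bound by fastforce
    qed
    have one: "m = m'" if mm: "m \<in> \<psi> n" "m' \<in> \<psi> n" for m m' n
    proof -
      obtain t t' where t: "t \<in> G" "t \<in> T n" "((n, m) \<^bold>\<in> x) iter_le t" "t' \<in> G" "t' \<in> T n" "((n, m') \<^bold>\<in> x) iter_le t'"
        using \<psi>D[OF mm(1)] \<psi>D[OF mm(2)] by blast
      obtain w where w: "(w, t) \<in> stage_at \<gamma>" "(w, t') \<in> stage_at \<gamma>"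
        using cond_filter_directed[OF G(1) t(1,4)] by blast
      have "(w, t) \<in> iter_le" "(w, t') \<in> iter_le" 
        using stage_le_mono[OF w(1) underS_sub_Field] stage_le_mono[OF w(2) underS_sub_Field] by blast+
      then show ?thesis
        using unique[OF stage_le_trans[of w t]] T(2)[OF t(2)] regular_mono[OF P.regular_mem t(3)]
          regular_mono[OF P.regular_mem t(6)] by blast
    qed
    \<comment> \<open>A single value is a small section because \<open>b n \<ge> 2 ^ n\<close>.\<close>
    have "card (\<psi> n) \<le> 1" for n
    proof (cases "\<psi> n = {}")
      case False
      then obtain m where "m \<in> \<psi> n" by blast
      then have "\<psi> n = {m}" using one by blast
      then show ?thesis by simp
    qed simp
    then have rate: "real (card (\<psi> n)) / real (b n) \<le> 2 powr (- (real n / 2 ^ k))" for n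
      by (rule small_section_rate[OF b_large])
    have "((?d, ?s, \<lambda>n. \<phi> n \<union> \<psi> n), (d, s, \<phi>)) \<in> LE_order b"
      by (rule LE_cond_pad_Un(2)[OF \<phi>(2) b_pos \<psi>b rate]) (simp add: L_def)
    then show "\<exists>c. val (nm \<tau>) G = code_of c \<and>
      ((?d, ?s, \<lambda>n. {m. Inr (n, m) \<in> val (nm \<tau> \<union> Z) G}), c) \<in> LE_order b"
      unfolding eq using \<phi>(1) by blast
  qed
  obtain u \<sigma> where u: "(u, u0) \<in> iter_le" "restr r u \<gamma> = ?t" "coords u \<gamma> = Some \<sigma>"
     "nm \<sigma> = stem_name ?d ?s (nm \<tau> \<union> Z)" "reads \<gamma> u ?d ?s"
    by (rule extend_stem[OF \<gamma> u0c u0(2) stage_le_refl[OF tc] Zs Zc gen]) (rule that)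
  have uq: "(u, q) \<in> iter_le" by (rule stage_le_trans[OF u(1) u0(1)])
  have "\<not> ((n, sv ! n) \<^bold>\<in> x) iter_le w"
    if h: "reads \<gamma> v dv sv" "(w, v) \<in> iter_le" "(w, u) \<in> iter_le" "L \<le> n" "n \<in> ones dv" for v dv sv n w
  proof
    assume xw: "((n, sv ! n) \<^bold>\<in> x) iter_le w"
    have wp: "(w, p) \<in> iter_le" using h(3) uq q stage_le_trans by blast
    obtain t w' where t: "t \<in> T n" "(w', w) \<in> iter_le" "(w', t) \<in> iter_le" using T(3)[OF wp] by blast
    obtain m where m: "((n, m) \<^bold>\<in> x) iter_le t" using T(2)[OF t(1)] by blast
    have "m = sv ! n"
      by (rule unique[OF stage_le_trans[OF t(2) wp] regular_mono[OF P.regular_mem m t(3)]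
            regular_mono[OF P.regular_mem xw t(2)]])
    then have tZ: "(Inr (n, sv ! n), t) \<in> Z" unfolding Z_def using t(1) m by blast
    \<comment> \<open>In a generic filter containing \<open>w'\<close> below \<open>\<gamma>\<close>, also \<open>t\<close> is present, so \<open>sv ! n\<close> is forbidden by the value at \<open>u\<close>.\<close>
    have w'v: "(w', v) \<in> iter_le" and w'u: "(w', u) \<in> iter_le"
      using t(2) h(2,3) stage_le_trans by blast+
    obtain \<rho> where \<rho>: "coords w' \<gamma> = Some \<rho>" using coords_le[OF w'u u(3)] by blast
    have w'F: "restr r w' \<gamma> \<in> Field (stage_at \<gamma>)" using restr_conds[OF stage_le_conds(1)[OF t(2)]] by (simp add: Field_stage_le)
    have wu: "(restr r w' \<gamma>, restr r u \<gamma>) \<in> stage_at \<gamma>" by (rule restr_stage_le[OF w'u])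
    have c\<rho>: "f_LE_cond b (nm \<rho>) (stage_at \<gamma>) (restr r w' \<gamma>)"
      using stage_le_conds(1)[OF t(2)] \<rho> unfolding conds_iff[of w'] by blast
    have "f_LE_cond b (nm \<sigma>) (stage_at \<gamma>) (restr r u \<gamma>)"
      using stage_le_conds(1)[OF u(1)] u(3) unfolding conds_iff[of u] by blast
    then have c\<sigma>: "f_LE_cond b (nm \<sigma>) (stage_at \<gamma>) (restr r w' \<gamma>)"
      by (rule regular_mono[OF regular_LE_cond _ wu])
    have le: "f_LE_le (nm \<rho>) (nm \<sigma>) (stage_at \<gamma>) (restr r w' \<gamma>)"
      using w'u \<rho> u(3) unfolding stage_le_iff[of w'] by blast
    obtain G c' c cv \<phi>v where G: "cond_filter (stage_at \<gamma>) G" "restr r w' \<gamma> \<in> G"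
      "val (nm \<rho>) G = code_of c'" "val (nm \<sigma>) G = code_of c" "(c', c) \<in> LE_order b"
      "val (nm \<rho>) G = code_of cv" "(cv, (dv, sv, \<phi>v)) \<in> LE_order b"
      by (rule generic_exists[OF generically_conj[OF le[unfolded forces_LE_le_iff[OF w'F c\<rho> c\<sigma>]]
            reads_generic[OF h(1) w'v \<rho>]] w'F]) (blast intro: that)
    have cv: "cv = c'" using G(3,6) by (simp add: code_of_inject)
    have "restr r t \<gamma> = t" using T(2)[OF t(1)] restr_id by blast
    then have "(restr r w' \<gamma>, t) \<in> stage_at \<gamma>" using restr_stage_le[OF t(3), of \<gamma>] by simp
    then have "t \<in> G" by (rule cond_filter_up[OF G(1,2)])
    then have "Inr (n, sv ! n) \<in> val (nm \<tau> \<union> Z) G" using tZ by (auto simp: val_def)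
    then obtain \<chi> where c: "c = (?d, ?s, \<chi>)" "sv ! n \<in> \<chi> n"
      using G(4)[unfolded u(4) val_stem_name[OF G(1)] code_of_inject] by blast
    obtain d' s' \<phi>' where c': "c' = (d', s', \<phi>')" by (cases c')
    have "(dv, sv, \<phi>v) \<in> LE_cond b" using FieldI2[OF G(7)] by (simp add: Field_LE_order)
    then have "length sv = length dv" by (simp add: LE_cond_def)
    then have n: "n \<in> ones d'" "s' ! n = sv ! n"
      using G(7) h(5) by (auto simp: cv c' LE_order_def ones_def prefix_def nth_append)
    have "n \<notin> ones ?d" using h(4) by (simp add: ones_pad) (simp add: ones_def L_def)
    with n(1) have "n \<in> ones d' - ones ?d" by simp
    moreover have "\<forall>j\<in>ones d' - ones ?d. s' ! j \<notin> \<chi> j"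
      using G(5) by (simp add: c' c(1) LE_order_def)
    ultimately show False using n(2) c(2) by metis
  qed
  then show ?thesis using uq by blast
qed

text \<open>
  Here \<open>\<theta>\<close> enters: a union of fewer than \<open>\<theta>\<close> countable sets has fewer than \<open>\<theta>\<close> elements since
  \<open>\<theta>\<close> is regular and uncountable, and again by regularity it is not cofinal.
\<close>

lemma bounded_support:
  fixes T :: "'i \<Rightarrow> nat \<Rightarrow> 'z set"
  assumes r: "Card_order r" "natLeq <o r" "regularCard r" and l: "l \<in> Field r"
    and T: "\<And>i n. i \<in> underS r l \<Longrightarrow> countable (T i n)"
      "\<And>i n t. i \<in> underS r l \<Longrightarrow> t \<in> T i n \<Longrightarrow> finite (S t) \<and> S t \<subseteq> Field r"
  obtains \<gamma> where "\<gamma> \<in> Field r" "\<And>i n t. i \<in> underS r l \<Longrightarrow> t \<in> T i n \<Longrightarrow> S t \<subseteq> underS r \<gamma>"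
proof -
  have fin: "infinite (Field r)"
    using card_of_mono2 card_of_ordLeq_infinite cinfinite_def natLeq_cinfinite ordLess_imp_ordLeq r(2)
    by blast
  then have cinf: "Cinfinite r" using r(1) by (simp add: cinfinite_def)
  have ctb: "|A| <o r" if cA: "countable A" for A :: "'i set"
  proof -
    obtain f :: "'i \<Rightarrow> nat" where "inj_on f A" using cA by (auto simp: countable_def)
    then have "|A| \<le>o |UNIV :: nat set|" by (rule card_of_ordLeqI) simp
    then show ?thesis by (rule ordLeq_ordLess_trans[OF ordLeq_ordIso_trans[OF _ card_of_nat] r(2)])
  qed
  define U where "U = (\<Union>i\<in>underS r l. \<Union>n. \<Union>t\<in>T i n. S t)"
  have "|U| <o r"
    unfolding U_def
  proof (rule card_of_UNION_ordLess_infinite_Field_regularCard[OF r(3) cinf card_of_underS[OF r(1) l]], rule ballI)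
    fix i assume i: "i \<in> underS r l"
    have "countable (\<Union>t\<in>T i n. S t)" for n
      by (rule countable_UN[OF T(1)[OF i]]) (use T(2)[OF i] countable_finite in blast)
    then have "countable (\<Union>n. \<Union>t\<in>T i n. S t)" by (intro countable_UN[OF countableI_type])
    then show "|\<Union>n. \<Union>t\<in>T i n. S t| <o r" by (rule ctb)
  qed
  then have "\<not> |U| =o r" by (rule not_ordLess_ordIso)
  moreover have UF: "U \<subseteq> Field r"
    unfolding U_def by (intro UN_least conjunct2[OF T(2)])
  ultimately have "\<not> cofinal U r" using r(3) unfolding regularCard_def by blast
  then obtain a where a: "a \<in> Field r" "\<And>s. s \<in> U \<Longrightarrow> a = s \<or> (a, s) \<notin> r"
    unfolding cofinal_def by blast
  obtain \<gamma> where \<gamma>: "\<gamma> \<in> Field r" "a \<in> underS r \<gamma>"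
    using infinite_Card_order_limit[OF r(1) fin a(1)] unfolding underS_def by blast
  have tot: "total_on (Field r) r"
    using wo by (simp add: well_order_on_def linear_order_on_def)
  have "s \<in> underS r \<gamma>" if s: "s \<in> U" for s
  proof (cases "s = a")
    case False
    then have "s \<in> underS r a"
      using tot a(1) a(2)[OF s] subsetD[OF UF s] unfolding total_on_def underS_def by blast
    then show ?thesis using underS_trans[OF \<gamma>(2)] by blast
  qed (use \<gamma>(2) in simp)
  then have "S t \<subseteq> underS r \<gamma>" if "i \<in> underS r l" "t \<in> T i n" for i n t
    using that unfolding U_def by blast
  then show ?thesis by (rule that[OF \<gamma>(1)])
qed

text \<open>
  The names of the bounding pair do not depend on the condition reached, only on \<open>\<gamma>\<close>; this allows
  \<open>read_D\<close> and \<open>read_y\<close> to witness both existential quantifiers below \<open>p\<close>.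
\<close>

lemma iteration_bounding:
  assumes r: "Card_order r" "natLeq <o r" "regularCard r"
  shows "iter_le \<tturnstile> f_bounding_ge b r"
  unfolding forced_def f_bounding_ge_def
proof (intro ballI forces_allI iffD2[OF forces_imp] allI impI)
  fix p0 l p and X :: "('i \<times> nat \<times> nat, ('i, 'k) icond) name"
  assume p: "(p, p0) \<in> iter_le"
  interpret forcing iter_le by (rule forcing_stage_le)
  let ?x = "section_name X"
  let ?goal = "\<^bold>\<exists>D. \<^bold>\<exists>y. f_infinite D \<^bold>\<and> f_prod_b b y \<^bold>\<and>
           (\<^bold>\<forall>i. \<langle>i \<in> underS r l\<rangle> \<^bold>\<longrightarrow> f_neq_star (?x i) D y)"
  have main: "?goal iter_le p"
    if hyp: "(\<langle>l \<in> Field r\<rangle> \<^bold>\<and> (\<^bold>\<forall>i. \<langle>i \<in> underS r l\<rangle> \<^bold>\<longrightarrow> f_prod_b b (?x i))) iter_le p"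
  proof -
    have l: "l \<in> Field r" using hyp by (simp add: forces_and forces_ground)
    have pF: "p \<in> Field iter_le" by (rule FieldI1[OF p])
    have x: "f_prod_b b (?x i) iter_le p" if i: "i \<in> underS r l" for i
    proof (rule regular_local[OF _ pF])
      show "regular iter_le (f_prod_b b (?x i))" unfolding f_prod_b_def by (intro regular_intros)
      fix q assume q: "(q, p) \<in> iter_le"
      have "(\<langle>i \<in> underS r l\<rangle> \<^bold>\<longrightarrow> f_prod_b b (?x i)) iter_le p"
        using hyp by (simp add: forces_and forces_all)
      then show "\<exists>s. (s, q) \<in> iter_le \<and> f_prod_b b (?x i) iter_le s"
        using q i unfolding forces_imp forces_not forces_ground by blast
    qed
    \<comment> \<open>The conditions below \<open>p\<close> that decide \<open>X\<^sub>i(n)\<close>.\<close>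
    define E where "E i n = {t. (t, p) \<in> iter_le \<and> (\<exists>m. ((n, m) \<^bold>\<in> ?x i) iter_le t)}" for i n
    have "\<exists>T. T \<subseteq> E i n \<and> (\<forall>s\<in>T. \<forall>t\<in>T. s \<noteq> t \<longrightarrow> \<not> (\<exists>u. (u, s) \<in> iter_le \<and> (u, t) \<in> iter_le)) \<and>
       (\<forall>e\<in>E i n. e \<in> Field iter_le \<longrightarrow> (\<exists>t\<in>T. \<exists>u. (u, e) \<in> iter_le \<and> (u, t) \<in> iter_le))" for i n
      by (rule maximal_antichain)
    then obtain T where T: "\<And>i n. T i n \<subseteq> E i n"
      "\<And>i n s t. s \<in> T i n \<Longrightarrow> t \<in> T i n \<Longrightarrow> s \<noteq> t \<Longrightarrow> \<not> (\<exists>u. (u, s) \<in> iter_le \<and> (u, t) \<in> iter_le)"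
      "\<And>i n e. e \<in> E i n \<Longrightarrow> e \<in> Field iter_le \<Longrightarrow> \<exists>t\<in>T i n. \<exists>u. (u, e) \<in> iter_le \<and> (u, t) \<in> iter_le"
      by metis
    have Tp: "(t, p) \<in> iter_le" "\<exists>m. ((n, m) \<^bold>\<in> ?x i) iter_le t" if "t \<in> T i n" for t i n
      using T(1) that unfolding E_def by blast+
    have Tctb: "countable (T i n)" for i n
      by (rule countable_antichain[OF _ underS_sub_Field _ T(2)]) (use stage_le_conds(1)[OF Tp(1)] in auto)
    have supp: "finite (dom (coords t)) \<and> dom (coords t) \<subseteq> Field r" if "t \<in> T i n" for t i n
      using stage_le_conds(1)[OF Tp(1)[OF that]] unfolding conds_iff[of t] by blast
    obtain \<gamma> where \<gamma>: "\<gamma> \<in> Field r" "\<And>i n t. i \<in> underS r l \<Longrightarrow> t \<in> T i n \<Longrightarrow> dom (coords t) \<subseteq> underS r \<gamma>"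
      by (rule bounded_support[OF r l, of T "\<lambda>t. dom (coords t)"]) (use Tctb supp in blast)+
    interpret stem_reading iter_le b "reads \<gamma>" by (rule stem_reading_at[OF \<gamma>(1)])
    \<comment> \<open>The antichains are predense below \<open>p\<close>, since the deciding conditions are dense there.\<close>
    have Tdense: "\<exists>t\<in>T i n. \<exists>u. (u, q) \<in> iter_le \<and> (u, t) \<in> iter_le" if i: "i \<in> underS r l" and q: "(q, p) \<in> iter_le" for i n q
    proof -
      obtain s m where s: "(s, q) \<in> iter_le" "((n, m) \<^bold>\<in> ?x i) iter_le s"
        by (rule f_prod_b_value[OF x[OF i] q]) (rule that)
      then have "s \<in> E i n" unfolding E_def using stage_le_trans[OF s(1) q] by blast
      then obtain t u where "t \<in> T i n" "(u, s) \<in> iter_le" "(u, t) \<in> iter_le"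
        using T(3) FieldI1[OF s(1)] by blast
      then show ?thesis using stage_le_trans[OF _ s(1)] by blast
    qed
    have neq: "f_neq_star (?x i) read_D read_y iter_le q" if i: "i \<in> underS r l" and q: "(q, p) \<in> iter_le" for i q
    proof (rule read_neq_star)
      fix q' assume "(q', q) \<in> iter_le"
      then have q': "(q', p) \<in> iter_le" using stage_le_trans q by blast
      show "\<exists>u L. (u, q') \<in> iter_le \<and> (\<forall>v d s n w. reads \<gamma> v d s \<longrightarrow> (w, v) \<in> iter_le \<longrightarrow> (w, u) \<in> iter_le \<longrightarrow>
         L \<le> n \<longrightarrow> n \<in> ones d \<longrightarrow> \<not> ((n, s ! n) \<^bold>\<in> ?x i) iter_le w)"
        by (rule avoid_name[OF \<gamma>(1) x[OF i] Tctb _ Tdense[OF i] q']) (use Tp \<gamma>(2)[OF i] in blast)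
    qed
    have body: "(f_infinite read_D \<^bold>\<and> f_prod_b b read_y \<^bold>\<and>
           (\<^bold>\<forall>i. \<langle>i \<in> underS r l\<rangle> \<^bold>\<longrightarrow> f_neq_star (?x i) read_D read_y)) iter_le q"
      if q: "(q, p) \<in> iter_le" for q
      unfolding forces_and
    proof (intro conjI forces_allI)
      show "f_infinite read_D iter_le q" "f_prod_b b read_y iter_le q"
        by (rule read_D_infinite read_y_prod)+
      show "(\<langle>i \<in> underS r l\<rangle> \<^bold>\<longrightarrow> f_neq_star (?x i) read_D read_y) iter_le q" for i
        unfolding forces_imp forces_not forces_ground
      proof (intro allI impI notI, elim conjE)
        fix q' assume q': "(q', q) \<in> iter_le" "i \<in> underS r l"
          "\<forall>q''. (q'', q') \<in> iter_le \<longrightarrow> \<not> f_neq_star (?x i) read_D read_y iter_le q''"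
        have "(q', p) \<in> iter_le" by (rule stage_le_trans[OF q'(1) q])
        then show False using neq[OF q'(2)] q'(3) stage_le_refl[OF stage_le_conds(1)[OF q'(1)]] by blast
      qed
    qed
    show ?thesis
    proof (rule forces_exI)
      fix q assume q: "(q, p) \<in> iter_le"
      have "(\<^bold>\<exists>y. f_infinite read_D \<^bold>\<and> f_prod_b b y \<^bold>\<and>
           (\<^bold>\<forall>i. \<langle>i \<in> underS r l\<rangle> \<^bold>\<longrightarrow> f_neq_star (?x i) read_D y)) iter_le q"
      proof (intro forces_exI)
        fix q' assume q': "(q', q) \<in> iter_le"
        then show "\<exists>s y. (s, q') \<in> iter_le \<and> (f_infinite read_D \<^bold>\<and> f_prod_b b y \<^bold>\<and>
           (\<^bold>\<forall>i. \<langle>i \<in> underS r l\<rangle> \<^bold>\<longrightarrow> f_neq_star (?x i) read_D y)) iter_le s"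
          using body[OF stage_le_trans[OF q' q]] stage_le_refl[OF stage_le_conds(1)[OF q']] by blast
      qed
      then show "\<exists>s D. (s, q) \<in> iter_le \<and> (\<^bold>\<exists>y. f_infinite D \<^bold>\<and> f_prod_b b y \<^bold>\<and>
           (\<^bold>\<forall>i. \<langle>i \<in> underS r l\<rangle> \<^bold>\<longrightarrow> f_neq_star (?x i) D y)) iter_le s"
        using stage_le_refl[OF stage_le_conds(1)[OF q]] by blast
    qed
  qed
  show "\<not> ((\<langle>l \<in> Field r\<rangle> \<^bold>\<and> (\<^bold>\<forall>i. \<langle>i \<in> underS r l\<rangle> \<^bold>\<longrightarrow> f_prod_b b (?x i))) iter_le p \<and> (\<^bold>\<not> ?goal) iter_le p)"
    using main leq_refl[OF FieldI1[OF p]] unfolding forces_not[of ?goal] by blast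
qed

end

theorem lemma4p26:
  fixes b :: "nat \<Rightarrow> nat"
  assumes "\<forall>n. b n \<ge> 2 ^ n"
  shows "(LE_order b \<tturnstile>
            f_infinite (D_name b) \<^bold>\<and> f_prod_b b (y_name b) \<^bold>\<and>
            (\<^bold>\<forall>x. \<langle>x \<in> prod_b b\<rangle> \<^bold>\<longrightarrow>
               f_neq_star (check (LE_order b) (graph_of x)) (D_name b) (y_name b)))
       \<and> (\<forall>r :: 'i rel. Card_order r \<and> natLeq <o r \<and> regularCard r \<and> infinite (UNIV :: 'k set) \<longrightarrow>
            ((LE_iteration b r :: ('i, 'k) icond rel) \<tturnstile> f_bounding_ge b r))"
proof (intro conjI allI impI)
  show "LE_order b \<tturnstile> f_infinite (D_name b) \<^bold>\<and> f_prod_b b (y_name b) \<^bold>\<and>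
      (\<^bold>\<forall>x. \<langle>x \<in> prod_b b\<rangle> \<^bold>\<longrightarrow>
         f_neq_star (check (LE_order b) (graph_of x)) (D_name b) (y_name b))"
    by (rule LE_generic_pair) (use assms in blast)
next
  fix r :: "'i rel"
  assume r: "Card_order r \<and> natLeq <o r \<and> regularCard r \<and> infinite (UNIV :: 'k set)"
  interpret LE_iter b r "TYPE('k)"
    by unfold_locales (use assms r in \<open>auto simp: card_order_on_def\<close>)
  show "(LE_iteration b r :: ('i, 'k) icond rel) \<tturnstile> f_bounding_ge b r"
    unfolding LE_iteration_def using r by (intro iteration_bounding) auto
qed

end
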